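(* Let $X=(X_t)_{t\in T}$ be an infinitely divisible process of the form $X=G+Y$, where $G=(G_t)_{t\in T}$ is a centered Gaussian process independent of a Poissonian infinitely divisible process $Y=(Y_t)_{t\in T}$ having a $\sigma$-finite Lévy measure $\nu$ and given by its canonical spectral representation $$Y_t=\int_{\mathbb{R}^T}x(t)\,[N(dx)-\chi(x(t))\,\nu(dx)]+b(t),\qquad t\in T,$$ where $N$ is a Poisson random measure on $(\mathbb{R}^T,\mathcal{B}^T)$ with intensity $\nu$ and $b\in\mathbb{R}^T$. Let $Z=(Z_t)_{t\in T}$ be an arbitrary process such that $G$, $N$ and $Z$ are independent. (a) Suppose that $\mathcal{L}(Z)\ll\nu$ and let $q:=\frac{d\mathcal{L}(Z)}{d\nu}$ be the Radon–Nikodym derivative. Then for any measurable functional $F:\mathbb{R}^T\to\mathbb{R}$ $$\mathbb{E}F\big((X_t+Z_t)_{t\in T}\big)=\mathbb{E}\big[F\big((X_t)_{t\in T}\big)\,N(q)\big],\qquad N(q)=\int_{\mathbb{R}^T}q(x)\,N(dx).$$ Conversely, for any measurable functional $F:\mathbb{R}^T\to\mathbb{R}$, $$\mathbb{E}\big[F\big((X_t)_{t\in T}\big)\mathbf{1}_{\{N(q)>0\}}\big]=\mathbb{E}\big[F\big((X_t+Z_t)_{t\in T}\big)\,(N(q)+q(Z))^{-1}\big],$$ where $q(Z)=q((Z_t)_{t\in T})$. Moreover, if $\nu\{x:q(x)>0\}=\infty$, then $\mathcal{L}(Y+Z)$ and $\mathcal{L}(Y)$ are equivalent. (b) Suppose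 that $\mathcal{L}(Z)\ll\nu+\delta_{0_T}$ and let $q:=\frac{d\mathcal{L}(Z)}{d(\nu+\delta_{0_T})}$. Then for any measurable functional $F:\mathbb{R}^T\to\mathbb{R}$ $$\mathbb{E}F\big((X_t+Z_t)_{t\in T}\big)=\mathbb{E}\big[F\big((X_t)_{t\in T}\big)\,(N(q)+q(0_T))\big].$$ Conversely, for any measurable functional $F:\mathbb{R}^T\to\mathbb{R}$, $$\mathbb{E}\big[F\big((X_t)_{t\in T}\big)\mathbf{1}_{\{N(q)+q(0_T)>0\}}\big]=\mathbb{E}\Big[F\big((X_t+Z_t)_{t\in T}\big)\big(N(q)+q(Z)+q(0_T)\mathbf{1}_{U^c}(Z)\big)^{-1}\Big],$$ where $q(Z)=q((Z_t)_{t\in T})$ and $U\in\mathcal{B}^T$ is such that $0_T\in U$ and $\nu(U)=0$. Furthermore, $\mathcal{L}(Y+Z)$ and $\mathcal{L}(Y)$ are equivalent if $q(0_T)>0$ or $\nu\{x:q(x)>0\}=\infty$.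
   Context: $T$ is an arbitrary nonempty set, $\mathbb{R}^T$ the space of all functions $x:T\to\mathbb{R}$, $\mathcal{B}^T$ its cylindrical (product) $\sigma$-algebra, $0_T$ the zero function, $\delta_{0_T}$ the unit mass at $0_T$. $\mathcal{L}(Z)$ is the law of $Z$ on $(\mathbb{R}^T,\mathcal{B}^T)$; $\ll$ is absolute continuity; measures are equivalent if mutually absolutely continuous. Convention $0\cdot\infty=0$. An identity between expectations reads: if one side exists then the other does and they are equal. A measure $\nu$ on $(\mathbb{R}^T,\mathcal{B}^T)$ is a Lévy measure if (L1) $\int|x(t)|^2\wedge1\,\nu(dx)<\infty$ for every $t\in T$, and (L2) $\nu(A)=\nu_*(A\setminus\{0_T\})$ for every $A\in\mathcal{B}^T$, where $\nu_*(E)=\sup\{\nu(D):D\subset E,\ D\in\mathcal{B}^T\}$. A cutoff function is a fixed bounded measurable $\chi:\mathbb{R}\to\mathbb{R}$ with $\chi(v)=1+o(|v|)$ as $v\to0$ and $\chi(v)=O(|v|^{-1})$ as $|v|\to\infty$. A process is (Poissonian) infinitely divisible if all its finite-dimensional distributions are infinitely divisible (without Gaussian part). The Poissonian process $Y$ in the claim has Lévy measure $\nu$ and shift $b$, meaning that for all finite nonempty $I\subset T$, $a\in\mathbb{R}^I$: $\mathbb{E}e^{i\sum_{t\in I}a_tY_t}=\exp\{\int_{\mathbb{R}^T}(e^{i\sum_{t\in I}a_tx(t)}-1-i\sum_{t\in I}a_tx(t)\chi(x(t)))\,\nu(dx)+i\sum_{t\in I}a_tb(t)\}$. A Poisson random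 measure $N$ on $(S,\mathcal{S})$ with intensity $n$ is a family $(N(A))_{A\in\mathcal{S}}$ with $N(A)$ Poisson with mean $n(A)$ ($N(A)=\infty$ a.s. if $n(A)=\infty$), independent over disjoint sets, and countably additive a.s. For measurable $f$ with $\int f^2\wedge1\,dn<\infty$, $\int f\,[dN-\chi(f)\,dn]$ denotes $\int f\mathbf{1}_{\{|f|\le1\}}d(N-n)+\int f\mathbf{1}_{\{|f|>1\}}dN+\int f(\mathbf{1}_{\{|f|\le1\}}-\chi(f))\,dn$, the first term being the $L^2$-limit of integrals of simple functions. *)

theory Defs
  imports "HOL-Probability.Probability" "HOL-Library.Landau_Symbols"
begin

text \<open>
  The index set of the processes is the type \<open>'t\<close>, so \<open>'t \<Rightarrow> real\<close> is the space of all real functions on it.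
  A process is a family \<open>X :: 't \<Rightarrow> 'w \<Rightarrow> real\<close> of random variables on a probability space \<open>M\<close>.
\<close>

abbreviation cyl :: "('t \<Rightarrow> real) measure" where
  "cyl \<equiv> Pi\<^sub>M UNIV (\<lambda>_. borel)"

abbreviation (input) zero_path :: "'t \<Rightarrow> real" where
  "zero_path \<equiv> (\<lambda>_. 0)"

abbreviation (input) sample_path :: "('t \<Rightarrow> 'w \<Rightarrow> real) \<Rightarrow> 'w \<Rightarrow> 't \<Rightarrow> real" where
  "sample_path X \<equiv> (\<lambda>\<omega> t. X t \<omega>)"

definition stoch_process :: "'w measure \<Rightarrow> ('t \<Rightarrow> 'w \<Rightarrow> real) \<Rightarrow> bool" where
  "stoch_process M X \<longleftrightarrow> (\<forall>t. X t \<in> borel_measurable M)"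

definition law :: "'w measure \<Rightarrow> ('t \<Rightarrow> 'w \<Rightarrow> real) \<Rightarrow> ('t \<Rightarrow> real) measure" where
  "law M X = distr M cyl (sample_path X)"


section \<open>Measures\<close>

definition add_measure :: "'a measure \<Rightarrow> 'a measure \<Rightarrow> 'a measure" where
  "add_measure M N = measure_of (space M) (sets M) (\<lambda>A. emeasure M A + emeasure N A)"

lemma space_add_measure [simp]: "space (add_measure M N) = space M"
  and sets_add_measure [simp, measurable_cong]: "sets (add_measure M N) = sets M"
  by (auto simp: add_measure_def)

lemma emeasure_add_measure:
  assumes "sets M = sets N" "A \<in> sets M"
  shows "emeasure (add_measure M N) A = emeasure M A + emeasure N A"
  unfolding add_measure_def
proof (rule emeasure_measure_of_sigma)
  show "sigma_algebra (space M) (sets M)" ..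
  show "positive (sets M) (\<lambda>A. emeasure M A + emeasure N A)"
    by (simp add: positive_def)
  show "countably_additive (sets M) (\<lambda>A. emeasure M A + emeasure N A)"
  proof (rule countably_additiveI)
    fix A :: "nat \<Rightarrow> 'a set" assume A: "range A \<subseteq> sets M" "disjoint_family A"
    have N: "range A \<subseteq> sets N"
      using A(1) assms(1) by blast
    have "(\<Sum>i. emeasure M (A i) + emeasure N (A i))
        = (\<Sum>i. emeasure M (A i)) + (\<Sum>i. emeasure N (A i))"
      by (rule suminf_add [symmetric]) (rule summableI)+
    also have "\<dots> = emeasure M (\<Union>i. A i) + emeasure N (\<Union>i. A i)"
      by (simp only: suminf_emeasure [OF A] suminf_emeasure [OF N A(2)])
    finally show "(\<Sum>i. emeasure M (A i) + emeasure N (A i))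
        = emeasure M (\<Union>i. A i) + emeasure N (\<Union>i. A i)" .
  qed
qed fact

definition equivalent_measures :: "'a measure \<Rightarrow> 'a measure \<Rightarrow> bool" where
  "equivalent_measures M N \<longleftrightarrow> absolutely_continuous M N \<and> absolutely_continuous N M"

text \<open>\<open>q\<close> is a version of \<open>dN/dM\<close>; this is the property by which \<^const>\<open>RN_deriv\<close> selects one version.\<close>

definition is_RN_deriv :: "'a measure \<Rightarrow> 'a measure \<Rightarrow> ('a \<Rightarrow> ennreal) \<Rightarrow> bool" where
  "is_RN_deriv M N q \<longleftrightarrow> q \<in> borel_measurable M \<and> density M q = N"

text \<open>
  The second conjunct says \<open>\<nu> A = \<nu>\<^sub>* (A - {0})\<close>; the inner measure is needed because the singleton
  of the zero path is not a cylindrical event when the index set is uncountable.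
\<close>

definition levy_measure :: "('t \<Rightarrow> real) measure \<Rightarrow> bool" where
  "levy_measure \<nu> \<longleftrightarrow> sets \<nu> = sets cyl
     \<and> (\<forall>t. (\<integral>\<^sup>+x. ennreal (min (\<bar>x t\<bar>\<^sup>2) 1) \<partial>\<nu>) < \<infinity>)
     \<and> (\<forall>A\<in>sets \<nu>. emeasure \<nu> A = (SUP D\<in>{D \<in> sets \<nu>. D \<subseteq> A - {zero_path}}. emeasure \<nu> D))"

definition cutoff_function :: "(real \<Rightarrow> real) \<Rightarrow> bool" where
  "cutoff_function chi \<longleftrightarrow> chi \<in> borel_measurable borel \<and> bounded (range chi)
     \<and> (\<lambda>v. chi v - 1) \<in> o[at 0](\<lambda>v. \<bar>v\<bar>)
     \<and> chi \<in> O[at_infinity](\<lambda>v. inverse \<bar>v\<bar>)"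


section \<open>Classes of processes\<close>

definition centered_gaussian_process :: "'w measure \<Rightarrow> ('t \<Rightarrow> 'w \<Rightarrow> real) \<Rightarrow> bool" where
  "centered_gaussian_process M G \<longleftrightarrow> stoch_process M G
     \<and> (\<forall>I a. finite I \<longrightarrow>
          (AE \<omega> in M. (\<Sum>t\<in>I. a t * G t \<omega>) = 0)
          \<or> (\<exists>\<sigma>>0. distributed M lborel (\<lambda>\<omega>. \<Sum>t\<in>I. a t * G t \<omega>) (normal_density 0 \<sigma>)))"

text \<open>\<open>\<mu>\<close>, on \<open>I \<rightarrow> \<real>\<close>, is for every \<open>n \<ge> 1\<close> the \<open>n\<close>-th convolution power of a probability measure.\<close>

definition inf_divisible :: "'t set \<Rightarrow> ('t \<Rightarrow> real) measure \<Rightarrow> bool" where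
  "inf_divisible I \<mu> \<longleftrightarrow>
     (\<forall>n\<ge>1::nat. \<exists>\<rho>. prob_space \<rho> \<and> sets \<rho> = sets (Pi\<^sub>M I (\<lambda>_. borel))
        \<and> \<mu> = distr (Pi\<^sub>M {..<n} (\<lambda>_. \<rho>)) (Pi\<^sub>M I (\<lambda>_. borel)) (\<lambda>y. \<lambda>t\<in>I. \<Sum>k<n. y k t))"

definition id_process :: "'w measure \<Rightarrow> ('t \<Rightarrow> 'w \<Rightarrow> real) \<Rightarrow> bool" where
  "id_process M X \<longleftrightarrow> stoch_process M X
     \<and> (\<forall>I. finite I \<and> I \<noteq> {} \<longrightarrow>
          inf_divisible I (distr M (Pi\<^sub>M I (\<lambda>_. borel)) (\<lambda>\<omega>. \<lambda>t\<in>I. X t \<omega>)))"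

text \<open>
  Poissonian infinitely divisible process with Levy measure \<open>\<nu>\<close> and shift \<open>b\<close>: the absence of a
  Gaussian part is visible in the characteristic functions.
\<close>

definition poissonian_id_process ::
  "'w measure \<Rightarrow> (real \<Rightarrow> real) \<Rightarrow> ('t \<Rightarrow> real) measure \<Rightarrow> ('t \<Rightarrow> real) \<Rightarrow> ('t \<Rightarrow> 'w \<Rightarrow> real) \<Rightarrow> bool" where
  "poissonian_id_process M chi \<nu> b Y \<longleftrightarrow> id_process M Y
     \<and> (\<forall>I a. finite I \<and> I \<noteq> {} \<longrightarrow>
          (CLINT \<omega>|M. iexp (\<Sum>t\<in>I. a t * Y t \<omega>))
          = exp ((CLINT x|\<nu>. iexp (\<Sum>t\<in>I. a t * x t) - 1
                     - \<i> * complex_of_real (\<Sum>t\<in>I. a t * x t * chi (x t)))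
                 + \<i> * complex_of_real (\<Sum>t\<in>I. a t * b t)))"


section \<open>Poisson random measures\<close>

definition has_poisson_law :: "'w measure \<Rightarrow> ('w \<Rightarrow> ennreal) \<Rightarrow> ennreal \<Rightarrow> bool" where
  "has_poisson_law M X m \<longleftrightarrow>
     (m = 0 \<longrightarrow> (AE \<omega> in M. X \<omega> = 0))
     \<and> (0 < m \<and> m < \<infinity> \<longrightarrow> distr M borel X = distr (poisson_pmf (enn2real m)) borel of_nat)
     \<and> (m = \<infinity> \<longrightarrow> (AE \<omega> in M. X \<omega> = \<infinity>))"

text \<open>
  \<open>N\<close> is a family indexed by the measurable sets. Countable additivity holds almost surely for each
  disjoint sequence, the exceptional event depending on the sequence, so \<open>\<lambda>A. N A \<omega>\<close> need not be a
  measure for any \<open>\<omega>\<close>.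
\<close>

definition poisson_random_measure :: "'w measure \<Rightarrow> 's measure \<Rightarrow> ('s set \<Rightarrow> 'w \<Rightarrow> ennreal) \<Rightarrow> bool" where
  "poisson_random_measure M n N \<longleftrightarrow>
     (\<forall>A\<in>sets n. N A \<in> borel_measurable M \<and> has_poisson_law M (N A) (emeasure n A))
     \<and> (\<forall>(A :: nat \<Rightarrow> 's set) I. A ` I \<subseteq> sets n \<and> disjoint_family_on A I \<longrightarrow>
          prob_space.indep_vars M (\<lambda>_. borel) (\<lambda>i. N (A i)) I)
     \<and> (\<forall>A :: nat \<Rightarrow> 's set. range A \<subseteq> sets n \<and> disjoint_family A \<longrightarrow>
          (AE \<omega> in M. N (\<Union>i. A i) \<omega> = (\<Sum>i. N (A i) \<omega>)))"

text \<open>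
  Since \<open>N\<close> need not be a measure for fixed \<open>\<omega>\<close>, integrals with respect to \<open>N\<close> are limits of
  integrals of simple functions. They are determined up to almost sure equality, and the predicates
  below say that \<open>J\<close> is a version of the integral. The first one is \<open>J = \<integral> f dN\<close> for \<open>f\<close> with values in
  \<open>[0, \<infinity>]\<close>.
\<close>

definition prm_nn_integral ::
  "'w measure \<Rightarrow> 's measure \<Rightarrow> ('s set \<Rightarrow> 'w \<Rightarrow> ennreal) \<Rightarrow> ('s \<Rightarrow> ennreal) \<Rightarrow> ('w \<Rightarrow> ennreal) \<Rightarrow> bool" where
  "prm_nn_integral M n N f J \<longleftrightarrow> J \<in> borel_measurable M
     \<and> (\<exists>s :: nat \<Rightarrow> 's \<Rightarrow> ennreal. (\<forall>k. simple_function n (s k))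
          \<and> (\<forall>x\<in>space n. incseq (\<lambda>k. s k x) \<and> (\<lambda>k. s k x) \<longlonglongrightarrow> f x)
          \<and> (AE \<omega> in M. (\<lambda>k. \<Sum>y\<in>s k ` space n. y * N (s k -` {y} \<inter> space n) \<omega>) \<longlonglongrightarrow> J \<omega>))"

text \<open>\<open>J = \<integral> f dN\<close> for real-valued \<open>f\<close>, as \<open>\<integral> f\<^sup>+ dN - \<integral> f\<^sup>- dN\<close> with both parts finite.\<close>

definition prm_integral ::
  "'w measure \<Rightarrow> 's measure \<Rightarrow> ('s set \<Rightarrow> 'w \<Rightarrow> ennreal) \<Rightarrow> ('s \<Rightarrow> real) \<Rightarrow> ('w \<Rightarrow> real) \<Rightarrow> bool" where
  "prm_integral M n N f J \<longleftrightarrow> J \<in> borel_measurable M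
     \<and> (\<exists>P Q. prm_nn_integral M n N (\<lambda>x. ennreal (f x)) P
          \<and> prm_nn_integral M n N (\<lambda>x. ennreal (- f x)) Q
          \<and> (AE \<omega> in M. P \<omega> < \<infinity> \<and> Q \<omega> < \<infinity> \<and> J \<omega> = enn2real (P \<omega>) - enn2real (Q \<omega>)))"

text \<open>\<open>\<integral> s d(N - n)\<close> for simple \<open>s\<close> supported on a set of finite measure\<close>

definition compensated_simple_integral ::
  "'s measure \<Rightarrow> ('s set \<Rightarrow> 'w \<Rightarrow> ennreal) \<Rightarrow> ('s \<Rightarrow> real) \<Rightarrow> 'w \<Rightarrow> real" where
  "compensated_simple_integral n N s \<omega> =
     (\<Sum>y\<in>s ` space n - {0}. y * (enn2real (N (s -` {y} \<inter> space n) \<omega>) - measure n (s -` {y} \<inter> space n)))"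

text \<open>\<open>J = \<integral> f d(N - n)\<close> as an \<open>L\<^sup>2\<close>-limit\<close>

definition prm_L2_integral ::
  "'w measure \<Rightarrow> 's measure \<Rightarrow> ('s set \<Rightarrow> 'w \<Rightarrow> ennreal) \<Rightarrow> ('s \<Rightarrow> real) \<Rightarrow> ('w \<Rightarrow> real) \<Rightarrow> bool" where
  "prm_L2_integral M n N f J \<longleftrightarrow> J \<in> borel_measurable M
     \<and> (\<exists>s :: nat \<Rightarrow> 's \<Rightarrow> real.
          (\<forall>k. simple_function n (s k) \<and> emeasure n {x \<in> space n. s k x \<noteq> 0} < \<infinity>)
          \<and> (\<lambda>k. \<integral>\<^sup>+x. ennreal ((s k x - f x)\<^sup>2) \<partial>n) \<longlonglongrightarrow> 0
          \<and> (\<lambda>k. \<integral>\<^sup>+\<omega>. ennreal ((compensated_simple_integral n N (s k) \<omega> - J \<omega>)\<^sup>2) \<partial>M) \<longlonglongrightarrow> 0)"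

text \<open>\<open>J = \<integral> f [dN - chi(f) dn]\<close>\<close>

definition prm_compensated_integral ::
  "'w measure \<Rightarrow> 's measure \<Rightarrow> ('s set \<Rightarrow> 'w \<Rightarrow> ennreal) \<Rightarrow> (real \<Rightarrow> real) \<Rightarrow> ('s \<Rightarrow> real) \<Rightarrow> ('w \<Rightarrow> real) \<Rightarrow> bool" where
  "prm_compensated_integral M n N chi f J \<longleftrightarrow>
     f \<in> borel_measurable n \<and> (\<integral>\<^sup>+x. ennreal (min ((f x)\<^sup>2) 1) \<partial>n) < \<infinity>
     \<and> J \<in> borel_measurable M
     \<and> (\<exists>J\<^sub>1 J\<^sub>2.
          prm_L2_integral M n N (\<lambda>x. f x * indicator {x. \<bar>f x\<bar> \<le> 1} x) J\<^sub>1
          \<and> prm_integral M n N (\<lambda>x. f x * indicator {x. \<bar>f x\<bar> > 1} x) J\<^sub>2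
          \<and> (AE \<omega> in M. J \<omega> = J\<^sub>1 \<omega> + J\<^sub>2 \<omega>
                + (\<integral>x. f x * (indicator {x. \<bar>f x\<bar> \<le> 1} x - chi (f x)) \<partial>n)))"

text \<open>\<open>Y\<^sub>t = \<integral> x(t) [N(dx) - chi(x(t)) \<nu>(dx)] + b(t)\<close> for every \<open>t\<close>\<close>

definition canonical_spectral_representation ::
  "'w measure \<Rightarrow> (real \<Rightarrow> real) \<Rightarrow> ('t \<Rightarrow> real) measure \<Rightarrow> (('t \<Rightarrow> real) set \<Rightarrow> 'w \<Rightarrow> ennreal)
     \<Rightarrow> ('t \<Rightarrow> real) \<Rightarrow> ('t \<Rightarrow> 'w \<Rightarrow> real) \<Rightarrow> bool" where
  "canonical_spectral_representation M chi \<nu> N b Y \<longleftrightarrow>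
     (\<forall>t. prm_compensated_integral M \<nu> N chi (\<lambda>x. x t) (\<lambda>\<omega>. Y t \<omega> - b t))"


section \<open>Independence of two processes and a random measure\<close>

text \<open>
  Independence of the sigma-algebras generated by the three objects. \<^const>\<open>prob_space.indep_vars\<close> does
  not apply because they take values in spaces of different types.
\<close>

definition gen_events :: "'w measure \<Rightarrow> 'a measure \<Rightarrow> ('w \<Rightarrow> 'a) \<Rightarrow> 'w set set" where
  "gen_events M K X = {X -` A \<inter> space M | A. A \<in> sets K}"

definition independent_GNZ ::
  "'w measure \<Rightarrow> 's measure \<Rightarrow> ('t \<Rightarrow> 'w \<Rightarrow> real) \<Rightarrow> ('s set \<Rightarrow> 'w \<Rightarrow> ennreal) \<Rightarrow> ('t \<Rightarrow> 'w \<Rightarrow> real) \<Rightarrow> bool" where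
  "independent_GNZ M n G N Z \<longleftrightarrow>
     prob_space.indep_sets M
       (\<lambda>i::nat. [gen_events M cyl (sample_path G),
                  gen_events M (Pi\<^sub>M (sets n) (\<lambda>_. borel)) (\<lambda>\<omega>. \<lambda>A\<in>sets n. N A \<omega>),
                  gen_events M cyl (sample_path Z)] ! i) {..<3}"


section \<open>Identities between expectations\<close>

text \<open>
  An expectation exists if the positive or the negative part has finite expectation; its value may
  then be infinite. Note that \<open>0 * \<infinity> = 0\<close> in \<^typ>\<open>ereal\<close>.
\<close>

definition expectation_exists :: "'w measure \<Rightarrow> ('w \<Rightarrow> ereal) \<Rightarrow> bool" where
  "expectation_exists M f \<longleftrightarrow> f \<in> borel_measurable M
     \<and> ((\<integral>\<^sup>+\<omega>. e2ennreal (f \<omega>) \<partial>M) < \<infinity> \<or> (\<integral>\<^sup>+\<omega>. e2ennreal (- f \<omega>) \<partial>M) < \<infinity>)"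

definition ext_expectation :: "'w measure \<Rightarrow> ('w \<Rightarrow> ereal) \<Rightarrow> ereal" where
  "ext_expectation M f =
     enn2ereal (\<integral>\<^sup>+\<omega>. e2ennreal (f \<omega>) \<partial>M) - enn2ereal (\<integral>\<^sup>+\<omega>. e2ennreal (- f \<omega>) \<partial>M)"

definition expectation_identity :: "'w measure \<Rightarrow> ('w \<Rightarrow> ereal) \<Rightarrow> ('w \<Rightarrow> ereal) \<Rightarrow> bool" where
  "expectation_identity M f g \<longleftrightarrow>
     (expectation_exists M f \<or> expectation_exists M g \<longrightarrow>
        expectation_exists M f \<and> expectation_exists M g \<and> ext_expectation M f = ext_expectation M g)"

end

theory Submission
  imports Defs
begin

text \<open>
  The proof is Mecke's identity read as an absolute continuity statement. Write \<open>N + \<delta>\<^sub>z\<close> for the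
  configuration with one more point at \<open>z\<close>. For every measurable functional \<open>H \<ge> 0\<close>,
  \<open>E[H(N) N(q)] = \<integral> q(z) E[H(N + \<delta>\<^sub>z)] \<nu>(dz)\<close> (lemma \<open>mecke\<close>). The process \<open>Y\<close> and the variable \<open>N(q)\<close> are
  stochastic integrals, hence additive in the configuration: an additional point at the path \<open>z\<close> changes
  \<open>Y\<close> into \<open>Y + z\<close> and \<open>N(q)\<close> into \<open>N(q) + q(z)\<close>. If \<open>Z\<close> is independent with law \<open>q \<nu>\<close>, the identity thus says
  that \<open>(X + Z, N(q) + q(Z))\<close> is distributed like \<open>(X, N(q))\<close> under the probability \<open>N(q) dP\<close>; \<open>G\<close> is
  independent of both and can be held fixed. The first formula is the first marginal of this statement. The converse
  formula is the statement for the test function \<open>F(x) / s\<close>, and equivalence of the laws holds as soon as the density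
  \<open>N(q)\<close> is almost surely positive. An atom of the law of \<open>Z\<close> of mass \<open>c\<close> at the zero path contributes
  \<open>c E[F(X)]\<close>, which replaces \<open>N(q)\<close> by \<open>N(q) + c\<close>.

  Two points need care. First, the random measure is only a family of random variables indexed by sets, and
  integrals are limits in \<open>L\<^sup>2\<close> or almost surely, so \<open>N + \<delta>\<^sub>z\<close> cannot be plugged into them pathwise. The
  realisation is regarded as a random element of a product space. There Mecke's identity follows
  from its version for finitely many independent Poisson variables (\<open>mecke_cylinder\<close>) because measures on a
  product space are determined by cylinders. That a stochastic integral is a measurable functional with the right
  increment is the predicate \<open>point_additive\<close>, which passes to almost everywhere limits.

  Secondly, the index set may be uncountable, so \<open>Y\<close> is a functional of the configuration only time by time,
  with an exceptional event for each time. A measurable functional of the path depends on countably many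
  coordinates (\<open>countable_coordinates\<close>), which makes this sufficient.
\<close>

section \<open>The shift identity for independent Poisson variables\<close>

text \<open>
  This rests on \<open>j * P(X = j) = m * P(X = j - 1)\<close>; summing against \<open>g\<close> and moving the index by one
  turns the weight \<open>X\<close> into a jump of size one.
\<close>
lemma poisson_law_shift:
  assumes [measurable]: "X \<in> borel_measurable M" and X: "has_poisson_law M X m" and m: "m < \<infinity>"
    and [measurable]: "g \<in> borel_measurable borel"
  shows "(\<integral>\<^sup>+\<omega>. g (X \<omega>) * X \<omega> \<partial>M) = m * (\<integral>\<^sup>+\<omega>. g (X \<omega> + 1) \<partial>M)"
proof (cases "m = 0")
  case True
  then have "AE \<omega> in M. X \<omega> = 0"
    using X by (simp add: has_poisson_law_def)
  then have "(\<integral>\<^sup>+\<omega>. g (X \<omega>) * X \<omega> \<partial>M) = (\<integral>\<^sup>+\<omega>. 0 \<partial>M)"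
    by (intro nn_integral_cong_AE) auto
  with True show ?thesis by simp
next
  case False
  define r where "r = enn2real m"
  have r: "r > 0" and mr: "m = ennreal r"
    using False m by (auto simp: r_def enn2real_positive_iff zero_less_iff_neq_zero less_top)
  have D: "distr M borel X = distr (poisson_pmf r) borel of_nat"
    using X False m by (simp add: has_poisson_law_def r_def zero_less_iff_neq_zero)
  have int: "(\<integral>\<^sup>+\<omega>. k (X \<omega>) \<partial>M) = (\<Sum>j. ennreal (r ^ j / fact j * exp (- r)) * k (of_nat j))"
    if [measurable]: "k \<in> borel_measurable borel" for k :: "ennreal \<Rightarrow> ennreal"
  proof -
    have "(\<integral>\<^sup>+\<omega>. k (X \<omega>) \<partial>M) = (\<integral>\<^sup>+y. k y \<partial>distr M borel X)"
      by (simp add: nn_integral_distr)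
    also have "\<dots> = (\<integral>\<^sup>+j. k (of_nat j) \<partial>measure_pmf (poisson_pmf r))"
      unfolding D by (subst nn_integral_distr) simp_all
    also have "\<dots> = (\<Sum>j. ennreal (r ^ j / fact j * exp (- r)) * k (of_nat j))"
      using r by (simp add: nn_integral_measure_pmf nn_integral_count_space_nat)
    finally show ?thesis .
  qed
  have "(\<integral>\<^sup>+\<omega>. g (X \<omega>) * X \<omega> \<partial>M)
      = (\<Sum>j. ennreal (r ^ j / fact j * exp (- r)) * (g (of_nat j) * of_nat j))"
    using int[of "\<lambda>y. g y * y"] by simp
  also have "\<dots> = (\<Sum>j. ennreal (r ^ Suc j / fact (Suc j) * exp (- r)) * (g (of_nat (Suc j)) * of_nat (Suc j)))"
    using suminf_offset[OF summableI, of "\<lambda>j. ennreal (r ^ j / fact j * exp (- r)) * (g (of_nat j) * of_nat j)" 1]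
    by simp
  also have "\<dots> = (\<Sum>j. m * (ennreal (r ^ j / fact j * exp (- r)) * g (of_nat j + 1)))"
  proof (rule suminf_cong)
    fix j
    have "ennreal (r ^ Suc j / fact (Suc j) * exp (- r)) * of_nat (Suc j)
        = ennreal (r ^ Suc j / fact (Suc j) * exp (- r) * real (Suc j))"
      using r by (subst ennreal_mult'') (auto simp: ennreal_of_nat_eq_real_of_nat)
    also have "r ^ Suc j / fact (Suc j) * exp (- r) * real (Suc j) = r * (r ^ j / fact j * exp (- r))"
      by (simp add: field_simps del: of_nat_Suc)
    also have "ennreal \<dots> = m * ennreal (r ^ j / fact j * exp (- r))"
      unfolding mr using r by (intro ennreal_mult) auto
    finally have *: "ennreal (r ^ Suc j / fact (Suc j) * exp (- r)) * of_nat (Suc j)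
        = m * ennreal (r ^ j / fact j * exp (- r))" .
    have "ennreal (r ^ Suc j / fact (Suc j) * exp (- r)) * (g (of_nat (Suc j)) * of_nat (Suc j))
       = (ennreal (r ^ Suc j / fact (Suc j) * exp (- r)) * of_nat (Suc j)) * g (of_nat (Suc j))"
      by (simp only: ac_simps)
    also have "\<dots> = m * (ennreal (r ^ j / fact j * exp (- r)) * g (of_nat j + 1))"
      unfolding * by (simp add: ac_simps)
    finally show "ennreal (r ^ Suc j / fact (Suc j) * exp (- r)) * (g (of_nat (Suc j)) * of_nat (Suc j))
       = m * (ennreal (r ^ j / fact j * exp (- r)) * g (of_nat j + 1))" .
  qed
  also have "\<dots> = m * (\<integral>\<^sup>+\<omega>. g (X \<omega> + 1) \<partial>M)"
    using int[of "\<lambda>y. g (y + 1)"] by simp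
  finally show ?thesis .
qed

text \<open>
  By Fubini, the one-dimensional identity applies in coordinate \<open>k\<close> with the other coordinates held fixed.
\<close>
lemma (in prob_space) indep_poisson_shift:
  fixes X :: "'i \<Rightarrow> 'a \<Rightarrow> ennreal"
  assumes ind: "indep_vars (\<lambda>_. borel) X I" and I: "finite I" "k \<in> I"
    and X: "has_poisson_law M (X k) m" "m < \<infinity>"
    and h [measurable]: "h \<in> borel_measurable (Pi\<^sub>M I (\<lambda>_. borel))"
  shows "(\<integral>\<^sup>+\<omega>. h (\<lambda>i\<in>I. X i \<omega>) * X k \<omega> \<partial>M)
       = m * (\<integral>\<^sup>+\<omega>. h ((\<lambda>i\<in>I. X i \<omega>)(k := X k \<omega> + 1)) \<partial>M)"
proof -
  have rv: "X i \<in> borel_measurable M" if "i \<in> I" for i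
    using ind that by (auto simp: indep_vars_def2)
  note [measurable] = rv[OF I(2)]
  \<comment> \<open>Outside \<open>I\<close> any probability measure will do: the product measure locale
    wants one at every index.\<close>
  define Q where "Q i = (if i \<in> I then distr M borel (X i) else return borel 0)" for i
  have Qp: "prob_space (Q i)" for i
    by (auto simp: Q_def intro!: prob_space_distr rv prob_space_return)
  interpret Q: product_sigma_finite Q
    using Qp by (auto simp: product_sigma_finite_def intro: prob_space_imp_sigma_finite)
  have sQ [measurable_cong, simp]: "sets (Q i) = sets borel" for i
    by (simp add: Q_def)
  have sP: "sets (Pi\<^sub>M J Q) = sets (Pi\<^sub>M J (\<lambda>_. borel))" for J
    by (intro sets_PiM_cong) auto
  have D: "distr M (Pi\<^sub>M I (\<lambda>_. borel)) (\<lambda>\<omega>. \<lambda>i\<in>I. X i \<omega>) = Pi\<^sub>M I Q"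
  proof -
    have "distr M (Pi\<^sub>M I (\<lambda>_. borel)) (\<lambda>\<omega>. \<lambda>i\<in>I. X i \<omega>) = (\<Pi>\<^sub>M i\<in>I. distr M borel (X i))"
      using ind I rv by (subst (asm) indep_vars_iff_distr_eq_PiM') auto
    also have "\<dots> = Pi\<^sub>M I Q"
      by (intro PiM_cong) (auto simp: Q_def)
    finally show ?thesis .
  qed
  have vec [measurable]: "(\<lambda>\<omega>. \<lambda>i\<in>I. X i \<omega>) \<in> measurable M (Pi\<^sub>M I (\<lambda>_. borel))"
    by (intro measurable_restrict rv)
  have kcomp [measurable]: "(\<lambda>x. x k :: ennreal) \<in> borel_measurable (Pi\<^sub>M I (\<lambda>_. borel))"
    using I(2) by measurable
  have upd [measurable]: "(\<lambda>x. x(k := x k + 1 :: ennreal)) \<in> measurable (Pi\<^sub>M I (\<lambda>_. borel)) (Pi\<^sub>M I (\<lambda>_. borel))"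
    using I(2) by (intro measurable_fun_upd[where J = I] borel_measurable_add kcomp) auto
  define J where "J = I - {k}"
  have J: "finite J" "k \<notin> J" "insert k J = I"
    using I by (auto simp: J_def)
  have m1: "(\<lambda>x. h x * x k) \<in> borel_measurable (Pi\<^sub>M (insert k J) Q)"
    using h kcomp unfolding J measurable_cong_sets[OF sP refl] by measurable
  have m2: "(\<lambda>x. h (x(k := x k + 1))) \<in> borel_measurable (Pi\<^sub>M (insert k J) Q)"
    unfolding J measurable_cong_sets[OF sP refl] using measurable_compose[OF upd h] by simp
  have "(\<integral>\<^sup>+\<omega>. h (\<lambda>i\<in>I. X i \<omega>) * X k \<omega> \<partial>M) = (\<integral>\<^sup>+x. h x * x k \<partial>Pi\<^sub>M I Q)"
    unfolding D[symmetric] using I(2)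
    by (subst nn_integral_distr[OF vec]) (auto intro: borel_measurable_times h kcomp)
  also have "\<dots> = (\<integral>\<^sup>+x. \<integral>\<^sup>+y. h (x(k := y)) * y \<partial>Q k \<partial>Pi\<^sub>M J Q)"
    using Q.product_nn_integral_insert[OF J(1,2) m1] by (simp add: J)
  also have "\<dots> = (\<integral>\<^sup>+x. m * (\<integral>\<^sup>+y. h (x(k := y + 1)) \<partial>Q k) \<partial>Pi\<^sub>M J Q)"
  proof (rule nn_integral_cong)
    fix x assume x: "x \<in> space (Pi\<^sub>M J Q)"
    then have x': "x \<in> space (Pi\<^sub>M J (\<lambda>_. borel))"
      using sets_eq_imp_space_eq[OF sP[of J]] by simp
    have hx: "(\<lambda>y. h (x(k := y))) \<in> borel_measurable borel"
    proof -
      have "(\<lambda>y. x(k := y)) \<in> measurable borel (Pi\<^sub>M (insert k J) (\<lambda>_. borel))"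
        using x' by measurable
      from measurable_compose[OF this[unfolded J] h] show ?thesis .
    qed
    note [measurable] = hx
    have "(\<integral>\<^sup>+y. h (x(k := y)) * y \<partial>Q k) = (\<integral>\<^sup>+\<omega>. h (x(k := X k \<omega>)) * X k \<omega> \<partial>M)"
      using I(2) by (simp add: Q_def nn_integral_distr)
    also have "\<dots> = m * (\<integral>\<^sup>+\<omega>. h (x(k := X k \<omega> + 1)) \<partial>M)"
      using poisson_law_shift[OF _ X, of "\<lambda>y. h (x(k := y))"] by simp
    also have "\<dots> = m * (\<integral>\<^sup>+y. h (x(k := y + 1)) \<partial>Q k)"
      using I(2) by (simp add: Q_def nn_integral_distr)
    finally show "(\<integral>\<^sup>+y. h (x(k := y)) * y \<partial>Q k) = m * (\<integral>\<^sup>+y. h (x(k := y + 1)) \<partial>Q k)" .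
  qed
  also have "\<dots> = m * (\<integral>\<^sup>+x. \<integral>\<^sup>+y. h (x(k := y + 1)) \<partial>Q k \<partial>Pi\<^sub>M J Q)"
  proof (rule nn_integral_cmult)
    have "(\<lambda>(x, y). x(k := y)) \<in> measurable (Pi\<^sub>M J Q \<Otimes>\<^sub>M Q k) (Pi\<^sub>M (insert k J) Q)"
      by (rule measurable_add_dim)
    from measurable_compose[OF this m2]
    have "(\<lambda>(x, y). h (x(k := y + 1))) \<in> borel_measurable (Pi\<^sub>M J Q \<Otimes>\<^sub>M Q k)"
      by (simp add: split_beta')
    then show "(\<lambda>x. \<integral>\<^sup>+y. h (x(k := y + 1)) \<partial>Q k) \<in> borel_measurable (Pi\<^sub>M J Q)"
      by (rule sigma_finite_measure.borel_measurable_nn_integral[OF prob_space_imp_sigma_finite[OF Qp]])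
  qed
  also have "(\<integral>\<^sup>+x. \<integral>\<^sup>+y. h (x(k := y + 1)) \<partial>Q k \<partial>Pi\<^sub>M J Q) = (\<integral>\<^sup>+x. h (x(k := x k + 1)) \<partial>Pi\<^sub>M I Q)"
    using Q.product_nn_integral_insert[OF J(1,2) m2] by (simp add: J)
  also have "\<dots> = (\<integral>\<^sup>+\<omega>. h ((\<lambda>i\<in>I. X i \<omega>)(k := X k \<omega> + 1)) \<partial>M)"
    unfolding D[symmetric] using I(2) measurable_compose[OF upd h]
    by (subst nn_integral_distr[OF vec]) auto
  finally show ?thesis .
qed

text \<open>
  The cells consist of the points with the same membership pattern with respect to \<open>\<B>\<close>. They are enumerated
  by natural numbers because the independence in the definition of a Poisson random measure is stated for
  sequences of sets. Some cells may be empty.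
\<close>
lemma finite_atoms:
  fixes n :: "'a measure"
  assumes fin: "finite \<B>" and B: "\<B> \<subseteq> sets n"
  obtains m :: nat and C :: "nat \<Rightarrow> 'a set" where
    "\<forall>i<m. C i \<in> sets n" "disjoint_family_on C {..<m}"
    "\<forall>i<m. \<forall>B\<in>\<B>. C i \<subseteq> B \<or> C i \<inter> B = {}"
    "\<forall>B\<in>\<B>. B = (\<Union>i\<in>{i. i < m \<and> C i \<subseteq> B}. C i)"
proof -
  define cl where "cl S = {y \<in> space n. \<forall>B\<in>\<B>. y \<in> B \<longleftrightarrow> B \<in> S}" for S
  define \<C> where "\<C> = cl ` Pow \<B>"
  have "finite \<C>"
    using fin by (simp add: \<C>_def)
  then obtain C where C: "bij_betw C {..<card \<C>} \<C>"
    by (metis ex_bij_betw_nat_finite atLeast0LessThan)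
  have Cin: "C i \<in> \<C>" if "i < card \<C>" for i
    using C that by (auto simp: bij_betw_def)
  have cl_sub: "cl S \<subseteq> B \<or> cl S \<inter> B = {}" if "B \<in> \<B>" for S B
    using that by (auto simp: cl_def)
  have disj: "cl S = cl S'" if "y \<in> cl S" "y \<in> cl S'" "S \<subseteq> \<B>" "S' \<subseteq> \<B>" for S S' y
    using that by (auto simp: cl_def)
  show ?thesis
  proof (rule that[of "card \<C>" C])
    have "cl S \<in> sets n" for S
    proof -
      have [measurable]: "Measurable.pred n (\<lambda>y. y \<in> B)" if "B \<in> \<B>" for B
        using that B by auto
      have "Measurable.pred n (\<lambda>y. \<forall>B\<in>\<B>. y \<in> B \<longleftrightarrow> B \<in> S)"
        by (intro pred_intros_finite fin) measurable
      then show ?thesis by (simp add: cl_def pred_def)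
    qed
    then show "\<forall>i<card \<C>. C i \<in> sets n"
      using Cin by (fastforce simp: \<C>_def)
    show "\<forall>i<card \<C>. \<forall>B\<in>\<B>. C i \<subseteq> B \<or> C i \<inter> B = {}"
    proof (intro allI impI ballI)
      fix i B assume "i < card \<C>" "B \<in> \<B>"
      then show "C i \<subseteq> B \<or> C i \<inter> B = {}"
        using Cin[of i] cl_sub[of B] by (auto simp: \<C>_def)
    qed
  next
    show "disjoint_family_on C {..<card \<C>}"
      unfolding disjoint_family_on_def
    proof (intro ballI impI)
      fix i j assume ij: "i \<in> {..<card \<C>}" "j \<in> {..<card \<C>}" "i \<noteq> j"
      then have ne: "C i \<noteq> C j"
        using C by (auto simp: bij_betw_def inj_on_def)
      obtain S S' where "C i = cl S" "C j = cl S'" "S \<subseteq> \<B>" "S' \<subseteq> \<B>"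
        using Cin[of i] Cin[of j] ij by (auto simp: \<C>_def)
      with ne disj show "C i \<inter> C j = {}" by blast
    qed
  next
    show "\<forall>B\<in>\<B>. B = (\<Union>i\<in>{i. i < card \<C> \<and> C i \<subseteq> B}. C i)"
    proof (intro ballI equalityI)
      fix B assume BB: "B \<in> \<B>"
      show "B \<subseteq> (\<Union>i\<in>{i. i < card \<C> \<and> C i \<subseteq> B}. C i)"
      proof
        fix x assume x: "x \<in> B"
        define S where "S = {B\<in>\<B>. x \<in> B}"
        have xs: "x \<in> space n"
          using x BB B sets.sets_into_space by blast
        have xcl: "x \<in> cl S" using xs by (auto simp: cl_def S_def)
        have "cl S \<in> \<C>" by (auto simp: \<C>_def S_def)
        then obtain i where i: "i < card \<C>" "C i = cl S"
          using C by (metis bij_betw_imp_surj_on imageE lessThan_iff)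
        have "cl S \<subseteq> B" using cl_sub[OF BB, of S] xcl x by auto
        with i xcl show "x \<in> (\<Union>i\<in>{i. i < card \<C> \<and> C i \<subseteq> B}. C i)" by auto
      qed
    qed auto
  qed
qed

section \<open>Poisson random measures and the Mecke identity\<close>

text \<open>
  A Poisson random measure is only a family of variables indexed by sets, almost surely additive along
  each fixed sequence. Its realisation is therefore treated as the random point \<open>config \<omega>\<close> of a product space
  and never as a measure. Adding a unit mass at \<open>z\<close> still makes sense there, coordinate by coordinate.
\<close>
locale prm_space = prob_space M + intensity: sigma_finite_measure n
  for M :: "'w measure" and n :: "'s measure" +
  fixes N :: "'s set \<Rightarrow> 'w \<Rightarrow> ennreal"
  assumes prm: "poisson_random_measure M n N"
begin

abbreviation configs :: "('s set \<Rightarrow> ennreal) measure" where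
  "configs \<equiv> Pi\<^sub>M (sets n) (\<lambda>_. borel)"

definition config :: "'w \<Rightarrow> 's set \<Rightarrow> ennreal" where
  "config \<omega> = (\<lambda>A\<in>sets n. N A \<omega>)"

definition add_point :: "('s set \<Rightarrow> ennreal) \<Rightarrow> 's \<Rightarrow> 's set \<Rightarrow> ennreal" where
  "add_point \<xi> z = (\<lambda>A\<in>sets n. \<xi> A + indicator A z)"

lemma N_measurable [measurable]: "A \<in> sets n \<Longrightarrow> N A \<in> borel_measurable M"
  using prm by (auto simp: poisson_random_measure_def)

lemma N_poisson: "A \<in> sets n \<Longrightarrow> has_poisson_law M (N A) (emeasure n A)"
  using prm by (auto simp: poisson_random_measure_def)

lemma N_indep:
  "A ` I \<subseteq> sets n \<Longrightarrow> disjoint_family_on A (I :: nat set) \<Longrightarrow> indep_vars (\<lambda>_. borel) (\<lambda>i. N (A i)) I"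
  using prm by (auto simp: poisson_random_measure_def)

lemma N_countably_additive:
  "range A \<subseteq> sets n \<Longrightarrow> disjoint_family (A :: nat \<Rightarrow> 's set) \<Longrightarrow> AE \<omega> in M. N (\<Union>i. A i) \<omega> = (\<Sum>i. N (A i) \<omega>)"
  using prm by (auto simp: poisson_random_measure_def)

lemma N_null: "A \<in> sets n \<Longrightarrow> emeasure n A = 0 \<Longrightarrow> AE \<omega> in M. N A \<omega> = 0"
  using N_poisson[of A] by (simp add: has_poisson_law_def)

lemma N_infinite: "A \<in> sets n \<Longrightarrow> emeasure n A = \<infinity> \<Longrightarrow> AE \<omega> in M. N A \<omega> = \<infinity>"
  using N_poisson[of A] by (simp add: has_poisson_law_def)

lemma N_finite:
  assumes A: "A \<in> sets n" "emeasure n A < \<infinity>"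
  shows "AE \<omega> in M. N A \<omega> < \<infinity>"
proof -
  have "(\<integral>\<^sup>+\<omega>. N A \<omega> \<partial>M) = emeasure n A"
    using poisson_law_shift[OF N_measurable N_poisson, of A "\<lambda>_. 1"] A by (simp add: emeasure_space_1)
  with A show ?thesis
    using nn_integral_noteq_infinite[of "N A" M] by (auto simp: less_top)
qed

lemma N_finitely_additive_nat:
  assumes C: "\<And>i. i < (m :: nat) \<Longrightarrow> C i \<in> sets n" "disjoint_family_on C {..<m}"
    and J: "J \<subseteq> {..<m}"
  shows "AE \<omega> in M. N (\<Union>i\<in>J. C i) \<omega> = (\<Sum>i\<in>J. N (C i) \<omega>)"
proof -
  define D where "D i = (if i \<in> J then C i else {})" for i
  have fin: "finite J" using J finite_subset by auto
  have Ds: "range D \<subseteq> sets n" using C J by (auto simp: D_def)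
  moreover have "disjoint_family D"
    using disjoint_family_on_mono[OF J C(2)] by (auto simp: disjoint_family_on_def D_def)
  ultimately have 1: "AE \<omega> in M. N (\<Union>i. D i) \<omega> = (\<Sum>i. N (D i) \<omega>)"
    by (rule N_countably_additive)
  have U: "(\<Union>i. D i) = (\<Union>i\<in>J. C i)" by (auto simp: D_def)
  have "AE \<omega> in M. N {} \<omega> = 0" by (intro N_null) auto
  with 1 show ?thesis
  proof eventually_elim
    case (elim \<omega>)
    have "(\<Sum>i. N (D i) \<omega>) = (\<Sum>i\<in>J. N (D i) \<omega>)"
      using fin elim by (intro suminf_finite) (auto simp: D_def)
    also have "\<dots> = (\<Sum>i\<in>J. N (C i) \<omega>)"
      by (intro sum.cong) (auto simp: D_def)
    finally show ?case using elim U by simp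
  qed
qed

lemma N_finitely_additive:
  assumes I: "finite I" "\<And>i. i \<in> I \<Longrightarrow> C i \<in> sets n" "disjoint_family_on C I"
  shows "AE \<omega> in M. N (\<Union>i\<in>I. C i) \<omega> = (\<Sum>i\<in>I. N (C i) \<omega>)"
proof -
  obtain f where f: "bij_betw f {..<card I} I"
    using ex_bij_betw_nat_finite[OF I(1)] by (auto simp: atLeast0LessThan)
  then have im: "f ` {..<card I} = I" and inj: "inj_on f {..<card I}"
    by (auto simp: bij_betw_def)
  have "AE \<omega> in M. N (\<Union>i\<in>{..<card I}. C (f i)) \<omega> = (\<Sum>i\<in>{..<card I}. N (C (f i)) \<omega>)"
  proof (rule N_finitely_additive_nat)
    show "disjoint_family_on (\<lambda>i. C (f i)) {..<card I}"
      unfolding disjoint_family_on_def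
    proof (intro ballI impI)
      fix i j assume "i \<in> {..<card I}" "j \<in> {..<card I}" "i \<noteq> j"
      then have "f i \<in> I" "f j \<in> I" "f i \<noteq> f j"
        using im inj_onD[OF inj, of i j] by blast+
      then show "C (f i) \<inter> C (f j) = {}"
        using I(3) unfolding disjoint_family_on_def by blast
    qed
  qed (use I im in auto)
  moreover have "(\<Union>i\<in>{..<card I}. C (f i)) = (\<Union>i\<in>I. C i)"
    using arg_cong[OF im, of "\<lambda>S. \<Union>(C ` S)"] by (simp only: image_image)
  moreover have "(\<Sum>i\<in>{..<card I}. N (C (f i)) \<omega>) = (\<Sum>i\<in>I. N (C i) \<omega>)" for \<omega>
    using sum.reindex_bij_betw[OF f] .
  ultimately show ?thesis by simp
qed

lemma N_mono:
  assumes "A \<in> sets n" "B \<in> sets n" "A \<subseteq> B"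
  shows "AE \<omega> in M. N A \<omega> \<le> N B \<omega>"
proof -
  have "AE \<omega> in M. N (\<Union>i\<in>UNIV. if i then A else B - A) \<omega> = (\<Sum>i\<in>UNIV. N (if i then A else B - A) \<omega>)"
    using assms by (intro N_finitely_additive) (auto simp: disjoint_family_on_def)
  moreover have "(\<Union>i\<in>UNIV. if i then A else B - A) = B"
    using assms by (auto simp: UNIV_bool)
  ultimately show ?thesis
    by (auto simp: UNIV_bool)
qed

lemma config_measurable [measurable]: "config \<in> measurable M configs"
  unfolding config_def by (intro measurable_restrict N_measurable)

lemma add_point_measurable [measurable]:
  "case_prod add_point \<in> measurable (configs \<Otimes>\<^sub>M n) configs"
  unfolding add_point_def split_beta'
  by (intro measurable_restrict borel_measurable_add measurable_compose[OF measurable_snd borel_measurable_indicator]) measurable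

lemma config_apply: "A \<in> sets n \<Longrightarrow> config \<omega> A = N A \<omega>"
  by (simp add: config_def)

lemma add_point_apply: "A \<in> sets n \<Longrightarrow> add_point \<xi> z A = \<xi> A + indicator A z"
  by (simp add: add_point_def)

text \<open>
  For functionals of finitely many counts: over the cells of the finite family the counts are independent
  Poisson variables, the counts of the given sets are sums over cells, and a point \<open>z \<in> A\<close> lies in exactly one
  cell, so adding it raises exactly one of the independent variables by one.
\<close>
lemma mecke_cylinder:
  assumes fin: "finite \<B>" and B: "\<B> \<subseteq> sets n" and A: "A \<in> \<B>" "emeasure n A < \<infinity>"
    and h [measurable]: "h \<in> borel_measurable (Pi\<^sub>M \<B> (\<lambda>_. borel))"
  shows "(\<integral>\<^sup>+\<omega>. h (restrict (config \<omega>) \<B>) * N A \<omega> \<partial>M)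
      = (\<integral>\<^sup>+\<omega>. \<integral>\<^sup>+z. indicator A z * h (restrict (add_point (config \<omega>) z) \<B>) \<partial>n \<partial>M)"
proof -
  obtain m :: nat and C :: "nat \<Rightarrow> 's set" where C': "\<forall>i<m. C i \<in> sets n"
    and disj: "disjoint_family_on C {..<m}"
    and dich: "\<forall>i<m. \<forall>B\<in>\<B>. C i \<subseteq> B \<or> C i \<inter> B = {}"
    and union: "\<forall>B\<in>\<B>. B = (\<Union>i\<in>{i. i < m \<and> C i \<subseteq> B}. C i)"
    by (rule finite_atoms[OF fin B])
  have C: "C i \<in> sets n" if "i < m" for i using C' that by simp
  \<comment> \<open>The vector \<open>x\<close> of cell counts determines the counts of the sets in \<open>\<B>\<close> through \<open>T\<close>;
    \<open>x' k\<close> is the vector with one more point in cell \<open>k\<close>.\<close>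
  define J where "J B = {i. i < m \<and> C i \<subseteq> B}" for B
  have J: "J B \<subseteq> {..<m}" "finite (J B)" for B by (auto simp: J_def)
  define T :: "(nat \<Rightarrow> ennreal) \<Rightarrow> 's set \<Rightarrow> ennreal" where "T x = (\<lambda>B\<in>\<B>. \<Sum>i\<in>J B. x i)" for x
  have T [measurable]: "T \<in> measurable (Pi\<^sub>M {..<m} (\<lambda>_. borel)) (Pi\<^sub>M \<B> (\<lambda>_. borel))"
    unfolding T_def
  proof (intro measurable_restrict borel_measurable_sum)
    fix B i assume "B \<in> \<B>" "i \<in> J B"
    then have "i \<in> {..<m}" using J by auto
    then show "(\<lambda>x. x i) \<in> borel_measurable (Pi\<^sub>M {..<m} (\<lambda>_. borel :: ennreal measure))"
      by measurable
  qed
  define x where "x \<omega> = (\<lambda>i\<in>{..<m}. N (C i) \<omega>)" for \<omega>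
  define x' where "x' k \<omega> = (x \<omega>)(k := N (C k) \<omega> + 1)" for k \<omega>
  have ind: "indep_vars (\<lambda>_. borel) (\<lambda>i. N (C i)) {..<m}"
    using C disj by (intro N_indep) auto
  have x_m [measurable]: "x \<in> measurable M (Pi\<^sub>M {..<m} (\<lambda>_. borel))"
    unfolding x_def using C by (intro measurable_restrict N_measurable) auto
  have x'_m: "(\<lambda>\<omega>. h (T (x' k \<omega>))) \<in> borel_measurable M" if "k < m" for k
  proof -
    have "x' k \<in> measurable M (Pi\<^sub>M {..<m} (\<lambda>_. borel))"
      unfolding x'_def using that C
      by (intro measurable_fun_upd[where J = "{..<m}"] x_m borel_measurable_add N_measurable) auto
    from measurable_compose[OF measurable_compose[OF this T] h] show ?thesis .
  qed
  have J_A: "k < m" "emeasure n (C k) < \<infinity>" "C k \<in> sets n" "C k \<subseteq> A" if "k \<in> J A" for k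
  proof -
    show "k < m" "C k \<in> sets n" "C k \<subseteq> A" using that C by (auto simp: J_def)
    then show "emeasure n (C k) < \<infinity>"
      using emeasure_mono[of "C k" A n] A B by (auto intro: le_less_trans)
  qed
  have add: "AE \<omega> in M. \<forall>B\<in>\<B>. N B \<omega> = (\<Sum>i\<in>J B. N (C i) \<omega>)"
  proof (rule AE_finite_allI[OF fin])
    fix B assume "B \<in> \<B>"
    then show "AE \<omega> in M. N B \<omega> = (\<Sum>i\<in>J B. N (C i) \<omega>)"
      using N_finitely_additive_nat[OF C disj J(1)[of B]] bspec[OF union, of B] by (simp add: J_def)
  qed
  have "(\<integral>\<^sup>+\<omega>. h (restrict (config \<omega>) \<B>) * N A \<omega> \<partial>M)
      = (\<integral>\<^sup>+\<omega>. (\<Sum>k\<in>J A. h (T (x \<omega>)) * N (C k) \<omega>) \<partial>M)"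
  proof (rule nn_integral_cong_AE, use add in eventually_elim)
    case (elim \<omega>)
    have "restrict (config \<omega>) \<B> = T (x \<omega>)"
    proof (rule ext)
      fix B
      show "restrict (config \<omega>) \<B> B = T (x \<omega>) B"
      proof (cases "B \<in> \<B>")
        case True
        then have "(\<Sum>i\<in>J B. x \<omega> i) = (\<Sum>i\<in>J B. N (C i) \<omega>)"
          using J(1)[of B] by (intro sum.cong) (auto simp: x_def)
        then show ?thesis using True elim B by (auto simp: T_def config_apply)
      qed (simp add: T_def)
    qed
    then show ?case using elim A by (simp add: sum_distrib_left)
  qed
  also have "\<dots> = (\<Sum>k\<in>J A. \<integral>\<^sup>+\<omega>. h (T (x \<omega>)) * N (C k) \<omega> \<partial>M)"
    using J_A by (intro nn_integral_sum) auto
  also have "\<dots> = (\<Sum>k\<in>J A. emeasure n (C k) * (\<integral>\<^sup>+\<omega>. h (T (x' k \<omega>)) \<partial>M))"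
  proof (rule sum.cong[OF refl])
    fix k assume k: "k \<in> J A"
    show "(\<integral>\<^sup>+\<omega>. h (T (x \<omega>)) * N (C k) \<omega> \<partial>M) = emeasure n (C k) * (\<integral>\<^sup>+\<omega>. h (T (x' k \<omega>)) \<partial>M)"
      using indep_poisson_shift[OF ind _ _ N_poisson, of k "\<lambda>y. h (T y)"] J_A[OF k]
      by (simp add: x_def x'_def)
  qed
  also have "\<dots> = (\<Sum>k\<in>J A. \<integral>\<^sup>+\<omega>. emeasure n (C k) * h (T (x' k \<omega>)) \<partial>M)"
    using J_A x'_m by (intro sum.cong[OF refl] nn_integral_cmult[symmetric]) auto
  also have "\<dots> = (\<integral>\<^sup>+\<omega>. (\<Sum>k\<in>J A. emeasure n (C k) * h (T (x' k \<omega>))) \<partial>M)"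
    using J_A x'_m by (intro nn_integral_sum[symmetric] borel_measurable_times) auto
  also have "\<dots> = (\<integral>\<^sup>+\<omega>. \<integral>\<^sup>+z. indicator A z * h (restrict (add_point (config \<omega>) z) \<B>) \<partial>n \<partial>M)"
  proof (rule nn_integral_cong_AE, use add in eventually_elim)
    case (elim \<omega>)
    have "(\<Sum>k\<in>J A. emeasure n (C k) * h (T (x' k \<omega>)))
        = (\<Sum>k\<in>J A. \<integral>\<^sup>+z. h (T (x' k \<omega>)) * indicator (C k) z \<partial>n)"
      using J_A by (intro sum.cong[OF refl]) (subst nn_integral_cmult_indicator, simp_all add: mult.commute)
    also have "\<dots> = (\<integral>\<^sup>+z. (\<Sum>k\<in>J A. h (T (x' k \<omega>)) * indicator (C k) z) \<partial>n)"
      using J_A by (intro nn_integral_sum[symmetric]) auto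
    also have "\<dots> = (\<integral>\<^sup>+z. indicator A z * h (restrict (add_point (config \<omega>) z) \<B>) \<partial>n)"
    proof (rule nn_integral_cong)
      fix z
      show "(\<Sum>k\<in>J A. h (T (x' k \<omega>)) * indicator (C k) z) = indicator A z * h (restrict (add_point (config \<omega>) z) \<B>)"
      proof (cases "z \<in> A")
        case False
        then have "(\<Sum>k\<in>J A. h (T (x' k \<omega>)) * indicator (C k) z) = 0"
          using J_A(4) by (intro sum.neutral) (auto simp: indicator_def)
        then show ?thesis using False by simp
      next
        case True
        then obtain k where k: "k \<in> J A" "z \<in> C k"
          using bspec[OF union A(1)] unfolding J_def by blast
        have uniq: "z \<in> C i \<longleftrightarrow> i = k" if "i < m" for i
          using disj k J_A[OF k(1)] that by (auto simp: disjoint_family_on_def)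
        have "(\<Sum>i\<in>J A. h (T (x' i \<omega>)) * indicator (C i) z) = (\<Sum>i\<in>J A. if i = k then h (T (x' k \<omega>)) else 0)"
          using uniq J_A by (intro sum.cong) auto
        also have "\<dots> = h (T (x' k \<omega>))" using k J by simp
        also have "T (x' k \<omega>) = restrict (add_point (config \<omega>) z) \<B>"
        proof (rule ext)
          fix D
          show "T (x' k \<omega>) D = restrict (add_point (config \<omega>) z) \<B> D"
          proof (cases "D \<in> \<B>")
            case D: True
            have eq: "x' k \<omega> i = N (C i) \<omega> + (if i = k then 1 else 0)" if "i \<in> J D" for i
              using J(1)[of D] that by (auto simp: x'_def x_def)
            have "(\<Sum>i\<in>J D. x' k \<omega> i) = (\<Sum>i\<in>J D. N (C i) \<omega>) + (\<Sum>i\<in>J D. if i = k then 1 else 0)"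
              by (simp add: eq sum.distrib)
            also have "(\<Sum>i\<in>J D. if i = k then 1 else 0) = (indicator D z :: ennreal)"
              using dich[rule_format, OF J_A(1)[OF k(1)] D] k J(2)[of D] J_A(1)[OF k(1)]
              by (auto simp: J_def indicator_def)
            finally show ?thesis
              using elim D B by (simp add: T_def add_point_def config_def subset_iff)
          qed (simp add: T_def)
        qed
        finally show ?thesis using True by (simp only: indicator_simps(1) mult_1)
      qed
    qed
    finally show ?case .
  qed
  finally show ?thesis .
qed

text \<open>
  Each side, as a function of \<open>H\<close>, is integration against a finite measure on the space of configurations.
  Both measures are determined by cylinders, where \<open>mecke_cylinder\<close> applies once \<open>A\<close> is added to the base
  of the cylinder.
\<close>
lemma mecke_finite_set:
  assumes A [measurable]: "A \<in> sets n" and fin: "emeasure n A < \<infinity>"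
    and H [measurable]: "H \<in> borel_measurable configs"
  shows "(\<integral>\<^sup>+\<omega>. H (config \<omega>) * N A \<omega> \<partial>M)
      = (\<integral>\<^sup>+\<omega>. \<integral>\<^sup>+z. indicator A z * H (add_point (config \<omega>) z) \<partial>n \<partial>M)"
proof -
  \<comment> \<open>The law of the configuration under \<open>N(A) dM\<close>, and the law of a configuration with an additional
    point distributed according to \<open>n\<close> restricted to \<open>A\<close>.\<close>
  define P where "P = distr (density M (N A)) configs config"
  define Q where "Q = distr (density (M \<Otimes>\<^sub>M n) (\<lambda>(\<omega>, z). indicator A z)) configs (\<lambda>(\<omega>, z). add_point (config \<omega>) z)"
  have add [measurable]: "(\<lambda>(\<omega>, z). add_point (config \<omega>) z) \<in> measurable (M \<Otimes>\<^sub>M n) configs"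
    by measurable
  have sets [measurable_cong, simp]: "sets P = sets configs" "sets Q = sets configs"
    by (simp_all add: P_def Q_def)
  have int_P: "(\<integral>\<^sup>+\<xi>. f \<xi> \<partial>P) = (\<integral>\<^sup>+\<omega>. f (config \<omega>) * N A \<omega> \<partial>M)"
    if [measurable]: "f \<in> borel_measurable configs" for f
    unfolding P_def by (simp add: nn_integral_distr nn_integral_density mult.commute)
  have int_Q: "(\<integral>\<^sup>+\<xi>. f \<xi> \<partial>Q) = (\<integral>\<^sup>+\<omega>. \<integral>\<^sup>+z. indicator A z * f (add_point (config \<omega>) z) \<partial>n \<partial>M)"
    if f [measurable]: "f \<in> borel_measurable configs" for f
  proof -
    have m: "(\<lambda>(\<omega>, z). indicator A z * f (add_point (config \<omega>) z)) \<in> borel_measurable (M \<Otimes>\<^sub>M n)"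
      using measurable_compose[OF add f] by (simp add: split_beta')
    have "(\<integral>\<^sup>+\<xi>. f \<xi> \<partial>Q) = (\<integral>\<^sup>+x. (\<lambda>(\<omega>, z). indicator A z * f (add_point (config \<omega>) z)) x \<partial>(M \<Otimes>\<^sub>M n))"
      unfolding Q_def using measurable_compose[OF add f]
      by (simp add: nn_integral_distr nn_integral_density split_beta')
    also have "\<dots> = (\<integral>\<^sup>+\<omega>. \<integral>\<^sup>+z. indicator A z * f (add_point (config \<omega>) z) \<partial>n \<partial>M)"
      using intensity.nn_integral_fst[OF m] by simp
    finally show ?thesis .
  qed
  have "P = Q"
  proof (rule measure_eqI_PiM_infinite)
    show "finite_measure P"
    proof (rule finite_measureI)
      have "emeasure P (space P) = (\<integral>\<^sup>+\<xi>. 1 \<partial>P)" by simp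
      also have "\<dots> = (\<integral>\<^sup>+\<omega>. N A \<omega> \<partial>M)" by (subst int_P) auto
      also have "\<dots> = emeasure n A"
        using poisson_law_shift[OF N_measurable N_poisson, of A "\<lambda>_. 1"] fin A by (simp add: emeasure_space_1)
      finally show "emeasure P (space P) \<noteq> \<infinity>" using fin by simp
    qed
    fix E J
    assume J: "finite J" "J \<subseteq> sets n" and E: "\<And>B. B \<in> J \<Longrightarrow> E B \<in> sets (borel :: ennreal measure)"
    define S where "S = prod_emb (sets n) (\<lambda>_. borel :: ennreal measure) J (Pi\<^sub>E J E)"
    have S [measurable]: "S \<in> sets configs"
      unfolding S_def using J E by (intro sets_PiM_I) auto
    define \<B> where "\<B> = insert A J"
    have \<B>: "finite \<B>" "\<B> \<subseteq> sets n" "A \<in> \<B>" using J A by (auto simp: \<B>_def)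
    define h :: "('s set \<Rightarrow> ennreal) \<Rightarrow> ennreal" where "h x = indicator (Pi\<^sub>E J E) (restrict x J)" for x
    have h: "h \<in> borel_measurable (Pi\<^sub>M \<B> (\<lambda>_. borel))"
    proof -
      have "Pi\<^sub>E J E \<in> sets (Pi\<^sub>M J (\<lambda>_. borel))"
        using J E by (intro sets_PiM_I_finite) auto
      moreover have "(\<lambda>x. restrict x J) \<in> measurable (Pi\<^sub>M \<B> (\<lambda>_. borel)) (Pi\<^sub>M J (\<lambda>_. borel :: ennreal measure))"
        by (intro measurable_restrict_subset) (auto simp: \<B>_def)
      ultimately show ?thesis
        unfolding h_def by (intro measurable_compose[OF _ borel_measurable_indicator])
    qed
    have ind: "indicator S \<xi> = h (restrict \<xi> \<B>)" if "\<xi> \<in> space configs" for \<xi>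
    proof -
      have "restrict (restrict \<xi> \<B>) J = restrict \<xi> J"
        by (auto simp: \<B>_def restrict_def)
      then show ?thesis
        using that by (simp add: h_def S_def prod_emb_def indicator_def space_PiM)
    qed
    have c: "config \<omega> \<in> space configs" "add_point (config \<omega>) z \<in> space configs" for \<omega> z
      by (auto simp: space_PiM config_def add_point_def)
    have "emeasure P S = (\<integral>\<^sup>+\<omega>. h (restrict (config \<omega>) \<B>) * N A \<omega> \<partial>M)"
      using int_P[of "indicator S"] ind c by (simp add: emeasure_distr)
    also have "\<dots> = (\<integral>\<^sup>+\<omega>. \<integral>\<^sup>+z. indicator A z * h (restrict (add_point (config \<omega>) z) \<B>) \<partial>n \<partial>M)"
      by (rule mecke_cylinder[OF \<B> fin h])
    also have "\<dots> = emeasure Q S"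
      using int_Q[of "indicator S"] ind c by simp
    finally show "emeasure P (prod_emb (sets n) (\<lambda>_. borel) J (Pi\<^sub>E J E))
       = emeasure Q (prod_emb (sets n) (\<lambda>_. borel) J (Pi\<^sub>E J E))"
      by (simp add: S_def)
  qed simp_all
  then show ?thesis
    using int_P[OF H] int_Q[OF H] by simp
qed

lemma add_point_config_measurable [measurable]:
  "(\<lambda>(\<omega>, z). add_point (config \<omega>) z) \<in> measurable (M \<Otimes>\<^sub>M n) configs"
  by measurable

lemma add_point_section_measurable [measurable]:
  "add_point (config \<omega>) \<in> measurable n configs"
  unfolding add_point_def by (intro measurable_restrict borel_measurable_add) auto

lemma shifted_functional_measurable:
  assumes H: "H \<in> borel_measurable configs" and f: "f \<in> borel_measurable n"
  shows "(\<lambda>\<omega>. \<integral>\<^sup>+z. f z * H (add_point (config \<omega>) z) \<partial>n) \<in> borel_measurable M"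
proof (rule intensity.borel_measurable_nn_integral)
  show "(\<lambda>(\<omega>, z). f z * H (add_point (config \<omega>) z)) \<in> borel_measurable (M \<Otimes>\<^sub>M n)"
    using measurable_compose[OF add_point_config_measurable H] f by (simp add: split_beta')
qed

text \<open>
  A set of infinite intensity is cut into countably many pieces of finite intensity.
\<close>
lemma mecke_set:
  assumes A [measurable]: "A \<in> sets n" and H [measurable]: "H \<in> borel_measurable configs"
  shows "(\<integral>\<^sup>+\<omega>. H (config \<omega>) * N A \<omega> \<partial>M)
      = (\<integral>\<^sup>+\<omega>. \<integral>\<^sup>+z. indicator A z * H (add_point (config \<omega>) z) \<partial>n \<partial>M)"
proof -
  obtain D :: "nat \<Rightarrow> 's set" where D: "range D \<subseteq> sets n" "(\<Union>i. D i) = space n"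
    "\<And>i. emeasure n (D i) \<noteq> \<infinity>" "disjoint_family D"
    using intensity.sigma_finite_disjoint by blast
  define E where "E i = A \<inter> D i" for i
  have Em [measurable]: "E i \<in> sets n" for i using D(1) by (auto simp: E_def)
  have Efin: "emeasure n (E i) < \<infinity>" for i
  proof -
    have "emeasure n (E i) \<le> emeasure n (D i)"
      using D(1) by (intro emeasure_mono) (auto simp: E_def)
    with D(3)[of i] show ?thesis by (auto simp: less_top intro: le_less_trans)
  qed
  have Edisj: "disjoint_family E"
    using D(4) by (auto simp: E_def disjoint_family_on_def)
  have EU: "(\<Union>i. E i) = A"
    using D(2) sets.sets_into_space[OF A] by (auto simp: E_def)
  have HE [measurable]: "(\<lambda>z. H (add_point (config \<omega>) z)) \<in> borel_measurable n" for \<omega>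
    by (rule measurable_compose[OF add_point_section_measurable H])
  have "range E \<subseteq> sets n" using Em by blast
  from N_countably_additive[OF this Edisj]
  have "AE \<omega> in M. N A \<omega> = (\<Sum>i. N (E i) \<omega>)"
    by (simp only: EU)
  then have "(\<integral>\<^sup>+\<omega>. H (config \<omega>) * N A \<omega> \<partial>M) = (\<integral>\<^sup>+\<omega>. (\<Sum>i. H (config \<omega>) * N (E i) \<omega>) \<partial>M)"
    by (intro nn_integral_cong_AE) auto
  also have "\<dots> = (\<Sum>i. \<integral>\<^sup>+\<omega>. H (config \<omega>) * N (E i) \<omega> \<partial>M)"
    by (intro nn_integral_suminf) measurable
  also have "\<dots> = (\<Sum>i. \<integral>\<^sup>+\<omega>. \<integral>\<^sup>+z. indicator (E i) z * H (add_point (config \<omega>) z) \<partial>n \<partial>M)"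
    by (simp only: mecke_finite_set[OF Em Efin H])
  also have "\<dots> = (\<integral>\<^sup>+\<omega>. (\<Sum>i. \<integral>\<^sup>+z. indicator (E i) z * H (add_point (config \<omega>) z) \<partial>n) \<partial>M)"
    by (intro nn_integral_suminf[symmetric] shifted_functional_measurable H) auto
  also have "\<dots> = (\<integral>\<^sup>+\<omega>. \<integral>\<^sup>+z. (\<Sum>i. indicator (E i) z * H (add_point (config \<omega>) z)) \<partial>n \<partial>M)"
    by (intro nn_integral_cong nn_integral_suminf[symmetric]) measurable
  also have "\<dots> = (\<integral>\<^sup>+\<omega>. \<integral>\<^sup>+z. indicator A z * H (add_point (config \<omega>) z) \<partial>n \<partial>M)"
    using suminf_indicator[OF Edisj] by (simp only: ennreal_suminf_multc EU)
  finally show ?thesis .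
qed

text \<open>
  The integral of a simple function against a configuration, defined for every configuration and not only
  for almost every realisation.
\<close>
definition simple_charge :: "('s \<Rightarrow> ennreal) \<Rightarrow> ('s set \<Rightarrow> ennreal) \<Rightarrow> ennreal" where
  "simple_charge s \<xi> = (\<Sum>y\<in>s ` space n. y * \<xi> (s -` {y} \<inter> space n))"

lemma simple_charge_measurable [measurable]:
  assumes "simple_function n s"
  shows "simple_charge s \<in> borel_measurable configs"
proof -
  have [measurable]: "s -` {y} \<inter> space n \<in> sets n" for y using assms by (rule simple_functionD)
  show ?thesis unfolding simple_charge_def by measurable
qed

lemma simple_charge_add_point:
  assumes s: "simple_function n s" and z: "z \<in> space n"
  shows "simple_charge s (add_point \<xi> z) = simple_charge s \<xi> + s z"
  using simple_functionD(2)[OF s]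
  by (simp add: simple_charge_def add_point_apply distrib_left sum.distrib
      simple_function_indicator_representation[OF s z, symmetric])

lemma simple_charge_config:
  assumes "simple_function n s"
  shows "simple_charge s (config \<omega>) = (\<Sum>y\<in>s ` space n. y * N (s -` {y} \<inter> space n) \<omega>)"
  using simple_functionD(2)[OF assms] by (simp add: simple_charge_def config_apply)

text \<open>
  Only almost sure, because it uses additivity of \<open>N\<close> over the common refinement of the level sets.
\<close>
lemma simple_charge_mono:
  assumes s: "simple_function n s" and t: "simple_function n t" and le: "\<And>x. x \<in> space n \<Longrightarrow> s x \<le> t x"
  shows "AE \<omega> in M. simple_charge s (config \<omega>) \<le> simple_charge t (config \<omega>)"
proof -
  define C where "C y y' = (s -` {y} \<inter> space n) \<inter> (t -` {y'} \<inter> space n)" for y y'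
  have C: "C y y' \<in> sets n" for y y'
    unfolding C_def by (rule sets.Int[OF simple_functionD(2)[OF s] simple_functionD(2)[OF t]])
  have fin: "finite (s ` space n)" "finite (t ` space n)"
    using simple_functionD(1)[OF s] simple_functionD(1)[OF t] by auto
  have 1: "AE \<omega> in M. \<forall>y\<in>s ` space n. N (s -` {y} \<inter> space n) \<omega> = (\<Sum>y'\<in>t ` space n. N (C y y') \<omega>)"
  proof (rule AE_finite_allI[OF fin(1)])
    fix y
    have "s -` {y} \<inter> space n = (\<Union>y'\<in>t ` space n. C y y')" by (auto simp: C_def)
    moreover have "disjoint_family_on (C y) (t ` space n)"
      by (auto simp: disjoint_family_on_def C_def)
    ultimately show "AE \<omega> in M. N (s -` {y} \<inter> space n) \<omega> = (\<Sum>y'\<in>t ` space n. N (C y y') \<omega>)"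
      using N_finitely_additive[OF fin(2), of "C y"] C by (simp only:)
  qed
  have 2: "AE \<omega> in M. \<forall>y'\<in>t ` space n. N (t -` {y'} \<inter> space n) \<omega> = (\<Sum>y\<in>s ` space n. N (C y y') \<omega>)"
  proof (rule AE_finite_allI[OF fin(2)])
    fix y'
    have "t -` {y'} \<inter> space n = (\<Union>y\<in>s ` space n. C y y')" by (auto simp: C_def)
    moreover have "disjoint_family_on (\<lambda>y. C y y') (s ` space n)"
      by (auto simp: disjoint_family_on_def C_def)
    ultimately show "AE \<omega> in M. N (t -` {y'} \<inter> space n) \<omega> = (\<Sum>y\<in>s ` space n. N (C y y') \<omega>)"
      using N_finitely_additive[OF fin(1), of "\<lambda>y. C y y'"] C by (simp only:)
  qed
  have 3: "AE \<omega> in M. N {} \<omega> = 0" by (intro N_null) auto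
  show ?thesis
    using 1 2 3
  proof eventually_elim
    case (elim \<omega>)
    have "simple_charge s (config \<omega>) = (\<Sum>y\<in>s ` space n. \<Sum>y'\<in>t ` space n. y * N (C y y') \<omega>)"
      unfolding simple_charge_config[OF s]
      by (intro sum.cong[OF refl]) (simp only: bspec[OF elim(1)] sum_distrib_left)
    also have "\<dots> \<le> (\<Sum>y\<in>s ` space n. \<Sum>y'\<in>t ` space n. y' * N (C y y') \<omega>)"
    proof (intro sum_mono)
      fix y y'
      show "y * N (C y y') \<omega> \<le> y' * N (C y y') \<omega>"
      proof (cases "C y y' = {}")
        case False
        then obtain x where "x \<in> space n" "s x = y" "t x = y'" by (auto simp: C_def)
        then show ?thesis using le[of x] by (auto intro: mult_right_mono)
      qed (use elim(3) in simp)
    qed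
    also have "\<dots> = (\<Sum>y'\<in>t ` space n. \<Sum>y\<in>s ` space n. y' * N (C y y') \<omega>)"
      by (rule sum.swap)
    also have "\<dots> = simple_charge t (config \<omega>)"
      unfolding simple_charge_config[OF t]
      by (intro sum.cong[OF refl]) (simp only: bspec[OF elim(2)] sum_distrib_left)
    finally show ?case .
  qed
qed

lemma mecke_simple:
  assumes s: "simple_function n s" and H [measurable]: "H \<in> borel_measurable configs"
  shows "(\<integral>\<^sup>+\<omega>. H (config \<omega>) * simple_charge s (config \<omega>) \<partial>M)
      = (\<integral>\<^sup>+\<omega>. \<integral>\<^sup>+z. s z * H (add_point (config \<omega>) z) \<partial>n \<partial>M)"
proof -
  define S where "S y = s -` {y} \<inter> space n" for y
  have S [measurable]: "S y \<in> sets n" for y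
    unfolding S_def by (rule simple_functionD[OF s])
  have HE [measurable]: "(\<lambda>z. H (add_point (config \<omega>) z)) \<in> borel_measurable n" for \<omega>
    by (rule measurable_compose[OF add_point_section_measurable H])
  have "(\<integral>\<^sup>+\<omega>. H (config \<omega>) * simple_charge s (config \<omega>) \<partial>M)
      = (\<integral>\<^sup>+\<omega>. (\<Sum>y\<in>s ` space n. y * (H (config \<omega>) * N (S y) \<omega>)) \<partial>M)"
    by (simp add: simple_charge_config[OF s] S_def sum_distrib_left ac_simps)
  also have "\<dots> = (\<Sum>y\<in>s ` space n. y * (\<integral>\<^sup>+\<omega>. H (config \<omega>) * N (S y) \<omega> \<partial>M))"
    by (simp add: nn_integral_sum nn_integral_cmult)
  also have "\<dots> = (\<Sum>y\<in>s ` space n. y * (\<integral>\<^sup>+\<omega>. \<integral>\<^sup>+z. indicator (S y) z * H (add_point (config \<omega>) z) \<partial>n \<partial>M))"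
    by (simp only: mecke_set[OF S H])
  also have "\<dots> = (\<integral>\<^sup>+\<omega>. (\<Sum>y\<in>s ` space n. y * (\<integral>\<^sup>+z. indicator (S y) z * H (add_point (config \<omega>) z) \<partial>n)) \<partial>M)"
    using shifted_functional_measurable[OF H borel_measurable_indicator[OF S]]
    by (subst nn_integral_sum) (auto simp: nn_integral_cmult)
  also have "\<dots> = (\<integral>\<^sup>+\<omega>. \<integral>\<^sup>+z. (\<Sum>y\<in>s ` space n. y * (indicator (S y) z * H (add_point (config \<omega>) z))) \<partial>n \<partial>M)"
    by (simp add: nn_integral_sum nn_integral_cmult)
  also have "\<dots> = (\<integral>\<^sup>+\<omega>. \<integral>\<^sup>+z. s z * H (add_point (config \<omega>) z) \<partial>n \<partial>M)"
  proof (intro nn_integral_cong)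
    fix \<omega> z assume z: "z \<in> space n"
    show "(\<Sum>y\<in>s ` space n. y * (indicator (S y) z * H (add_point (config \<omega>) z))) = s z * H (add_point (config \<omega>) z)"
      by (simp only: S_def mult.assoc[symmetric] sum_distrib_right[symmetric]
          simple_function_indicator_representation[OF s z, symmetric])
  qed
  finally show ?thesis .
qed

text \<open>
  The Mecke identity \<open>E[H(N) N(f)] = \<integral> f(z) E[H(N + \<delta>\<^sub>z)] n(dz)\<close>, by monotone convergence on both sides.
\<close>
lemma mecke:
  assumes J: "prm_nn_integral M n N f J" and H [measurable]: "H \<in> borel_measurable configs"
  shows "(\<integral>\<^sup>+\<omega>. H (config \<omega>) * J \<omega> \<partial>M)
      = (\<integral>\<^sup>+\<omega>. \<integral>\<^sup>+z. f z * H (add_point (config \<omega>) z) \<partial>n \<partial>M)"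
proof -
  obtain s :: "nat \<Rightarrow> 's \<Rightarrow> ennreal" where s: "\<And>k. simple_function n (s k)"
    and inc: "\<And>x. x \<in> space n \<Longrightarrow> incseq (\<lambda>k. s k x)"
    and lim: "\<And>x. x \<in> space n \<Longrightarrow> (\<lambda>k. s k x) \<longlonglongrightarrow> f x"
    and J_lim: "AE \<omega> in M. (\<lambda>k. simple_charge (s k) (config \<omega>)) \<longlonglongrightarrow> J \<omega>"
    using J by (auto simp: prm_nn_integral_def simple_charge_config)
  have sm [measurable]: "s k \<in> borel_measurable n" for k
    using s by (rule borel_measurable_simple_function)
  have HE [measurable]: "(\<lambda>z. H (add_point (config \<omega>) z)) \<in> borel_measurable n" for \<omega>
    by (rule measurable_compose[OF add_point_section_measurable H])
  have cm [measurable]: "(\<lambda>\<omega>. simple_charge (s k) (config \<omega>)) \<in> borel_measurable M" for k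
    by (rule measurable_compose[OF config_measurable simple_charge_measurable[OF s]])
  have mono: "AE \<omega> in M. simple_charge (s k) (config \<omega>) \<le> simple_charge (s (Suc k)) (config \<omega>)" for k
    using inc by (intro simple_charge_mono s) (auto simp: incseq_Suc_iff)
  then have mono_all: "AE \<omega> in M. \<forall>k. simple_charge (s k) (config \<omega>) \<le> simple_charge (s (Suc k)) (config \<omega>)"
    by (simp add: AE_all_countable)
  have "AE \<omega> in M. H (config \<omega>) * J \<omega> = (SUP k. H (config \<omega>) * simple_charge (s k) (config \<omega>))"
    using mono_all J_lim
  proof eventually_elim
    case (elim \<omega>)
    then have "(SUP k. simple_charge (s k) (config \<omega>)) = J \<omega>"
      using LIMSEQ_unique[OF LIMSEQ_SUP] by (auto simp: incseq_Suc_iff)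
    then show ?case by (simp add: SUP_mult_left_ennreal[symmetric])
  qed
  then have "(\<integral>\<^sup>+\<omega>. H (config \<omega>) * J \<omega> \<partial>M)
      = (\<integral>\<^sup>+\<omega>. (SUP k. H (config \<omega>) * simple_charge (s k) (config \<omega>)) \<partial>M)"
    by (rule nn_integral_cong_AE)
  also have "\<dots> = (SUP k. \<integral>\<^sup>+\<omega>. H (config \<omega>) * simple_charge (s k) (config \<omega>) \<partial>M)"
  proof (rule nn_integral_monotone_convergence_SUP_AE)
    show "AE \<omega> in M. H (config \<omega>) * simple_charge (s k) (config \<omega>)
        \<le> H (config \<omega>) * simple_charge (s (Suc k)) (config \<omega>)" for k
      using mono[of k] by eventually_elim (auto intro: mult_left_mono)
  qed measurable
  also have "\<dots> = (SUP k. \<integral>\<^sup>+\<omega>. \<integral>\<^sup>+z. s k z * H (add_point (config \<omega>) z) \<partial>n \<partial>M)"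
    by (simp only: mecke_simple[OF s H])
  also have "\<dots> = (\<integral>\<^sup>+\<omega>. (SUP k. \<integral>\<^sup>+z. s k z * H (add_point (config \<omega>) z) \<partial>n) \<partial>M)"
    using inc by (intro nn_integral_monotone_convergence_SUP[symmetric] shifted_functional_measurable H sm)
      (auto simp: incseq_def le_fun_def intro!: nn_integral_mono mult_right_mono)
  also have "\<dots> = (\<integral>\<^sup>+\<omega>. \<integral>\<^sup>+z. (SUP k. s k z * H (add_point (config \<omega>) z)) \<partial>n \<partial>M)"
  proof (rule nn_integral_cong)
    fix \<omega>
    show "(SUP k. \<integral>\<^sup>+z. s k z * H (add_point (config \<omega>) z) \<partial>n)
        = (\<integral>\<^sup>+z. (SUP k. s k z * H (add_point (config \<omega>) z)) \<partial>n)"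
      using inc by (intro nn_integral_monotone_convergence_SUP_AE[symmetric])
        (auto simp: incseq_Suc_iff intro!: mult_right_mono)
  qed
  also have "\<dots> = (\<integral>\<^sup>+\<omega>. \<integral>\<^sup>+z. f z * H (add_point (config \<omega>) z) \<partial>n \<partial>M)"
  proof (intro nn_integral_cong)
    fix \<omega> z assume z: "z \<in> space n"
    have "(SUP k. s k z) = f z"
      using LIMSEQ_unique[OF LIMSEQ_SUP[OF inc[OF z]] lim[OF z]] .
    then show "(SUP k. s k z * H (add_point (config \<omega>) z)) = f z * H (add_point (config \<omega>) z)"
      by (simp add: SUP_mult_right_ennreal[symmetric])
  qed
  finally show ?thesis .
qed

end

section \<open>Functionals that are additive under adding a point\<close>

text \<open>
  The integrals are only assumed to tend to zero, so finitely many of them may be infinite; the initial ones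
  are skipped before convergence in \<open>L\<^sup>1\<close> is used.
\<close>
lemma tendsto_L2_AE_subseq:
  fixes u :: "nat \<Rightarrow> 'a \<Rightarrow> real"
  assumes u [measurable]: "\<And>k. u k \<in> borel_measurable M"
    and lim: "(\<lambda>k. \<integral>\<^sup>+x. ennreal ((u k x)\<^sup>2) \<partial>M) \<longlonglongrightarrow> 0"
  obtains r :: "nat \<Rightarrow> nat" where "strict_mono r" "AE x in M. (\<lambda>k. u (r k) x) \<longlonglongrightarrow> 0"
proof -
  have "eventually (\<lambda>k. (\<integral>\<^sup>+x. ennreal ((u k x)\<^sup>2) \<partial>M) < 1) sequentially"
    using lim by (rule order_tendstoD(2)) simp
  then obtain k0 where k0: "\<And>k. k \<ge> k0 \<Longrightarrow> (\<integral>\<^sup>+x. ennreal ((u k x)\<^sup>2) \<partial>M) < 1"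
    by (auto simp: eventually_sequentially)
  define w where "w k x = (u (k + k0) x)\<^sup>2" for k x
  have wm [measurable]: "w k \<in> borel_measurable M" for k
    unfolding w_def by measurable
  have w_int: "integrable M (w k)" for k
    using k0[of "k + k0"] by (intro integrableI_nonneg) (auto simp: w_def intro: less_trans)
  have "(\<lambda>k. ennreal (\<integral>x. norm (w k x) \<partial>M)) \<longlonglongrightarrow> ennreal 0"
  proof -
    have "(\<integral>\<^sup>+x. ennreal ((u (k + k0) x)\<^sup>2) \<partial>M) = ennreal (\<integral>x. norm (w k x) \<partial>M)" for k
      using nn_integral_eq_integral[OF w_int[of k]] by (simp add: w_def[abs_def])
    then show ?thesis
      using LIMSEQ_ignore_initial_segment[OF lim, of k0] by simp
  qed
  then have "(\<lambda>k. \<integral>x. norm (w k x) \<partial>M) \<longlonglongrightarrow> 0"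
    by (subst (asm) tendsto_ennreal_iff) auto
  then obtain r :: "nat \<Rightarrow> nat" where r: "strict_mono r" "AE x in M. (\<lambda>k. w (r k) x) \<longlonglongrightarrow> 0"
    using tendsto_L1_AE_subseq[of M w] w_int by blast
  show ?thesis
  proof (rule that[of "\<lambda>k. r k + k0"])
    show "strict_mono (\<lambda>k. r k + k0)"
      using r(1) by (auto simp: strict_mono_def)
    show "AE x in M. (\<lambda>k. u (r k + k0) x) \<longlonglongrightarrow> 0"
      using r(2)
    proof eventually_elim
      case (elim x)
      from tendsto_real_sqrt[OF elim] show ?case
        by (simp add: w_def tendsto_rabs_zero_iff)
    qed
  qed
qed

context prm_space
begin

text \<open>
  \<open>V\<close> is almost surely a measurable functional of the configuration whose value grows by \<open>v z\<close> when a point is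
  added at \<open>z\<close>. Stochastic integrals of \<open>f\<close> are of this kind with \<open>v = f\<close>, and this is all that is used of
  them. A functional defined up to null sets of configurations may be evaluated at \<open>N + \<delta>\<^sub>z\<close>, because by the
  Mecke identity the laws of \<open>N + \<delta>\<^sub>z\<close>, averaged over \<open>z\<close>, do not charge such null sets; here the value at
  the augmented configuration is simply part of the definition.
\<close>
definition point_additive :: "('w \<Rightarrow> 'b::{topological_space, plus}) \<Rightarrow> ('s \<Rightarrow> 'b) \<Rightarrow> bool" where
  "point_additive V v \<longleftrightarrow> (\<exists>\<Phi>\<in>borel_measurable configs. AE \<omega> in M.
     \<Phi> (config \<omega>) = V \<omega> \<and> (AE z in n. \<Phi> (add_point (config \<omega>) z) = V \<omega> + v z))"

lemma point_additiveI:
  assumes "\<Phi> \<in> borel_measurable configs" "AE \<omega> in M. \<Phi> (config \<omega>) = V \<omega>"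
    "AE \<omega> in M. AE z in n. \<Phi> (add_point (config \<omega>) z) = V \<omega> + v z"
  shows "point_additive V v"
  unfolding point_additive_def using assms(2,3) by (intro bexI[OF _ assms(1)]) auto

lemma point_additiveE:
  assumes "point_additive V v"
  obtains \<Phi> where "\<Phi> \<in> borel_measurable configs" "AE \<omega> in M. \<Phi> (config \<omega>) = V \<omega>"
    "AE \<omega> in M. AE z in n. \<Phi> (add_point (config \<omega>) z) = V \<omega> + v z"
  using assms unfolding point_additive_def by auto

lemma point_additive_cong:
  assumes "point_additive V v" "AE \<omega> in M. V \<omega> = V' \<omega>" "AE z in n. v z = v' z"
  shows "point_additive V' v'"
proof -
  from assms(1) obtain \<Phi> where \<Phi>: "\<Phi> \<in> borel_measurable configs" "AE \<omega> in M. \<Phi> (config \<omega>) = V \<omega>"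
    "AE \<omega> in M. AE z in n. \<Phi> (add_point (config \<omega>) z) = V \<omega> + v z"
    by (rule point_additiveE)
  show ?thesis
  proof (rule point_additiveI[OF \<Phi>(1)])
    show "AE \<omega> in M. \<Phi> (config \<omega>) = V' \<omega>"
      using \<Phi>(2) assms(2) by eventually_elim simp
    show "AE \<omega> in M. AE z in n. \<Phi> (add_point (config \<omega>) z) = V' \<omega> + v' z"
      using \<Phi>(3) assms(2)
    proof eventually_elim
      case (elim \<omega>)
      from elim(1) assms(3) show ?case by eventually_elim (simp add: elim(2))
    qed
  qed
qed

lemma point_additive_affine:
  fixes V :: "'w \<Rightarrow> real"
  assumes "point_additive V v"
  shows "point_additive (\<lambda>\<omega>. c * V \<omega> + d) (\<lambda>z. c * v z)"
proof -
  from assms obtain \<Phi> where \<Phi>: "\<Phi> \<in> borel_measurable configs" "AE \<omega> in M. \<Phi> (config \<omega>) = V \<omega>"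
    "AE \<omega> in M. AE z in n. \<Phi> (add_point (config \<omega>) z) = V \<omega> + v z"
    by (rule point_additiveE)
  note [measurable] = \<Phi>(1)
  show ?thesis
  proof (rule point_additiveI[of "\<lambda>\<xi>. c * \<Phi> \<xi> + d"])
    show "AE \<omega> in M. c * \<Phi> (config \<omega>) + d = c * V \<omega> + d"
      using \<Phi>(2) by eventually_elim simp
    show "AE \<omega> in M. AE z in n. c * \<Phi> (add_point (config \<omega>) z) + d = c * V \<omega> + d + c * v z"
      using \<Phi>(3)
    proof eventually_elim
      case (elim \<omega>)
      then show ?case by eventually_elim (simp add: algebra_simps)
    qed
  qed measurable
qed

lemma point_additive_add:
  fixes V W :: "'w \<Rightarrow> real"
  assumes "point_additive V v" "point_additive W w"
  shows "point_additive (\<lambda>\<omega>. V \<omega> + W \<omega>) (\<lambda>z. v z + w z)"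
proof -
  from assms(1) obtain \<Phi> where \<Phi>: "\<Phi> \<in> borel_measurable configs" "AE \<omega> in M. \<Phi> (config \<omega>) = V \<omega>"
    "AE \<omega> in M. AE z in n. \<Phi> (add_point (config \<omega>) z) = V \<omega> + v z"
    by (rule point_additiveE)
  from assms(2) obtain \<Psi> where \<Psi>: "\<Psi> \<in> borel_measurable configs" "AE \<omega> in M. \<Psi> (config \<omega>) = W \<omega>"
    "AE \<omega> in M. AE z in n. \<Psi> (add_point (config \<omega>) z) = W \<omega> + w z"
    by (rule point_additiveE)
  note [measurable] = \<Phi>(1) \<Psi>(1)
  show ?thesis
  proof (rule point_additiveI[of "\<lambda>\<xi>. \<Phi> \<xi> + \<Psi> \<xi>"])
    show "AE \<omega> in M. \<Phi> (config \<omega>) + \<Psi> (config \<omega>) = V \<omega> + W \<omega>"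
      using \<Phi>(2) \<Psi>(2) by eventually_elim simp
    show "AE \<omega> in M. AE z in n. \<Phi> (add_point (config \<omega>) z) + \<Psi> (add_point (config \<omega>) z)
        = V \<omega> + W \<omega> + (v z + w z)"
      using \<Phi>(3) \<Psi>(3)
    proof eventually_elim
      case (elim \<omega>)
      then show ?case by eventually_elim simp
    qed
  qed measurable
qed

lemma point_additive_sum:
  fixes V :: "'i \<Rightarrow> 'w \<Rightarrow> real"
  assumes "finite I" "\<And>i. i \<in> I \<Longrightarrow> point_additive (V i) (v i)"
  shows "point_additive (\<lambda>\<omega>. \<Sum>i\<in>I. V i \<omega>) (\<lambda>z. \<Sum>i\<in>I. v i z)"
  using assms
proof (induction I rule: finite_induct)
  case empty
  show ?case by (rule point_additiveI[of "\<lambda>_. 0"]) auto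
next
  case (insert i I)
  then show ?case
    using point_additive_add[of "V i" "v i" "\<lambda>\<omega>. \<Sum>i\<in>I. V i \<omega>" "\<lambda>z. \<Sum>i\<in>I. v i z"] by simp
qed

text \<open>
  The increments \<open>v\<close> have to converge as well; they do so because in the definition of the integral by
  approximation the simple integrands converge to \<open>f\<close> and not only their integrals.
\<close>
lemma point_additive_limit:
  fixes V :: "nat \<Rightarrow> 'w \<Rightarrow> real"
  assumes pa: "\<And>k. point_additive (V k) (v k)"
    and V: "AE \<omega> in M. (\<lambda>k. V k \<omega>) \<longlonglongrightarrow> V' \<omega>" and v: "AE z in n. (\<lambda>k. v k z) \<longlonglongrightarrow> v' z"
  shows "point_additive V' v'"
proof -
  have "\<forall>k. \<exists>\<Phi>. \<Phi> \<in> borel_measurable configs \<and> (AE \<omega> in M. \<Phi> (config \<omega>) = V k \<omega>)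
     \<and> (AE \<omega> in M. AE z in n. \<Phi> (add_point (config \<omega>) z) = V k \<omega> + v k z)"
    by (rule allI, rule point_additiveE[OF pa]) blast
  from choice[OF this] obtain \<Phi> where \<Phi>': "\<forall>k. \<Phi> k \<in> borel_measurable configs
     \<and> (AE \<omega> in M. \<Phi> k (config \<omega>) = V k \<omega>)
     \<and> (AE \<omega> in M. AE z in n. \<Phi> k (add_point (config \<omega>) z) = V k \<omega> + v k z)" ..
  have \<Phi>: "\<Phi> k \<in> borel_measurable configs" "AE \<omega> in M. \<Phi> k (config \<omega>) = V k \<omega>"
    "AE \<omega> in M. AE z in n. \<Phi> k (add_point (config \<omega>) z) = V k \<omega> + v k z" for k
    using \<Phi>' by simp_all
  note [measurable] = \<Phi>(1)
  have all: "AE \<omega> in M. \<forall>k. \<Phi> k (config \<omega>) = V k \<omega>"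
    "AE \<omega> in M. \<forall>k. AE z in n. \<Phi> k (add_point (config \<omega>) z) = V k \<omega> + v k z"
    using \<Phi>(2,3) by (simp_all add: AE_all_countable)
  show ?thesis
  proof (rule point_additiveI[of "\<lambda>\<xi>. lim (\<lambda>k. \<Phi> k \<xi>)"])
    show "AE \<omega> in M. lim (\<lambda>k. \<Phi> k (config \<omega>)) = V' \<omega>"
      using all(1) V by eventually_elim (auto intro: limI)
    show "AE \<omega> in M. AE z in n. lim (\<lambda>k. \<Phi> k (add_point (config \<omega>) z)) = V' \<omega> + v' z"
      using all(2) V
    proof eventually_elim
      case (elim \<omega>)
      from elim(1) have "AE z in n. \<forall>k. \<Phi> k (add_point (config \<omega>) z) = V k \<omega> + v k z"
        by (simp add: AE_all_countable)
      with v show ?case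
        by eventually_elim (auto intro!: limI tendsto_add elim(2))
    qed
  qed measurable
qed

lemma point_additive_nn_integral:
  assumes J: "prm_nn_integral M n N f J"
  shows "point_additive J f"
proof -
  obtain s :: "nat \<Rightarrow> 's \<Rightarrow> ennreal" where s: "\<And>k. simple_function n (s k)"
    and lim: "\<And>x. x \<in> space n \<Longrightarrow> (\<lambda>k. s k x) \<longlonglongrightarrow> f x"
    and J_lim: "AE \<omega> in M. (\<lambda>k. simple_charge (s k) (config \<omega>)) \<longlonglongrightarrow> J \<omega>"
    using J by (auto simp: prm_nn_integral_def simple_charge_config)
  note [measurable] = simple_charge_measurable[OF s]
  show ?thesis
  proof (rule point_additiveI[of "\<lambda>\<xi>. liminf (\<lambda>k. simple_charge (s k) \<xi>)"])
    show "AE \<omega> in M. liminf (\<lambda>k. simple_charge (s k) (config \<omega>)) = J \<omega>"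
      using J_lim by eventually_elim (auto intro: lim_imp_Liminf)
    show "AE \<omega> in M. AE z in n. liminf (\<lambda>k. simple_charge (s k) (add_point (config \<omega>) z)) = J \<omega> + f z"
      using J_lim
    proof eventually_elim
      case (elim \<omega>)
      show ?case
      proof (rule AE_I2)
        fix z assume z: "z \<in> space n"
        have "(\<lambda>k. simple_charge (s k) (config \<omega>) + s k z) \<longlonglongrightarrow> J \<omega> + f z"
          using elim lim[OF z] by (rule tendsto_add)
        then show "liminf (\<lambda>k. simple_charge (s k) (add_point (config \<omega>) z)) = J \<omega> + f z"
          using z s by (auto simp: simple_charge_add_point intro: lim_imp_Liminf)
      qed
    qed
  qed measurable
qed

lemma point_additive_enn2real:
  assumes pa: "point_additive V v" and V: "AE \<omega> in M. V \<omega> < \<infinity>" and v: "AE z in n. v z < \<infinity>"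
  shows "point_additive (\<lambda>\<omega>. enn2real (V \<omega>)) (\<lambda>z. enn2real (v z))"
proof -
  from pa obtain \<Phi> where \<Phi>: "\<Phi> \<in> borel_measurable configs" "AE \<omega> in M. \<Phi> (config \<omega>) = V \<omega>"
    "AE \<omega> in M. AE z in n. \<Phi> (add_point (config \<omega>) z) = V \<omega> + v z"
    by (rule point_additiveE)
  note [measurable] = \<Phi>(1)
  show ?thesis
  proof (rule point_additiveI[of "\<lambda>\<xi>. enn2real (\<Phi> \<xi>)"])
    show "AE \<omega> in M. enn2real (\<Phi> (config \<omega>)) = enn2real (V \<omega>)"
      using \<Phi>(2) by eventually_elim simp
    show "AE \<omega> in M. AE z in n. enn2real (\<Phi> (add_point (config \<omega>) z)) = enn2real (V \<omega>) + enn2real (v z)"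
      using \<Phi>(3) V
    proof eventually_elim
      case (elim \<omega>)
      from elim(1) v show ?case
        by eventually_elim (use elim(2) in \<open>simp add: enn2real_plus\<close>)
    qed
  qed measurable
qed

lemma point_additive_N:
  assumes A [measurable]: "A \<in> sets n" and fin: "emeasure n A < \<infinity>"
  shows "point_additive (\<lambda>\<omega>. enn2real (N A \<omega>)) (indicator A)"
proof -
  have "point_additive (N A) (indicator A)"
    by (rule point_additiveI[of "\<lambda>\<xi>. \<xi> A"]) (auto simp: config_apply add_point_apply)
  then have "point_additive (\<lambda>\<omega>. enn2real (N A \<omega>)) (\<lambda>z. enn2real (indicator A z))"
    using N_finite[OF A fin] by (rule point_additive_enn2real) (auto simp: indicator_def)
  then show ?thesis
    by (rule point_additive_cong) (auto simp: indicator_def)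
qed

text \<open>
  Compensation subtracts a constant, so only the atom at \<open>z\<close> contributes to the increment.
\<close>
lemma point_additive_compensated_simple:
  assumes s: "simple_function n s" and fin: "emeasure n {x \<in> space n. s x \<noteq> 0} < \<infinity>"
  shows "point_additive (compensated_simple_integral n N s) s"
proof -
  define S where "S y = s -` {y} \<inter> space n" for y
  have S [measurable]: "S y \<in> sets n" for y
    unfolding S_def by (rule simple_functionD[OF s])
  have S_fin: "emeasure n (S y) < \<infinity>" if "y \<noteq> 0" for y
  proof -
    have "emeasure n (S y) \<le> emeasure n {x \<in> space n. s x \<noteq> 0}"
      using that borel_measurable_simple_function[OF s] by (intro emeasure_mono) (auto simp: S_def)
    with fin show ?thesis by (rule le_less_trans[rotated])
  qed
  have "point_additive (\<lambda>\<omega>. \<Sum>y\<in>s ` space n - {0}. y * enn2real (N (S y) \<omega>) + - y * measure n (S y))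
      (\<lambda>z. \<Sum>y\<in>s ` space n - {0}. y * indicator (S y) z)"
    using simple_functionD(1)[OF s] S_fin
    by (intro point_additive_sum point_additive_affine point_additive_N) auto
  then show ?thesis
  proof (rule point_additive_cong)
    show "AE \<omega> in M. (\<Sum>y\<in>s ` space n - {0}. y * enn2real (N (S y) \<omega>) + - y * measure n (S y))
        = compensated_simple_integral n N s \<omega>"
      by (simp add: compensated_simple_integral_def S_def algebra_simps)
    show "AE z in n. (\<Sum>y\<in>s ` space n - {0}. y * indicator (S y) z) = s z"
    proof (rule AE_I2)
      fix z assume z: "z \<in> space n"
      have "(\<Sum>y\<in>s ` space n - {0}. y * indicator (S y) z) = (\<Sum>y\<in>s ` space n. y * indicator (S y) z)"
        using simple_functionD(1)[OF s] by (intro sum.mono_neutral_left) auto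
      also have "\<dots> = (\<Sum>y\<in>s ` space n. indicator (s -` {y} \<inter> space n) z *\<^sub>R y)"
        by (intro sum.cong) (simp_all add: S_def)
      also have "\<dots> = s z"
        by (rule simple_function_indicator_representation_banach[OF s z, symmetric])
      finally show "(\<Sum>y\<in>s ` space n - {0}. y * indicator (S y) z) = s z" .
    qed
  qed
qed

lemma compensated_simple_measurable [measurable]:
  assumes s: "simple_function n s"
  shows "compensated_simple_integral n N s \<in> borel_measurable M"
proof -
  have [measurable]: "s -` {y} \<inter> space n \<in> sets n" for y
    by (rule simple_functionD[OF s])
  have "(\<lambda>\<omega>. compensated_simple_integral n N s \<omega>) \<in> borel_measurable M"
    unfolding compensated_simple_integral_def by measurable
  then show ?thesis by simp
qed

text \<open>
  Two successive subsequences turn the convergence in \<open>L\<^sup>2\<close> of the integrands and of the integrals into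
  almost everywhere convergence along a common subsequence.
\<close>
lemma point_additive_L2_integral:
  assumes J: "prm_L2_integral M n N f J" and f [measurable]: "f \<in> borel_measurable n"
  shows "point_additive J f"
proof -
  obtain s :: "nat \<Rightarrow> 's \<Rightarrow> real" where [measurable]: "J \<in> borel_measurable M"
    and s: "\<And>k. simple_function n (s k)" "\<And>k. emeasure n {x \<in> space n. s k x \<noteq> 0} < \<infinity>"
    and f_lim: "(\<lambda>k. \<integral>\<^sup>+x. ennreal ((s k x - f x)\<^sup>2) \<partial>n) \<longlonglongrightarrow> 0"
    and J_lim: "(\<lambda>k. \<integral>\<^sup>+\<omega>. ennreal ((compensated_simple_integral n N (s k) \<omega> - J \<omega>)\<^sup>2) \<partial>M) \<longlonglongrightarrow> 0"
    using J by (auto simp: prm_L2_integral_def)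
  note [measurable] = borel_measurable_simple_function[OF s(1)] compensated_simple_measurable[OF s(1)]
  have m1: "(\<lambda>x. s k x - f x) \<in> borel_measurable n" for k by measurable
  obtain r1 :: "nat \<Rightarrow> nat" where r1: "strict_mono r1" "AE x in n. (\<lambda>k. s (r1 k) x - f x) \<longlonglongrightarrow> 0"
    by (rule tendsto_L2_AE_subseq[OF m1 f_lim])
  have m2: "(\<lambda>\<omega>. compensated_simple_integral n N (s (r1 k)) \<omega> - J \<omega>) \<in> borel_measurable M" for k
    by measurable
  have lim2: "(\<lambda>k. \<integral>\<^sup>+\<omega>. ennreal ((compensated_simple_integral n N (s (r1 k)) \<omega> - J \<omega>)\<^sup>2) \<partial>M) \<longlonglongrightarrow> 0"
    using LIMSEQ_subseq_LIMSEQ[OF J_lim r1(1)] by (simp add: comp_def)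
  obtain r2 :: "nat \<Rightarrow> nat" where r2: "strict_mono r2"
    "AE \<omega> in M. (\<lambda>k. compensated_simple_integral n N (s (r1 (r2 k))) \<omega> - J \<omega>) \<longlonglongrightarrow> 0"
    by (rule tendsto_L2_AE_subseq[OF m2 lim2])
  show ?thesis
  proof (rule point_additive_limit)
    show "point_additive (compensated_simple_integral n N (s (r1 (r2 k)))) (s (r1 (r2 k)))" for k
      using s by (rule point_additive_compensated_simple)
    show "AE \<omega> in M. (\<lambda>k. compensated_simple_integral n N (s (r1 (r2 k))) \<omega>) \<longlonglongrightarrow> J \<omega>"
      using r2(2) by eventually_elim (auto dest: LIM_zero_cancel)
    show "AE z in n. (\<lambda>k. s (r1 (r2 k)) z) \<longlonglongrightarrow> f z"
      using r1(2)
    proof eventually_elim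
      case (elim z)
      from LIMSEQ_subseq_LIMSEQ[OF LIM_zero_cancel[OF elim] r2(1)] show ?case
        by (simp add: comp_def)
    qed
  qed
qed

lemma point_additive_integral:
  assumes J: "prm_integral M n N f J"
  shows "point_additive J f"
proof -
  obtain P Q where P: "prm_nn_integral M n N (\<lambda>x. ennreal (f x)) P"
    and Q: "prm_nn_integral M n N (\<lambda>x. ennreal (- f x)) Q"
    and PQ: "AE \<omega> in M. P \<omega> < \<infinity> \<and> Q \<omega> < \<infinity> \<and> J \<omega> = enn2real (P \<omega>) - enn2real (Q \<omega>)"
    using J by (auto simp: prm_integral_def)
  have "point_additive (\<lambda>\<omega>. enn2real (P \<omega>)) (\<lambda>z. enn2real (ennreal (f z)))"
    using PQ by (intro point_additive_enn2real point_additive_nn_integral[OF P]) auto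
  moreover have "point_additive (\<lambda>\<omega>. enn2real (Q \<omega>)) (\<lambda>z. enn2real (ennreal (- f z)))"
    using PQ by (intro point_additive_enn2real point_additive_nn_integral[OF Q]) auto
  ultimately have "point_additive (\<lambda>\<omega>. enn2real (P \<omega>) + (- 1 * enn2real (Q \<omega>) + 0))
      (\<lambda>z. enn2real (ennreal (f z)) + (- 1 * enn2real (ennreal (- f z))))"
    by (intro point_additive_add point_additive_affine)
  then show ?thesis
  proof (rule point_additive_cong)
    show "AE \<omega> in M. enn2real (P \<omega>) + (- 1 * enn2real (Q \<omega>) + 0) = J \<omega>"
      using PQ by eventually_elim simp
    show "AE z in n. enn2real (ennreal (f z)) + (- 1 * enn2real (ennreal (- f z))) = f z"
    proof (rule AE_I2)
      fix z
      show "enn2real (ennreal (f z)) + (- 1 * enn2real (ennreal (- f z))) = f z"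
        by (cases "f z \<ge> 0") (simp_all add: ennreal_neg)
    qed
  qed
qed

lemma point_additive_compensated_integral:
  assumes J: "prm_compensated_integral M n N chi f J"
  shows "point_additive J f"
proof -
  obtain J1 J2 where f [measurable]: "f \<in> borel_measurable n"
    and J1: "prm_L2_integral M n N (\<lambda>x. f x * indicator {x. \<bar>f x\<bar> \<le> 1} x) J1"
    and J2: "prm_integral M n N (\<lambda>x. f x * indicator {x. \<bar>f x\<bar> > 1} x) J2"
    and eq: "AE \<omega> in M. J \<omega> = J1 \<omega> + J2 \<omega>
                + (\<integral>x. f x * (indicator {x. \<bar>f x\<bar> \<le> 1} x - chi (f x)) \<partial>n)"
    using J by (auto simp: prm_compensated_integral_def)
  let ?c = "\<integral>x. f x * (indicator {x. \<bar>f x\<bar> \<le> 1} x - chi (f x)) \<partial>n"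
  have "(\<lambda>x. f x * (if \<bar>f x\<bar> \<le> 1 then 1 else 0)) \<in> borel_measurable n"
    by measurable
  then have "(\<lambda>x. f x * indicator {x. \<bar>f x\<bar> \<le> 1} x) \<in> borel_measurable n"
    by (simp add: indicator_def)
  then have "point_additive (\<lambda>\<omega>. 1 * (J1 \<omega> + J2 \<omega>) + ?c)
      (\<lambda>z. 1 * (f z * indicator {x. \<bar>f x\<bar> \<le> 1} z + f z * indicator {x. \<bar>f x\<bar> > 1} z))"
    by (intro point_additive_affine point_additive_add point_additive_L2_integral[OF J1]
        point_additive_integral[OF J2])
  then show ?thesis
  proof (rule point_additive_cong)
    show "AE \<omega> in M. 1 * (J1 \<omega> + J2 \<omega>) + ?c = J \<omega>"
      using eq by eventually_elim simp
  qed (auto simp: indicator_def)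
qed

end

section \<open>Paths indexed by an uncountable set\<close>

text \<open>
  The product sigma-algebra is generated by events that look at one coordinate, and depending on countably many
  coordinates is preserved by complements and countable unions.
\<close>
lemma countable_coordinates_set:
  assumes "A \<in> sets (cyl :: ('t \<Rightarrow> real) measure)"
  shows "\<exists>J. countable J \<and> (\<forall>x y. (\<forall>t\<in>J. x t = y t) \<longrightarrow> (x \<in> A \<longleftrightarrow> y \<in> A))"
  using assms unfolding sets_PiM_single
proof (induction A rule: sigma_sets.induct)
  case (Basic a)
  then obtain i B where "a = {f \<in> Pi\<^sub>E UNIV (\<lambda>_. space borel). f i \<in> B}" by blast
  then show ?case by (intro exI[of _ "{i}"]) auto
next
  case Empty
  show ?case by (intro exI[of _ "{}"]) auto
next
  case (Compl a)
  then obtain J where "countable J" "\<forall>x y. (\<forall>t\<in>J. x t = y t) \<longrightarrow> (x \<in> a \<longleftrightarrow> y \<in> a)" by blast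
  then show ?case by (intro exI[of _ J]) auto
next
  case (Union a)
  from choice[OF allI[OF Union.IH]]
  obtain J where J': "\<forall>i. countable (J i) \<and> (\<forall>x y. (\<forall>t\<in>J i. x t = y t) \<longrightarrow> (x \<in> a i \<longleftrightarrow> y \<in> a i))" ..
  have J: "countable (J i)" "(\<forall>t\<in>J i. x t = y t) \<Longrightarrow> (x \<in> a i \<longleftrightarrow> y \<in> a i)" for i x y
    using J'[rule_format, of i] by simp_all
  show ?case
  proof (intro exI[of _ "\<Union>i. J i"] conjI allI impI)
    show "countable (\<Union>i. J i)" using J(1) by auto
    fix x y :: "'t \<Rightarrow> real" assume "\<forall>t\<in>\<Union>i. J i. x t = y t"
    then have "x \<in> a i \<longleftrightarrow> y \<in> a i" for i by (intro J(2)) auto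
    then show "x \<in> (\<Union>i. a i) \<longleftrightarrow> y \<in> (\<Union>i. a i)" by auto
  qed
qed

text \<open>
  For uncountable index sets this replaces an almost sure identity of whole paths: identities that hold
  almost surely at each single time hold simultaneously at the countably many times that \<open>F\<close> sees. The proof
  collects the coordinates needed for the preimages of a countable base.
\<close>
lemma countable_coordinates:
  fixes F :: "('t \<Rightarrow> real) \<Rightarrow> 'b::{second_countable_topology, t2_space}"
  assumes [measurable]: "F \<in> borel_measurable cyl"
  obtains J where "countable J" "\<And>x y. (\<And>t. t \<in> J \<Longrightarrow> x t = y t) \<Longrightarrow> F x = F y"
proof -
  obtain \<B> :: "'b set set" where \<B>: "countable \<B>" "topological_basis \<B>"
    using ex_countable_basis by blast
  have "\<forall>U. \<exists>J. U \<in> \<B> \<longrightarrow> countable J \<and> (\<forall>x y. (\<forall>t\<in>J. x t = y t) \<longrightarrow> (F x \<in> U \<longleftrightarrow> F y \<in> U))"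
  proof
    fix U
    show "\<exists>J. U \<in> \<B> \<longrightarrow> countable J \<and> (\<forall>x y. (\<forall>t\<in>J. x t = y t) \<longrightarrow> (F x \<in> U \<longleftrightarrow> F y \<in> U))"
    proof (cases "U \<in> \<B>")
      case True
      then have "open U" using \<B>(2) by (rule topological_basis_open[rotated])
      then have "F -` U \<inter> space cyl \<in> sets cyl"
        by (intro measurable_sets[OF assms]) auto
      from countable_coordinates_set[OF this] show ?thesis
        by (auto simp: space_PiM)
    qed simp
  qed
  from choice[OF this] obtain J where
    J': "\<forall>U. U \<in> \<B> \<longrightarrow> countable (J U) \<and> (\<forall>x y. (\<forall>t\<in>J U. x t = y t) \<longrightarrow> (F x \<in> U \<longleftrightarrow> F y \<in> U))" ..
  have J: "countable (J U)" "(\<forall>t\<in>J U. x t = y t) \<Longrightarrow> (F x \<in> U \<longleftrightarrow> F y \<in> U)" if "U \<in> \<B>" for U x y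
    using J'[rule_format, OF that] by simp_all
  show ?thesis
  proof (rule that[of "\<Union>U\<in>\<B>. J U"])
    show "countable (\<Union>U\<in>\<B>. J U)" using \<B>(1) J(1) by auto
    fix x y :: "'t \<Rightarrow> real" assume agree: "\<And>t. t \<in> (\<Union>U\<in>\<B>. J U) \<Longrightarrow> x t = y t"
    show "F x = F y"
    proof (rule ccontr)
      assume "F x \<noteq> F y"
      then obtain V where "open V" "F x \<in> V" "F y \<notin> V"
        using t1_space by blast
      then obtain U where U: "U \<in> \<B>" "F x \<in> U" "U \<subseteq> V"
        using \<B>(2) by (metis topological_basisE)
      with J(2)[of U x y] agree \<open>F y \<notin> V\<close> show False by blast
    qed
  qed
qed

section \<open>Independent maps\<close>

lemma sample_path_measurable:
  "stoch_process M X \<Longrightarrow> sample_path X \<in> measurable M cyl"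
  unfolding stoch_process_def by (intro measurable_PiM_single') auto

lemma path_add_measurable [measurable (raw)]:
  assumes "f \<in> measurable M (cyl :: ('t \<Rightarrow> real) measure)" "g \<in> measurable M (cyl :: ('t \<Rightarrow> real) measure)"
  shows "(\<lambda>x t. f x t + g x t) \<in> measurable M cyl"
proof (intro measurable_PiM_single')
  fix t :: 't
  have "(\<lambda>x. f x t) \<in> borel_measurable M" "(\<lambda>x. g x t) \<in> borel_measurable M"
    using assms by (auto intro: measurable_compose[OF _ measurable_component_singleton])
  then show "(\<lambda>x. f x t + g x t) \<in> borel_measurable M" by measurable
qed auto

lemma Int_stable_gen_events: "Int_stable (gen_events M K X)"
proof (rule Int_stableI)
  fix a b assume "a \<in> gen_events M K X" "b \<in> gen_events M K X"
  then obtain A B where "A \<in> sets K" "B \<in> sets K" "a = X -` A \<inter> space M" "b = X -` B \<inter> space M"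
    by (auto simp: gen_events_def)
  then show "a \<inter> b \<in> gen_events M K X"
    unfolding gen_events_def by (intro CollectI exI[of _ "A \<inter> B"]) auto
qed

lemma gen_events_subset_Pow: "gen_events M K X \<subseteq> Pow (space M)"
  by (auto simp: gen_events_def)

lemma measurable_sigma_gen_events:
  assumes X: "X \<in> measurable M K" and sub: "gen_events M K X \<subseteq> \<E>" and E: "\<E> \<subseteq> Pow (space M)"
  shows "X \<in> measurable (sigma (space M) \<E>) K"
proof (rule measurableI)
  show "X x \<in> space K" if "x \<in> space (sigma (space M) \<E>)" for x
    using that X E by (auto simp: measurable_space)
  show "X -` A \<inter> space (sigma (space M) \<E>) \<in> sets (sigma (space M) \<E>)" if "A \<in> sets K" for A
    using that sub E by (auto simp: gen_events_def intro!: sigma_sets.Basic)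
qed

text \<open>
  Phrased through the generated events since the two maps take values in spaces of different types.
\<close>
definition (in prob_space) indep_maps :: "'b measure \<Rightarrow> ('a \<Rightarrow> 'b) \<Rightarrow> 'c measure \<Rightarrow> ('a \<Rightarrow> 'c) \<Rightarrow> bool" where
  "indep_maps S X T Y \<longleftrightarrow> X \<in> measurable M S \<and> Y \<in> measurable M T
     \<and> indep_set (gen_events M S X) (gen_events M T Y)"

lemma (in prob_space) distr_indep_maps:
  assumes "indep_maps S X T Y"
  shows "distr M S X \<Otimes>\<^sub>M distr M T Y = distr M (S \<Otimes>\<^sub>M T) (\<lambda>\<omega>. (X \<omega>, Y \<omega>))"
proof (rule pair_measure_eqI)
  have [measurable]: "X \<in> measurable M S" "Y \<in> measurable M T"
    and ind: "indep_set (gen_events M S X) (gen_events M T Y)"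
    using assms by (auto simp: indep_maps_def)
  show "sigma_finite_measure (distr M S X)" "sigma_finite_measure (distr M T Y)"
    by (auto intro!: prob_space_imp_sigma_finite prob_space_distr)
  fix A B assume "A \<in> sets (distr M S X)" "B \<in> sets (distr M T Y)"
  then have [measurable]: "A \<in> sets S" "B \<in> sets T" by simp_all
  have "X -` A \<inter> space M \<in> gen_events M S X" "Y -` B \<inter> space M \<in> gen_events M T Y"
    by (auto simp: gen_events_def)
  then have "prob ((X -` A \<inter> space M) \<inter> (Y -` B \<inter> space M)) = prob (X -` A \<inter> space M) * prob (Y -` B \<inter> space M)"
    using ind by (auto simp: indep_sets2_eq)
  moreover have "(X -` A \<inter> space M) \<inter> (Y -` B \<inter> space M) = (\<lambda>\<omega>. (X \<omega>, Y \<omega>)) -` (A \<times> B) \<inter> space M"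
    by auto
  ultimately show "emeasure (distr M S X) A * emeasure (distr M T Y) B
      = emeasure (distr M (S \<Otimes>\<^sub>M T) (\<lambda>\<omega>. (X \<omega>, Y \<omega>))) (A \<times> B)"
    by (simp add: emeasure_distr emeasure_eq_measure ennreal_mult)
qed simp

lemma (in prob_space) nn_integral_indep_maps:
  assumes ind: "indep_maps S X T Y" and f [measurable]: "f \<in> borel_measurable (S \<Otimes>\<^sub>M T)"
  shows "(\<integral>\<^sup>+\<omega>. f (X \<omega>, Y \<omega>) \<partial>M) = (\<integral>\<^sup>+\<omega>. \<integral>\<^sup>+\<omega>'. f (X \<omega>, Y \<omega>') \<partial>M \<partial>M)"
proof -
  have [measurable]: "X \<in> measurable M S" "Y \<in> measurable M T"
    using ind by (auto simp: indep_maps_def)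
  note D = distr_indep_maps[OF ind]
  interpret Y: prob_space "distr M T Y" by (rule prob_space_distr) measurable
  have m: "f \<in> borel_measurable (distr M S X \<Otimes>\<^sub>M distr M T Y)" by measurable
  have "(\<integral>\<^sup>+\<omega>. f (X \<omega>, Y \<omega>) \<partial>M) = (\<integral>\<^sup>+p. f p \<partial>(distr M S X \<Otimes>\<^sub>M distr M T Y))"
    unfolding D by (simp add: nn_integral_distr)
  also have "\<dots> = (\<integral>\<^sup>+x. \<integral>\<^sup>+y. f (x, y) \<partial>distr M T Y \<partial>distr M S X)"
    by (rule Y.nn_integral_fst[OF m, symmetric])
  also have "\<dots> = (\<integral>\<^sup>+\<omega>. \<integral>\<^sup>+y. f (X \<omega>, y) \<partial>distr M T Y \<partial>M)"
    by (rule nn_integral_distr) measurable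
  also have "\<dots> = (\<integral>\<^sup>+\<omega>. \<integral>\<^sup>+\<omega>'. f (X \<omega>, Y \<omega>') \<partial>M \<partial>M)"
  proof (rule nn_integral_cong)
    fix \<omega> assume "\<omega> \<in> space M"
    then have "X \<omega> \<in> space S" by (intro measurable_space[of X M S]) measurable
    then have "(\<lambda>y. f (X \<omega>, y)) \<in> borel_measurable T" by measurable
    then show "(\<integral>\<^sup>+y. f (X \<omega>, y) \<partial>distr M T Y) = (\<integral>\<^sup>+\<omega>'. f (X \<omega>, Y \<omega>') \<partial>M)"
      by (intro nn_integral_distr) auto
  qed
  finally show ?thesis .
qed

text \<open>
  Disjoint blocks of an independent family of intersection-stable generators generate independent
  sigma-algebras. This turns joint independence of \<open>G\<close>, \<open>N\<close> and \<open>Z\<close> into independence of the pair \<open>(G, N)\<close>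
  from \<open>Z\<close>.
\<close>
lemma (in prob_space) indep_maps_of_indep_sets:
  fixes E :: "nat \<Rightarrow> 'a set set"
  assumes ind: "indep_sets E K" and I: "I1 \<subseteq> K" "I2 \<subseteq> K" "I1 \<inter> I2 = {}"
    and stable: "\<And>i. i \<in> K \<Longrightarrow> Int_stable (E i)"
    and X: "X \<in> measurable M S" "X \<in> measurable (sigma (space M) (\<Union>i\<in>I1. E i)) S"
    and Y: "Y \<in> measurable M T" "Y \<in> measurable (sigma (space M) (\<Union>i\<in>I2. E i)) T"
  shows "indep_maps S X T Y"
proof -
  have E: "E i \<subseteq> Pow (space M)" if "i \<in> K" for i
  proof -
    have "E i \<subseteq> events" using ind that by (simp add: indep_sets_def)
    then show ?thesis using sets.space_closed by blast
  qed
  define I where "I = case_bool I1 I2"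
  have sig: "indep_sets (\<lambda>j. sigma_sets (space M) (\<Union>i\<in>I j. E i)) UNIV"
  proof (rule indep_sets_collect_sigma)
    show "indep_sets E (\<Union>j\<in>UNIV. I j)"
      using I by (intro indep_sets_mono_index[OF _ ind]) (auto simp: I_def split: bool.splits)
    show "Int_stable (E i)" if "i \<in> I j" for i j
      using that I by (intro stable) (auto simp: I_def split: bool.splits)
    show "disjoint_family_on I UNIV"
      using I by (auto simp: I_def disjoint_family_on_def split: bool.splits)
  qed
  have gX: "gen_events M S X \<subseteq> sigma_sets (space M) (\<Union>i\<in>I1. E i)"
  proof -
    have "(\<Union>i\<in>I1. E i) \<subseteq> Pow (space M)" using E I by blast
    then show ?thesis
      using measurable_sets[OF X(2)] by (auto simp: gen_events_def sets_measure_of space_measure_of)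
  qed
  have gY: "gen_events M T Y \<subseteq> sigma_sets (space M) (\<Union>i\<in>I2. E i)"
  proof -
    have "(\<Union>i\<in>I2. E i) \<subseteq> Pow (space M)" using E I by blast
    then show ?thesis
      using measurable_sets[OF Y(2)] by (auto simp: gen_events_def sets_measure_of space_measure_of)
  qed
  have "indep_set (gen_events M S X) (gen_events M T Y)"
    unfolding indep_set_def
  proof (rule indep_sets_mono_sets[OF sig])
    fix j :: bool
    show "(case j of True \<Rightarrow> gen_events M S X | False \<Rightarrow> gen_events M T Y) \<subseteq> sigma_sets (space M) (\<Union>i\<in>I j. E i)"
      using gX gY by (cases j) (simp_all add: I_def)
  qed
  then show ?thesis
    using X(1) Y(1) by (simp add: indep_maps_def)
qed

context prm_space
begin

lemma independent_GNZ_indep_maps: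
  fixes G Z :: "'t \<Rightarrow> 'w \<Rightarrow> real"
  assumes ind: "independent_GNZ M n G N Z" and G: "stoch_process M G" and Z: "stoch_process M Z"
  shows "indep_maps cyl (sample_path G) configs config"
    and "indep_maps (cyl \<Otimes>\<^sub>M configs) (\<lambda>\<omega>. (sample_path G \<omega>, config \<omega>)) cyl (sample_path Z)"
proof -
  note [measurable] = sample_path_measurable[OF G] sample_path_measurable[OF Z]
  define E where "E = (\<lambda>i::nat. [gen_events M cyl (sample_path G), gen_events M configs config,
    gen_events M cyl (sample_path Z)] ! i)"
  have E: "E 0 = gen_events M cyl (sample_path G)" "E 1 = gen_events M configs config"
    "E 2 = gen_events M cyl (sample_path Z)"
    by (simp_all add: E_def)
  have iE: "indep_sets E {..<3}"
    using ind by (simp add: independent_GNZ_def E_def config_def[abs_def])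
  have stable: "Int_stable (E i)" if "i \<in> {..<3}" for i
  proof -
    have "i = 0 \<or> i = 1 \<or> i = 2" using that by auto
    then show ?thesis by (elim disjE) (simp_all only: E Int_stable_gen_events)
  qed
  note sub = gen_events_subset_Pow[THEN subsetD, THEN PowD, THEN subsetD]
  show "indep_maps cyl (sample_path G) configs config"
    by (rule indep_maps_of_indep_sets[OF iE, of "{0}" "{1}"])
      (use stable E in \<open>auto intro!: measurable_sigma_gen_events dest: sub\<close>)
  have GN: "sample_path G \<in> measurable (sigma (space M) (\<Union>i\<in>{0, 1}. E i)) cyl"
    "config \<in> measurable (sigma (space M) (\<Union>i\<in>{0, 1}. E i)) configs"
    using E by (auto intro!: measurable_sigma_gen_events dest: sub)
  show "indep_maps (cyl \<Otimes>\<^sub>M configs) (\<lambda>\<omega>. (sample_path G \<omega>, config \<omega>)) cyl (sample_path Z)"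
  proof (rule indep_maps_of_indep_sets[OF iE, of "{0, 1}" "{2}"])
    show "(\<lambda>\<omega>. (sample_path G \<omega>, config \<omega>)) \<in> measurable (sigma (space M) (\<Union>i\<in>{0, 1}. E i)) (cyl \<Otimes>\<^sub>M configs)"
      using GN by (rule measurable_Pair)
    show "sample_path Z \<in> measurable (sigma (space M) (\<Union>i\<in>{2}. E i)) cyl"
      using E by (auto intro!: measurable_sigma_gen_events dest: sub)
  qed (use stable in auto)
qed

text \<open>
  For a fixed value of the independent variable \<open>X\<close> this is the Mecke identity; both sides are then averaged
  over \<open>X\<close>. The variable \<open>J\<close> has to be replaced by a functional of the configuration before independence can be
  used.
\<close>
lemma mecke_independent:
  assumes J: "prm_nn_integral M n N f J" and f [measurable]: "f \<in> borel_measurable n"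
    and ind: "indep_maps K X configs config" and H [measurable]: "H \<in> borel_measurable (K \<Otimes>\<^sub>M configs)"
  shows "(\<integral>\<^sup>+\<omega>. H (X \<omega>, config \<omega>) * J \<omega> \<partial>M)
      = (\<integral>\<^sup>+\<omega>. \<integral>\<^sup>+z. f z * H (X \<omega>, add_point (config \<omega>) z) \<partial>n \<partial>M)"
proof -
  obtain \<Phi> where \<Phi> [measurable]: "\<Phi> \<in> borel_measurable configs" and \<Phi>_eq: "AE \<omega> in M. \<Phi> (config \<omega>) = J \<omega>"
    by (rule point_additiveE[OF point_additive_nn_integral[OF J]])
  have X [measurable]: "X \<in> measurable M K"
    using ind by (simp add: indep_maps_def)
  have "(\<integral>\<^sup>+\<omega>. H (X \<omega>, config \<omega>) * J \<omega> \<partial>M) = (\<integral>\<^sup>+\<omega>. H (X \<omega>, config \<omega>) * \<Phi> (config \<omega>) \<partial>M)"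
    using \<Phi>_eq by (intro nn_integral_cong_AE) auto
  also have "\<dots> = (\<integral>\<^sup>+\<omega>. \<integral>\<^sup>+\<omega>'. H (X \<omega>, config \<omega>') * \<Phi> (config \<omega>') \<partial>M \<partial>M)"
    using nn_integral_indep_maps[OF ind, of "\<lambda>p. H p * \<Phi> (snd p)"] by simp
  also have "\<dots> = (\<integral>\<^sup>+\<omega>. \<integral>\<^sup>+\<omega>'. H (X \<omega>, config \<omega>') * J \<omega>' \<partial>M \<partial>M)"
    using \<Phi>_eq by (intro nn_integral_cong nn_integral_cong_AE) auto
  also have "\<dots> = (\<integral>\<^sup>+\<omega>. \<integral>\<^sup>+\<omega>'. \<integral>\<^sup>+z. f z * H (X \<omega>, add_point (config \<omega>') z) \<partial>n \<partial>M \<partial>M)"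
  proof (rule nn_integral_cong)
    fix \<omega> assume "\<omega> \<in> space M"
    then have "X \<omega> \<in> space K" by (rule measurable_space[OF X])
    then have "(\<lambda>\<xi>. H (X \<omega>, \<xi>)) \<in> borel_measurable configs" by measurable
    from mecke[OF J this]
    show "(\<integral>\<^sup>+\<omega>'. H (X \<omega>, config \<omega>') * J \<omega>' \<partial>M)
        = (\<integral>\<^sup>+\<omega>'. \<integral>\<^sup>+z. f z * H (X \<omega>, add_point (config \<omega>') z) \<partial>n \<partial>M)" .
  qed
  also have "\<dots> = (\<integral>\<^sup>+\<omega>. \<integral>\<^sup>+z. f z * H (X \<omega>, add_point (config \<omega>) z) \<partial>n \<partial>M)"
  proof -
    have "(\<lambda>p. \<integral>\<^sup>+z. f z * H (fst p, add_point (snd p) z) \<partial>n) \<in> borel_measurable (K \<Otimes>\<^sub>M configs)"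
    proof (rule intensity.borel_measurable_nn_integral)
      have "(\<lambda>x. add_point (snd (fst x)) (snd x)) \<in> measurable ((K \<Otimes>\<^sub>M configs) \<Otimes>\<^sub>M n) configs"
        using measurable_compose[OF _ add_point_measurable, of "\<lambda>x. (snd (fst x), snd x)"] by simp
      then show "(\<lambda>(p, z). f z * H (fst p, add_point (snd p) z)) \<in> borel_measurable ((K \<Otimes>\<^sub>M configs) \<Otimes>\<^sub>M n)"
        by (simp add: split_beta')
    qed
    from nn_integral_indep_maps[OF ind this] show ?thesis by simp
  qed
  finally show ?thesis .
qed

text \<open>
  On \<open>{J = 0}\<close> the level sets \<open>{s k > 0}\<close> of the approximating simple functions carry no points, hence neither
  does their union \<open>{f > 0}\<close>, which almost surely carries infinitely many.
\<close>
lemma prm_nn_integral_pos: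
  assumes J: "prm_nn_integral M n N f J" and inf: "emeasure n {x \<in> space n. f x > 0} = \<infinity>"
  shows "AE \<omega> in M. J \<omega> > 0"
proof -
  obtain s :: "nat \<Rightarrow> 's \<Rightarrow> ennreal" where s: "\<And>k. simple_function n (s k)"
    and inc: "\<And>x. x \<in> space n \<Longrightarrow> incseq (\<lambda>k. s k x)"
    and lim: "\<And>x. x \<in> space n \<Longrightarrow> (\<lambda>k. s k x) \<longlonglongrightarrow> f x"
    and J_lim: "AE \<omega> in M. (\<lambda>k. simple_charge (s k) (config \<omega>)) \<longlonglongrightarrow> J \<omega>"
    using J by (auto simp: prm_nn_integral_def simple_charge_config)
  have [measurable]: "s k \<in> borel_measurable n" for k
    using s by (rule borel_measurable_simple_function)
  define S where "S k y = s k -` {y} \<inter> space n" for k y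
  have S: "S k y \<in> sets n" for k y
    unfolding S_def by (rule simple_functionD[OF s])
  have fin: "finite (s k ` space n)" for k by (rule simple_functionD[OF s])
  define A where "A k = {x \<in> space n. s k x > 0}" for k
  have A [measurable]: "A k \<in> sets n" for k unfolding A_def by measurable
  define D where "D = disjointed A"
  have D: "D k \<in> sets n" "D k \<subseteq> A k" for k
  proof -
    have "range A \<subseteq> sets n" using A by blast
    from sets.range_disjointed_sets[OF this] show "D k \<in> sets n" by (auto simp: D_def)
    show "D k \<subseteq> A k" by (simp add: D_def disjointed_subset)
  qed
  have U: "(\<Union>k. D k) = {x \<in> space n. f x > 0}"
  proof -
    have "f x > 0 \<longleftrightarrow> (\<exists>k. s k x > 0)" if "x \<in> space n" for x
    proof -
      have "f x = (SUP k. s k x)"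
        using LIMSEQ_unique[OF LIMSEQ_SUP[OF inc[OF that]] lim[OF that]] by simp
      then show ?thesis by (simp add: less_SUP_iff)
    qed
    then show ?thesis
      unfolding D_def UN_disjointed_eq A_def by auto
  qed
  have "range D \<subseteq> sets n" "disjoint_family D"
    using D by (auto simp: D_def disjoint_family_disjointed)
  note add = N_countably_additive[OF this]
  have "(\<Union>k. D k) \<in> sets n" using D by auto
  then have top: "AE \<omega> in M. N (\<Union>k. D k) \<omega> = \<infinity>"
    using inf by (intro N_infinite) (simp_all add: U)
  have "AE \<omega> in M. simple_charge (s k) (config \<omega>) \<le> simple_charge (s (Suc k)) (config \<omega>)" for k
    using inc by (intro simple_charge_mono s) (auto simp: incseq_Suc_iff)
  then have mono: "AE \<omega> in M. \<forall>k. simple_charge (s k) (config \<omega>) \<le> simple_charge (s (Suc k)) (config \<omega>)"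
    by (simp add: AE_all_countable)
  have "AE \<omega> in M. N (A k) \<omega> = (\<Sum>y\<in>s k ` space n - {0}. N (S k y) \<omega>)" for k
  proof -
    have "A k = (\<Union>y\<in>s k ` space n - {0}. S k y)"
      by (auto simp: A_def S_def zero_less_iff_neq_zero)
    moreover have "disjoint_family_on (S k) (s k ` space n - {0})"
      by (auto simp: disjoint_family_on_def S_def)
    ultimately show ?thesis
      using N_finitely_additive[of "s k ` space n - {0}" "S k"] fin[of k] S by simp
  qed
  then have NA: "AE \<omega> in M. \<forall>k. N (A k) \<omega> = (\<Sum>y\<in>s k ` space n - {0}. N (S k y) \<omega>)"
    by (simp add: AE_all_countable)
  have "AE \<omega> in M. \<forall>k. N (D k) \<omega> \<le> N (A k) \<omega>"
    using N_mono[OF D(1) A D(2)] by (simp add: AE_all_countable)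
  then show ?thesis
    using add top mono NA J_lim
  proof eventually_elim
    case (elim \<omega>)
    show ?case
    proof (rule ccontr)
      assume "\<not> 0 < J \<omega>"
      then have J0: "J \<omega> = 0" by (simp add: zero_less_iff_neq_zero)
      have "N (A k) \<omega> = 0" for k
      proof -
        have "simple_charge (s k) (config \<omega>) \<le> J \<omega>"
          using elim(4,6) by (intro incseq_le) (auto simp: incseq_Suc_iff)
        then have "simple_charge (s k) (config \<omega>) = 0" by (simp add: J0)
        then have "y * N (S k y) \<omega> = 0" if "y \<in> s k ` space n" for y
          using that fin[of k] by (auto simp: simple_charge_config[OF s] S_def sum_nonneg_eq_0_iff)
        then have "(\<Sum>y\<in>s k ` space n - {0}. N (S k y) \<omega>) = 0"
          by (intro sum.neutral) auto
        with elim(5) show ?thesis by simp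
      qed
      with elim(1) have "(\<Sum>k. N (D k) \<omega>) = 0" by simp
      with elim(2,3) show False by simp
    qed
  qed
qed

end

section \<open>Adding an independent process\<close>

lemma nn_integral_add_measure:
  assumes MN: "sets M = sets N" and f: "f \<in> borel_measurable M"
  shows "(\<integral>\<^sup>+x. f x \<partial>add_measure M N) = (\<integral>\<^sup>+x. f x \<partial>M) + (\<integral>\<^sup>+x. f x \<partial>N)"
  using f
proof (induction rule: borel_measurable_induct)
  case (cong f g)
  have "space M = space N" using MN by (rule sets_eq_imp_space_eq)
  then have "(\<integral>\<^sup>+x. g x \<partial>K) = (\<integral>\<^sup>+x. f x \<partial>K)" if "K \<in> {M, N, add_measure M N}" for K
    using cong(3) that by (intro nn_integral_cong) auto
  with cong(4) show ?case by simp
next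
  case (set A)
  then show ?case using MN by (simp add: emeasure_add_measure)
next
  case (mult u c)
  then have "u \<in> borel_measurable N" using measurable_cong_sets[OF MN refl] by blast
  with mult show ?case by (simp add: nn_integral_cmult distrib_left)
next
  case (add u v)
  then have "u \<in> borel_measurable N" "v \<in> borel_measurable N"
    using measurable_cong_sets[OF MN refl] by blast+
  with add show ?case by (simp add: nn_integral_add ac_simps)
next
  case (seq U)
  have N: "U i \<in> borel_measurable N" for i
    using seq(1) measurable_cong_sets[OF MN refl] by blast
  have A: "U i \<in> borel_measurable (add_measure M N)" for i
    using seq(1) by measurable
  have inc: "incseq (\<lambda>i. \<integral>\<^sup>+x. U i x \<partial>K)" for K
    using \<open>incseq U\<close> by (auto simp: incseq_def le_fun_def intro!: nn_integral_mono)
  have "(\<integral>\<^sup>+x. (SUP i. U i x) \<partial>add_measure M N) = (SUP i. (\<integral>\<^sup>+x. U i x \<partial>M) + (\<integral>\<^sup>+x. U i x \<partial>N))"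
    using nn_integral_monotone_convergence_SUP[OF \<open>incseq U\<close> A] seq(3) by (simp add: seq.IH)
  also have "\<dots> = (\<integral>\<^sup>+x. (SUP i. U i x) \<partial>M) + (\<integral>\<^sup>+x. (SUP i. U i x) \<partial>N)"
    using nn_integral_monotone_convergence_SUP[OF \<open>incseq U\<close> N]
      nn_integral_monotone_convergence_SUP[OF \<open>incseq U\<close> seq(1)]
    by (simp add: ennreal_SUP_add inc)
  finally show ?case by (simp add: SUP_apply[abs_def])
qed

text \<open>
  On a piece \<open>D\<close> of finite measure the inner measure of \<open>D - {0}\<close> is attained by a countable union of
  measurable sets that avoid the zero path. The complement of all these sets is null and contains the zero path.
\<close>
lemma levy_measure_null_set_at_zero:
  fixes \<nu> :: "('t \<Rightarrow> real) measure"
  assumes levy: "levy_measure \<nu>" and "sigma_finite_measure \<nu>"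
  shows "\<exists>U\<in>sets cyl. zero_path \<in> U \<and> emeasure \<nu> U = 0"
proof -
  interpret sigma_finite_measure \<nu> by fact
  have s: "sets \<nu> = sets cyl" using levy by (simp add: levy_measure_def)
  have sp: "space \<nu> = UNIV" using sets_eq_imp_space_eq[OF s] by (simp add: space_PiM)
  obtain D :: "nat \<Rightarrow> ('t \<Rightarrow> real) set" where D: "range D \<subseteq> sets \<nu>" "(\<Union>i. D i) = space \<nu>"
    "\<And>i. emeasure \<nu> (D i) \<noteq> \<infinity>"
    using sigma_finite by blast
  have "\<exists>V\<in>sets \<nu>. V \<subseteq> D i - {zero_path} \<and> emeasure \<nu> (D i - V) = 0" for i
  proof -
    let ?S = "{E \<in> sets \<nu>. E \<subseteq> D i - {zero_path}}"
    have Di: "D i \<in> sets \<nu>" using D(1) by blast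
    have eq: "emeasure \<nu> (D i) = (SUP E\<in>?S. emeasure \<nu> E)"
      using levy Di by (simp add: levy_measure_def)
    have "?S \<noteq> {}" by blast
    then obtain f :: "nat \<Rightarrow> ennreal" where f: "range f \<subseteq> emeasure \<nu> ` ?S"
      "(SUP E\<in>?S. emeasure \<nu> E) = (SUP k. f k)"
      using ennreal_Sup_countable_SUP[of "emeasure \<nu> ` ?S"] by auto
    have "\<forall>k. \<exists>E. E \<in> ?S \<and> f k = emeasure \<nu> E"
      using f(1) by (simp add: image_subset_iff) blast
    from choice[OF this] obtain E where E': "\<forall>k. E k \<in> ?S \<and> f k = emeasure \<nu> (E k)" ..
    have E: "E k \<in> sets \<nu>" "E k \<subseteq> D i - {zero_path}" "f k = emeasure \<nu> (E k)" for k
      using E' by auto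
    define V where "V = (\<Union>k. E k)"
    have V: "V \<in> sets \<nu>" "V \<subseteq> D i - {zero_path}" using E(1,2) by (auto simp: V_def)
    have "(SUP k. f k) \<le> emeasure \<nu> V"
      unfolding E(3) using V(1) by (intro SUP_least emeasure_mono) (auto simp: V_def)
    then have "emeasure \<nu> (D i) \<le> emeasure \<nu> V" by (simp add: eq f(2))
    moreover have "emeasure \<nu> V \<le> emeasure \<nu> (D i)"
      using V Di by (intro emeasure_mono) auto
    ultimately have "emeasure \<nu> (D i - V) = 0"
      using V Di D(3)[of i] by (subst emeasure_Diff) (auto simp: top_unique)
    with V show ?thesis by blast
  qed
  then obtain V where V: "\<And>i. V i \<in> sets \<nu>" "\<And>i. V i \<subseteq> D i - {zero_path}"
    "\<And>i. emeasure \<nu> (D i - V i) = 0" by metis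
  define U where "U = space \<nu> - (\<Union>i. V i)"
  have "U \<in> sets cyl" using V(1) by (auto simp: U_def s[symmetric])
  moreover have "zero_path \<in> U" using V(2) by (auto simp: U_def sp)
  moreover have "emeasure \<nu> U = 0"
  proof -
    have "(\<Union>i. D i - V i) \<in> null_sets \<nu>"
      using V D(1) by (intro null_sets_UN) (auto simp: null_sets_def)
    moreover have "U \<subseteq> (\<Union>i. D i - V i)" using D(2) by (auto simp: U_def)
    ultimately have "emeasure \<nu> U \<le> 0"
      using emeasure_mono[of U "\<Union>i. D i - V i" \<nu>] by (auto simp: null_sets_def)
    then show ?thesis by simp
  qed
  ultimately show ?thesis by blast
qed

lemma e2ennreal_ereal_mult: "e2ennreal (ereal a * enn2ereal m) = ennreal a * m"
proof (cases "a \<ge> 0")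
  case True
  then have "ereal a * enn2ereal m = enn2ereal (ennreal a * m)"
    by (simp add: times_ennreal.rep_eq)
  then show ?thesis by simp
next
  case False
  then have "ereal a * enn2ereal m \<le> 0"
    by (intro ereal_mult_le_0_iff[THEN iffD2]) auto
  with False show ?thesis by (simp add: e2ennreal_neg ennreal_neg)
qed

lemma expectation_identityI:
  assumes [measurable]: "u \<in> borel_measurable M" "v \<in> borel_measurable M"
      "m \<in> borel_measurable M" "k \<in> borel_measurable M"
    and pos: "(\<integral>\<^sup>+\<omega>. ennreal (u \<omega>) * m \<omega> \<partial>M) = (\<integral>\<^sup>+\<omega>. ennreal (v \<omega>) * k \<omega> \<partial>M)"
    and neg: "(\<integral>\<^sup>+\<omega>. ennreal (- u \<omega>) * m \<omega> \<partial>M) = (\<integral>\<^sup>+\<omega>. ennreal (- v \<omega>) * k \<omega> \<partial>M)"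
  shows "expectation_identity M (\<lambda>\<omega>. ereal (u \<omega>) * enn2ereal (m \<omega>)) (\<lambda>\<omega>. ereal (v \<omega>) * enn2ereal (k \<omega>))"
proof -
  have *: "- (ereal a * enn2ereal x) = ereal (- a) * enn2ereal x" for a x
    by (simp flip: uminus_ereal.simps(1))
  show ?thesis
    unfolding expectation_identity_def expectation_exists_def ext_expectation_def
      * e2ennreal_ereal_mult pos neg
    by simp
qed

lemma emeasure_law:
  assumes V: "sample_path V \<in> measurable M cyl" and A: "A \<in> sets cyl"
  shows "emeasure (law M V) A = (\<integral>\<^sup>+\<omega>. indicator A (\<lambda>t. V t \<omega>) \<partial>M)"
  using nn_integral_distr[OF V, of "indicator A"] A by (simp add: law_def)

text \<open>
  Both parts of the theorem are instances: the law of \<open>Z\<close> is \<open>q \<nu> + c \<delta>\<^sub>0\<close> with \<open>c = 0\<close> or \<open>c = q(0)\<close>. The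
  statements about \<open>Y\<close> instead of \<open>X\<close> are the instance \<open>G = 0\<close>.
\<close>
locale shifted_process = prm_space M \<nu> N
  for M :: "'w measure" and \<nu> :: "('t \<Rightarrow> real) measure" and N :: "('t \<Rightarrow> real) set \<Rightarrow> 'w \<Rightarrow> ennreal" +
  fixes X G Y Z :: "'t \<Rightarrow> 'w \<Rightarrow> real" and q :: "('t \<Rightarrow> real) \<Rightarrow> ennreal" and Nq :: "'w \<Rightarrow> ennreal" and c :: ennreal
  assumes sets_\<nu> [measurable_cong]: "sets \<nu> = sets cyl"
    and X_eq: "\<And>t \<omega>. \<omega> \<in> space M \<Longrightarrow> X t \<omega> = G t \<omega> + Y t \<omega>"
    and G: "stoch_process M G" and Y: "stoch_process M Y" and Z: "stoch_process M Z"
    and GNZ: "independent_GNZ M \<nu> G N Z"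
    and Y_shift: "\<And>t. point_additive (Y t) (\<lambda>x. x t)"
    and q [measurable]: "q \<in> borel_measurable cyl"
    and Nq: "prm_nn_integral M \<nu> N q Nq"
    and law_Z: "\<And>g. g \<in> borel_measurable cyl \<Longrightarrow>
      (\<integral>\<^sup>+\<omega>. g (\<lambda>t. Z t \<omega>) \<partial>M) = (\<integral>\<^sup>+x. q x * g x \<partial>\<nu>) + c * g zero_path"
begin

lemmas [measurable] = sample_path_measurable[OF G] sample_path_measurable[OF Y] sample_path_measurable[OF Z]

lemma X_measurable [measurable]: "sample_path X \<in> measurable M cyl"
proof -
  have "(\<lambda>\<omega> t. G t \<omega> + Y t \<omega>) \<in> measurable M cyl" by measurable
  then show ?thesis by (rule measurable_cong[THEN iffD1, rotated]) (simp add: X_eq)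
qed

lemma Nq_measurable [measurable]: "Nq \<in> borel_measurable M"
  using Nq by (simp add: prm_nn_integral_def)

text \<open>
  The process is replaced by functionals \<open>\<Phi> t\<close> of the configuration, simultaneously at the countably many
  times on which \<open>F\<close> depends. The free path \<open>z\<close> in the first almost sure statement makes it applicable with
  \<open>z = 0\<close> as well as with the values of \<open>Z\<close>.
\<close>
lemma shift_functional:
  assumes F [measurable]: "F \<in> borel_measurable cyl"
  obtains \<Phi> \<Psi> where
    "(\<lambda>\<xi> t. \<Phi> t \<xi>) \<in> measurable configs cyl" "\<Psi> \<in> borel_measurable configs"
    "AE \<omega> in M. \<forall>z. F (\<lambda>t. G t \<omega> + \<Phi> t (config \<omega>) + z t) = (F (\<lambda>t. X t \<omega> + z t) :: ennreal)"
    "AE \<omega> in M. \<Psi> (config \<omega>) = Nq \<omega>"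
    "AE \<omega> in M. AE z in \<nu>. F (\<lambda>t. G t \<omega> + \<Phi> t (add_point (config \<omega>) z)) = F (\<lambda>t. X t \<omega> + z t)
        \<and> \<Psi> (add_point (config \<omega>) z) = Nq \<omega> + q z"
proof -
  obtain J where J: "countable J" "\<And>x y. (\<And>t. t \<in> J \<Longrightarrow> x t = y t) \<Longrightarrow> F x = F y"
    by (rule countable_coordinates[OF F]) blast
  have "\<forall>t. \<exists>\<Phi>. \<Phi> \<in> borel_measurable configs \<and> (AE \<omega> in M. \<Phi> (config \<omega>) = Y t \<omega>)
     \<and> (AE \<omega> in M. AE z in \<nu>. \<Phi> (add_point (config \<omega>) z) = Y t \<omega> + z t)"
    by (rule allI, rule point_additiveE[OF Y_shift]) blast
  from choice[OF this] obtain \<Phi> where \<Phi>': "\<forall>t. \<Phi> t \<in> borel_measurable configs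
     \<and> (AE \<omega> in M. \<Phi> t (config \<omega>) = Y t \<omega>)
     \<and> (AE \<omega> in M. AE z in \<nu>. \<Phi> t (add_point (config \<omega>) z) = Y t \<omega> + z t)" ..
  have \<Phi>: "\<Phi> t \<in> borel_measurable configs" "AE \<omega> in M. \<Phi> t (config \<omega>) = Y t \<omega>"
    "AE \<omega> in M. AE z in \<nu>. \<Phi> t (add_point (config \<omega>) z) = Y t \<omega> + z t" for t
    using \<Phi>' by simp_all
  obtain \<Psi> where \<Psi>: "\<Psi> \<in> borel_measurable configs" "AE \<omega> in M. \<Psi> (config \<omega>) = Nq \<omega>"
    "AE \<omega> in M. AE z in \<nu>. \<Psi> (add_point (config \<omega>) z) = Nq \<omega> + q z"
    by (rule point_additiveE[OF point_additive_nn_integral[OF Nq]])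
  have all: "AE \<omega> in M. \<forall>t\<in>J. \<Phi> t (config \<omega>) = Y t \<omega>"
    "AE \<omega> in M. \<forall>t\<in>J. AE z in \<nu>. \<Phi> t (add_point (config \<omega>) z) = Y t \<omega> + z t"
    using \<Phi>(2,3) by (simp_all add: AE_ball_countable J(1))
  show ?thesis
  proof (rule that)
    show "(\<lambda>\<xi> t. \<Phi> t \<xi>) \<in> measurable configs cyl"
      using \<Phi>(1) by (intro measurable_PiM_single') auto
    show "AE \<omega> in M. \<forall>z. F (\<lambda>t. G t \<omega> + \<Phi> t (config \<omega>) + z t) = F (\<lambda>t. X t \<omega> + z t)"
      using all(1) AE_space
    proof eventually_elim
      case (elim \<omega>)
      then show ?case by (intro allI J(2)) (simp add: X_eq)
    qed
    show "AE \<omega> in M. AE z in \<nu>. F (\<lambda>t. G t \<omega> + \<Phi> t (add_point (config \<omega>) z)) = F (\<lambda>t. X t \<omega> + z t)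
        \<and> \<Psi> (add_point (config \<omega>) z) = Nq \<omega> + q z"
      using all(2) \<Psi>(3) AE_space
    proof eventually_elim
      case (elim \<omega>)
      from elim(1) have "AE z in \<nu>. \<forall>t\<in>J. \<Phi> t (add_point (config \<omega>) z) = Y t \<omega> + z t"
        by (simp add: AE_ball_countable J(1))
      with elim(2) show ?case
      proof eventually_elim
        case (elim z)
        then show ?case using \<open>\<omega> \<in> space M\<close>
          by (auto intro!: J(2) simp: X_eq)
      qed
    qed
  qed (fact \<Psi>(1,2))+
qed

text \<open>
  The heart of the matter: weighting by \<open>N(q)\<close> has the same effect as adding a path \<open>z\<close> drawn from \<open>q \<nu>\<close> to \<open>X\<close>
  and \<open>q(z)\<close> to \<open>N(q)\<close>. The second component is carried along because the converse formula divides by it.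
\<close>
lemma mecke_process:
  assumes F [measurable]: "F \<in> borel_measurable cyl" and w [measurable]: "w \<in> borel_measurable borel"
  shows "(\<integral>\<^sup>+\<omega>. F (\<lambda>t. X t \<omega>) * w (Nq \<omega>) * Nq \<omega> \<partial>M)
      = (\<integral>\<^sup>+\<omega>. \<integral>\<^sup>+z. q z * (F (\<lambda>t. X t \<omega> + z t) * w (Nq \<omega> + q z)) \<partial>\<nu> \<partial>M)"
proof -
  obtain \<Phi> \<Psi> where [measurable]: "(\<lambda>\<xi> t. \<Phi> t \<xi>) \<in> measurable configs cyl" "\<Psi> \<in> borel_measurable configs"
    and 1: "AE \<omega> in M. \<forall>z. F (\<lambda>t. G t \<omega> + \<Phi> t (config \<omega>) + z t) = F (\<lambda>t. X t \<omega> + z t)"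
    and 2: "AE \<omega> in M. \<Psi> (config \<omega>) = Nq \<omega>"
    and 3: "AE \<omega> in M. AE z in \<nu>. F (\<lambda>t. G t \<omega> + \<Phi> t (add_point (config \<omega>) z)) = F (\<lambda>t. X t \<omega> + z t)
        \<and> \<Psi> (add_point (config \<omega>) z) = Nq \<omega> + q z"
    by (rule shift_functional[OF F])
  define H where "H p = F (\<lambda>t. fst p t + \<Phi> t (snd p)) * w (\<Psi> (snd p))" for p
  have [measurable]: "(\<lambda>p t. \<Phi> t (snd p)) \<in> measurable (cyl \<Otimes>\<^sub>M configs) cyl"
    by (rule measurable_compose[of snd _ configs "\<lambda>\<xi> t. \<Phi> t \<xi>"]) measurable
  have H: "H \<in> borel_measurable (cyl \<Otimes>\<^sub>M configs)"
    unfolding H_def by measurable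
  have "(\<integral>\<^sup>+\<omega>. F (\<lambda>t. X t \<omega>) * w (Nq \<omega>) * Nq \<omega> \<partial>M) = (\<integral>\<^sup>+\<omega>. H (\<lambda>t. G t \<omega>, config \<omega>) * Nq \<omega> \<partial>M)"
  proof (rule nn_integral_cong_AE, use 1 2 in eventually_elim)
    case (elim \<omega>)
    then show ?case using spec[OF elim(1), of "\<lambda>_. 0"] by (simp add: H_def)
  qed
  also have "\<dots> = (\<integral>\<^sup>+\<omega>. \<integral>\<^sup>+z. q z * H (\<lambda>t. G t \<omega>, add_point (config \<omega>) z) \<partial>\<nu> \<partial>M)"
    by (rule mecke_independent[OF Nq _ independent_GNZ_indep_maps(1)[OF GNZ G Z] H]) measurable
  also have "\<dots> = (\<integral>\<^sup>+\<omega>. \<integral>\<^sup>+z. q z * (F (\<lambda>t. X t \<omega> + z t) * w (Nq \<omega> + q z)) \<partial>\<nu> \<partial>M)"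
  proof (rule nn_integral_cong_AE, use 3 in eventually_elim)
    case (elim \<omega>)
    then have "AE z in \<nu>. q z * H (\<lambda>t. G t \<omega>, add_point (config \<omega>) z)
        = q z * (F (\<lambda>t. X t \<omega> + z t) * w (Nq \<omega> + q z))"
      by eventually_elim (simp add: H_def)
    then show ?case by (rule nn_integral_cong_AE)
  qed
  finally show ?thesis .
qed

lemma nn_integral_independent_shift:
  assumes F [measurable]: "F \<in> borel_measurable cyl" and w [measurable]: "w \<in> borel_measurable (borel \<Otimes>\<^sub>M cyl)"
  shows "(\<integral>\<^sup>+\<omega>. F (\<lambda>t. X t \<omega> + Z t \<omega>) * w (Nq \<omega>, \<lambda>t. Z t \<omega>) \<partial>M)
      = (\<integral>\<^sup>+\<omega>. \<integral>\<^sup>+z. q z * (F (\<lambda>t. X t \<omega> + z t) * w (Nq \<omega>, z)) \<partial>\<nu> \<partial>M)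
        + c * (\<integral>\<^sup>+\<omega>. F (\<lambda>t. X t \<omega>) * w (Nq \<omega>, zero_path) \<partial>M)"
proof -
  obtain \<Phi> \<Psi> where [measurable]: "(\<lambda>\<xi> t. \<Phi> t \<xi>) \<in> measurable configs cyl" "\<Psi> \<in> borel_measurable configs"
    and 1: "AE \<omega> in M. \<forall>z. F (\<lambda>t. G t \<omega> + \<Phi> t (config \<omega>) + z t) = F (\<lambda>t. X t \<omega> + z t)"
    and 2: "AE \<omega> in M. \<Psi> (config \<omega>) = Nq \<omega>"
    by (rule shift_functional[OF F])
  define H where "H p = F (\<lambda>t. fst (fst p) t + \<Phi> t (snd (fst p)) + snd p t) * w (\<Psi> (snd (fst p)), snd p)" for p
  have [measurable]: "(\<lambda>p t. \<Phi> t (snd (fst p))) \<in> measurable ((cyl \<Otimes>\<^sub>M configs) \<Otimes>\<^sub>M cyl) cyl"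
    by (rule measurable_compose[of "\<lambda>p. snd (fst p)" _ configs "\<lambda>\<xi> t. \<Phi> t \<xi>"]) measurable
  have H: "H \<in> borel_measurable ((cyl \<Otimes>\<^sub>M configs) \<Otimes>\<^sub>M cyl)"
    unfolding H_def by measurable
  have [measurable]: "(\<lambda>\<omega>. w (Nq \<omega>, zero_path)) \<in> borel_measurable M"
    by (rule measurable_compose[OF measurable_Pair[OF Nq_measurable measurable_const] w]) (simp add: space_PiM)
  have eq: "AE \<omega> in M. \<forall>z. H ((\<lambda>t. G t \<omega>, config \<omega>), z) = F (\<lambda>t. X t \<omega> + z t) * w (Nq \<omega>, z)"
    using 1 2 by eventually_elim (simp add: H_def)
  have "(\<integral>\<^sup>+\<omega>. F (\<lambda>t. X t \<omega> + Z t \<omega>) * w (Nq \<omega>, \<lambda>t. Z t \<omega>) \<partial>M)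
      = (\<integral>\<^sup>+\<omega>. H ((\<lambda>t. G t \<omega>, config \<omega>), \<lambda>t. Z t \<omega>) \<partial>M)"
  proof (rule nn_integral_cong_AE, use eq in eventually_elim)
    case (elim \<omega>)
    then show ?case by simp
  qed
  also have "\<dots> = (\<integral>\<^sup>+\<omega>. \<integral>\<^sup>+\<omega>'. H ((\<lambda>t. G t \<omega>, config \<omega>), \<lambda>t. Z t \<omega>') \<partial>M \<partial>M)"
    by (rule nn_integral_indep_maps[OF independent_GNZ_indep_maps(2)[OF GNZ G Z] H])
  also have "\<dots> = (\<integral>\<^sup>+\<omega>. \<integral>\<^sup>+\<omega>'. F (\<lambda>t. X t \<omega> + Z t \<omega>') * w (Nq \<omega>, \<lambda>t. Z t \<omega>') \<partial>M \<partial>M)"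
  proof (rule nn_integral_cong_AE, use eq in eventually_elim)
    case (elim \<omega>)
    then show ?case by simp
  qed
  also have "\<dots> = (\<integral>\<^sup>+\<omega>. (\<integral>\<^sup>+z. q z * (F (\<lambda>t. X t \<omega> + z t) * w (Nq \<omega>, z)) \<partial>\<nu>)
      + c * (F (\<lambda>t. X t \<omega>) * w (Nq \<omega>, zero_path)) \<partial>M)"
  proof (rule nn_integral_cong)
    fix \<omega>
    have [measurable]: "(\<lambda>z t. X t \<omega> + z t) \<in> measurable cyl cyl"
      by (rule path_add_measurable) (simp_all add: space_PiM)
    have [measurable]: "(\<lambda>z. w (Nq \<omega>, z)) \<in> borel_measurable cyl"
      by (rule measurable_compose[OF measurable_Pair1' w]) simp
    have "(\<lambda>z. F (\<lambda>t. X t \<omega> + z t) * w (Nq \<omega>, z)) \<in> borel_measurable cyl"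
      by measurable
    from law_Z[OF this]
    show "(\<integral>\<^sup>+\<omega>'. F (\<lambda>t. X t \<omega> + Z t \<omega>') * w (Nq \<omega>, \<lambda>t. Z t \<omega>') \<partial>M)
      = (\<integral>\<^sup>+z. q z * (F (\<lambda>t. X t \<omega> + z t) * w (Nq \<omega>, z)) \<partial>\<nu>)
      + c * (F (\<lambda>t. X t \<omega>) * w (Nq \<omega>, zero_path))" by simp
  qed
  also have "\<dots> = (\<integral>\<^sup>+\<omega>. \<integral>\<^sup>+z. q z * (F (\<lambda>t. X t \<omega> + z t) * w (Nq \<omega>, z)) \<partial>\<nu> \<partial>M)
      + (\<integral>\<^sup>+\<omega>. c * (F (\<lambda>t. X t \<omega>) * w (Nq \<omega>, zero_path)) \<partial>M)"
  proof (rule nn_integral_add)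
    show "(\<lambda>\<omega>. \<integral>\<^sup>+z. q z * (F (\<lambda>t. X t \<omega> + z t) * w (Nq \<omega>, z)) \<partial>\<nu>) \<in> borel_measurable M"
    proof (rule intensity.borel_measurable_nn_integral)
      have [measurable]: "(\<lambda>p t. X t (fst p)) \<in> measurable (M \<Otimes>\<^sub>M \<nu>) cyl"
        by (rule measurable_compose[OF measurable_fst X_measurable])
      show "(\<lambda>(\<omega>, z). q z * (F (\<lambda>t. X t \<omega> + z t) * w (Nq \<omega>, z))) \<in> borel_measurable (M \<Otimes>\<^sub>M \<nu>)"
        unfolding split_beta' by measurable
    qed
  qed measurable
  also have "(\<integral>\<^sup>+\<omega>. c * (F (\<lambda>t. X t \<omega>) * w (Nq \<omega>, zero_path)) \<partial>M)
      = c * (\<integral>\<^sup>+\<omega>. F (\<lambda>t. X t \<omega>) * w (Nq \<omega>, zero_path) \<partial>M)"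
    by (rule nn_integral_cmult) measurable
  finally show ?thesis .
qed

lemma nn_integral_shift:
  assumes F [measurable]: "F \<in> borel_measurable cyl"
  shows "(\<integral>\<^sup>+\<omega>. F (\<lambda>t. X t \<omega> + Z t \<omega>) \<partial>M) = (\<integral>\<^sup>+\<omega>. F (\<lambda>t. X t \<omega>) * (Nq \<omega> + c) \<partial>M)"
proof -
  have "(\<integral>\<^sup>+\<omega>. F (\<lambda>t. X t \<omega> + Z t \<omega>) \<partial>M)
      = (\<integral>\<^sup>+\<omega>. F (\<lambda>t. X t \<omega>) * Nq \<omega> \<partial>M) + c * (\<integral>\<^sup>+\<omega>. F (\<lambda>t. X t \<omega>) \<partial>M)"
    using nn_integral_independent_shift[OF F, of "\<lambda>_. 1"] mecke_process[OF F, of "\<lambda>_. 1"] by simp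
  also have "\<dots> = (\<integral>\<^sup>+\<omega>. F (\<lambda>t. X t \<omega>) * Nq \<omega> + c * F (\<lambda>t. X t \<omega>) \<partial>M)"
    by (simp add: nn_integral_add nn_integral_cmult)
  finally show ?thesis by (simp only: distrib_left mult.commute[of c])
qed

lemma Nq_finite: "AE \<omega> in M. Nq \<omega> + c < \<infinity>"
proof -
  have "(\<integral>\<^sup>+\<omega>. Nq \<omega> + c \<partial>M) = 1"
    using nn_integral_shift[of "\<lambda>_. 1"] by (simp add: emeasure_space_1)
  then show ?thesis
    using nn_integral_noteq_infinite[of "\<lambda>\<omega>. Nq \<omega> + c" M] by (simp add: less_top)
qed

text \<open>
  Apply \<open>mecke_process\<close> with \<open>w(s) = 1 / (s + c)\<close>: the part of the law of \<open>Z\<close> with density \<open>q\<close> contributes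
  \<open>F(X) N(q) / (N(q) + c)\<close> and the atom contributes \<open>F(X) c / (N(q) + c)\<close>, which together give \<open>F(X)\<close>, except on
  \<open>N(q) + c = 0\<close> where both vanish. The function \<open>r\<close> has to produce the denominator \<open>N(q) + q(z) + c\<close> on the
  first part but \<open>N(q) + c\<close> on the atom; this is what the set \<open>U\<close> accomplishes in the second part of the
  theorem.
\<close>
lemma nn_integral_unshift:
  assumes F [measurable]: "F \<in> borel_measurable cyl" and r [measurable]: "r \<in> borel_measurable cyl"
    and r_eq: "AE z in \<nu>. r z = q z + c" and r_0: "c \<noteq> 0 \<Longrightarrow> r zero_path = c"
  shows "(\<integral>\<^sup>+\<omega>. F (\<lambda>t. X t \<omega>) * indicator {\<omega>. Nq \<omega> + c > 0} \<omega> \<partial>M)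
      = (\<integral>\<^sup>+\<omega>. F (\<lambda>t. X t \<omega> + Z t \<omega>) * inverse (Nq \<omega> + r (\<lambda>t. Z t \<omega>)) \<partial>M)"
proof -
  have "(\<integral>\<^sup>+\<omega>. F (\<lambda>t. X t \<omega> + Z t \<omega>) * inverse (Nq \<omega> + r (\<lambda>t. Z t \<omega>)) \<partial>M)
      = (\<integral>\<^sup>+\<omega>. \<integral>\<^sup>+z. q z * (F (\<lambda>t. X t \<omega> + z t) * inverse (Nq \<omega> + r z)) \<partial>\<nu> \<partial>M)
        + c * (\<integral>\<^sup>+\<omega>. F (\<lambda>t. X t \<omega>) * inverse (Nq \<omega> + r zero_path) \<partial>M)"
    using nn_integral_independent_shift[OF F, of "\<lambda>p. inverse (fst p + r (snd p))"] by simp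
  also have "c * (\<integral>\<^sup>+\<omega>. F (\<lambda>t. X t \<omega>) * inverse (Nq \<omega> + r zero_path) \<partial>M)
      = c * (\<integral>\<^sup>+\<omega>. F (\<lambda>t. X t \<omega>) * inverse (Nq \<omega> + c) \<partial>M)"
    using r_0 by (cases "c = 0") auto
  also have "(\<integral>\<^sup>+\<omega>. \<integral>\<^sup>+z. q z * (F (\<lambda>t. X t \<omega> + z t) * inverse (Nq \<omega> + r z)) \<partial>\<nu> \<partial>M)
      = (\<integral>\<^sup>+\<omega>. \<integral>\<^sup>+z. q z * (F (\<lambda>t. X t \<omega> + z t) * inverse (Nq \<omega> + q z + c)) \<partial>\<nu> \<partial>M)"
  proof (rule nn_integral_cong)
    fix \<omega>
    have "AE z in \<nu>. q z * (F (\<lambda>t. X t \<omega> + z t) * inverse (Nq \<omega> + r z))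
        = q z * (F (\<lambda>t. X t \<omega> + z t) * inverse (Nq \<omega> + q z + c))"
      using r_eq by eventually_elim (simp add: add.assoc)
    then show "(\<integral>\<^sup>+z. q z * (F (\<lambda>t. X t \<omega> + z t) * inverse (Nq \<omega> + r z)) \<partial>\<nu>)
        = (\<integral>\<^sup>+z. q z * (F (\<lambda>t. X t \<omega> + z t) * inverse (Nq \<omega> + q z + c)) \<partial>\<nu>)"
      by (rule nn_integral_cong_AE)
  qed
  also have "\<dots> = (\<integral>\<^sup>+\<omega>. F (\<lambda>t. X t \<omega>) * inverse (Nq \<omega> + c) * Nq \<omega> \<partial>M)"
    using mecke_process[OF F, of "\<lambda>s. inverse (s + c)"] by simp
  also have "(\<integral>\<^sup>+\<omega>. F (\<lambda>t. X t \<omega>) * inverse (Nq \<omega> + c) * Nq \<omega> \<partial>M)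
        + c * (\<integral>\<^sup>+\<omega>. F (\<lambda>t. X t \<omega>) * inverse (Nq \<omega> + c) \<partial>M)
      = (\<integral>\<^sup>+\<omega>. F (\<lambda>t. X t \<omega>) * inverse (Nq \<omega> + c) * Nq \<omega> + c * (F (\<lambda>t. X t \<omega>) * inverse (Nq \<omega> + c)) \<partial>M)"
    by (simp add: nn_integral_add nn_integral_cmult)
  also have "\<dots> = (\<integral>\<^sup>+\<omega>. F (\<lambda>t. X t \<omega>) * indicator {\<omega>. Nq \<omega> + c > 0} \<omega> \<partial>M)"
  proof (rule nn_integral_cong_AE, use Nq_finite in eventually_elim)
    case (elim \<omega>)
    have "F (\<lambda>t. X t \<omega>) * inverse (Nq \<omega> + c) * Nq \<omega> + c * (F (\<lambda>t. X t \<omega>) * inverse (Nq \<omega> + c))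
        = F (\<lambda>t. X t \<omega>) * ((Nq \<omega> + c) * inverse (Nq \<omega> + c))"
      by (simp add: algebra_simps)
    also have "(Nq \<omega> + c) * inverse (Nq \<omega> + c) = indicator {\<omega>. Nq \<omega> + c > 0} \<omega>"
    proof (cases "Nq \<omega> + c = 0")
      case False
      then show ?thesis
        using elim ennreal_divide_self[of "Nq \<omega> + c"]
        by (simp add: divide_ennreal_def zero_less_iff_neq_zero del: add_eq_0_iff_both_eq_0)
    qed simp
    finally show ?case .
  qed
  finally show ?thesis by simp
qed

lemma expectation_shift:
  assumes F [measurable]: "F \<in> borel_measurable cyl"
  shows "expectation_identity M (\<lambda>\<omega>. ereal (F (\<lambda>t. X t \<omega> + Z t \<omega>)))
    (\<lambda>\<omega>. ereal (F (\<lambda>t. X t \<omega>)) * enn2ereal (Nq \<omega> + c))"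
proof -
  have "expectation_identity M (\<lambda>\<omega>. ereal (F (\<lambda>t. X t \<omega> + Z t \<omega>)) * enn2ereal 1)
    (\<lambda>\<omega>. ereal (F (\<lambda>t. X t \<omega>)) * enn2ereal (Nq \<omega> + c))"
    using nn_integral_shift[of "\<lambda>x. ennreal (F x)"] nn_integral_shift[of "\<lambda>x. ennreal (- F x)"]
    by (intro expectation_identityI) simp_all
  then show ?thesis by (simp add: one_ennreal.rep_eq)
qed

lemma expectation_unshift:
  assumes F [measurable]: "F \<in> borel_measurable cyl" and r [measurable]: "r \<in> borel_measurable cyl"
    and r_eq: "AE z in \<nu>. r z = q z + c" "c \<noteq> 0 \<Longrightarrow> r zero_path = c"
  shows "expectation_identity M (\<lambda>\<omega>. ereal (F (\<lambda>t. X t \<omega>) * indicator {\<omega>. Nq \<omega> + c > 0} \<omega>))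
    (\<lambda>\<omega>. ereal (F (\<lambda>t. X t \<omega> + Z t \<omega>)) * enn2ereal (inverse (Nq \<omega> + r (\<lambda>t. Z t \<omega>))))"
proof -
  have "expectation_identity M (\<lambda>\<omega>. ereal (F (\<lambda>t. X t \<omega>) * indicator {\<omega>. Nq \<omega> + c > 0} \<omega>) * enn2ereal 1)
    (\<lambda>\<omega>. ereal (F (\<lambda>t. X t \<omega> + Z t \<omega>)) * enn2ereal (inverse (Nq \<omega> + r (\<lambda>t. Z t \<omega>))))"
  proof (rule expectation_identityI)
    have *: "ennreal (a * indicator A \<omega>) = ennreal a * indicator A \<omega>"
      "ennreal (- (a * indicator A \<omega>)) = ennreal (- a) * indicator A \<omega>" for a A and \<omega> :: 'w
      by (simp_all add: indicator_def)
    show "(\<integral>\<^sup>+\<omega>. ennreal (F (\<lambda>t. X t \<omega>) * indicator {\<omega>. Nq \<omega> + c > 0} \<omega>) * 1 \<partial>M)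
      = (\<integral>\<^sup>+\<omega>. ennreal (F (\<lambda>t. X t \<omega> + Z t \<omega>)) * inverse (Nq \<omega> + r (\<lambda>t. Z t \<omega>)) \<partial>M)"
      using nn_integral_unshift[of "\<lambda>x. ennreal (F x)" r] r_eq by (simp add: *)
    show "(\<integral>\<^sup>+\<omega>. ennreal (- (F (\<lambda>t. X t \<omega>) * indicator {\<omega>. Nq \<omega> + c > 0} \<omega>)) * 1 \<partial>M)
      = (\<integral>\<^sup>+\<omega>. ennreal (- F (\<lambda>t. X t \<omega> + Z t \<omega>)) * inverse (Nq \<omega> + r (\<lambda>t. Z t \<omega>)) \<partial>M)"
      using nn_integral_unshift[of "\<lambda>x. ennreal (- F x)" r] r_eq by (simp add: *)
    have "(\<lambda>\<omega>. if Nq \<omega> + c > 0 then F (\<lambda>t. X t \<omega>) else 0) \<in> borel_measurable M"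
      by measurable
    moreover have "(\<lambda>\<omega>. if Nq \<omega> + c > 0 then F (\<lambda>t. X t \<omega>) else 0)
        = (\<lambda>\<omega>. F (\<lambda>t. X t \<omega>) * indicator {\<omega>. Nq \<omega> + c > 0} \<omega>)"
      by (auto simp: indicator_def)
    ultimately show "(\<lambda>\<omega>. F (\<lambda>t. X t \<omega>) * indicator {\<omega>. Nq \<omega> + c > 0} \<omega>) \<in> borel_measurable M"
      by (simp only:)
  qed measurable
  then show ?thesis by (simp add: one_ennreal.rep_eq)
qed

text \<open>
  By \<open>nn_integral_shift\<close> the law of the shifted process has density \<open>E[N(q) + c | X]\<close>, and \<open>N(q) + c\<close> is almost
  surely positive.
\<close>
lemma equivalent_laws:
  assumes pos: "c > 0 \<or> emeasure \<nu> {x \<in> space \<nu>. q x > 0} = \<infinity>"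
  shows "equivalent_measures (law M (\<lambda>t \<omega>. X t \<omega> + Z t \<omega>)) (law M X)"
proof -
  have Nq_pos: "AE \<omega> in M. Nq \<omega> + c > 0"
    using pos
  proof
    assume "emeasure \<nu> {x \<in> space \<nu>. q x > 0} = \<infinity>"
    from prm_nn_integral_pos[OF Nq this] show ?thesis
      by eventually_elim (simp add: add_pos_nonneg)
  next
    assume "c > 0"
    then show ?thesis by (intro AE_I2) (simp add: add_nonneg_pos)
  qed
  have XZ: "(\<lambda>\<omega> t. X t \<omega> + Z t \<omega>) \<in> measurable M cyl" by measurable
  have "emeasure (law M (\<lambda>t \<omega>. X t \<omega> + Z t \<omega>)) A = 0 \<longleftrightarrow> emeasure (law M X) A = 0"
    if A [measurable]: "A \<in> sets cyl" for A
  proof -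
    have "emeasure (law M (\<lambda>t \<omega>. X t \<omega> + Z t \<omega>)) A
        = (\<integral>\<^sup>+\<omega>. indicator A (\<lambda>t. X t \<omega> + Z t \<omega>) \<partial>M)"
      by (rule emeasure_law[OF XZ A])
    also have "\<dots> = (\<integral>\<^sup>+\<omega>. indicator A (\<lambda>t. X t \<omega>) * (Nq \<omega> + c) \<partial>M)"
      by (rule nn_integral_shift) measurable
    also have "\<dots> = 0 \<longleftrightarrow> (AE \<omega> in M. indicator A (\<lambda>t. X t \<omega>) * (Nq \<omega> + c) = 0)"
      by (rule nn_integral_0_iff_AE) measurable
    also have "\<dots> \<longleftrightarrow> (AE \<omega> in M. indicator A (\<lambda>t. X t \<omega>) = (0 :: ennreal))"
    proof
      assume "AE \<omega> in M. indicator A (\<lambda>t. X t \<omega>) * (Nq \<omega> + c) = 0"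
      then show "AE \<omega> in M. indicator A (\<lambda>t. X t \<omega>) = (0 :: ennreal)"
        using Nq_pos by eventually_elim (auto simp: indicator_def split: if_splits)
    next
      assume "AE \<omega> in M. indicator A (\<lambda>t. X t \<omega>) = (0 :: ennreal)"
      then show "AE \<omega> in M. indicator A (\<lambda>t. X t \<omega>) * (Nq \<omega> + c) = 0"
        by eventually_elim simp
    qed
    also have "\<dots> \<longleftrightarrow> (\<integral>\<^sup>+\<omega>. indicator A (\<lambda>t. X t \<omega>) \<partial>M) = 0"
      by (rule nn_integral_0_iff_AE[symmetric]) measurable
    also have "(\<integral>\<^sup>+\<omega>. indicator A (\<lambda>t. X t \<omega>) \<partial>M) = emeasure (law M X) A"
      by (rule emeasure_law[OF X_measurable A, symmetric])
    finally show ?thesis .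
  qed
  then show ?thesis
    by (auto simp: equivalent_measures_def absolutely_continuous_def null_sets_def law_def)
qed

end

lemma (in prob_space) independent_GNZ_zero:
  fixes G Z :: "'t \<Rightarrow> 'a \<Rightarrow> real"
  assumes "independent_GNZ M n G N Z" "stoch_process M G"
  shows "independent_GNZ M n (\<lambda>_ _. 0) N Z"
proof -
  have "gen_events M cyl (sample_path (\<lambda>_ _. 0) :: 'a \<Rightarrow> 't \<Rightarrow> real) \<subseteq> gen_events M cyl (sample_path G)"
  proof
    fix E assume "E \<in> gen_events M cyl (sample_path (\<lambda>_ _. 0) :: 'a \<Rightarrow> 't \<Rightarrow> real)"
    then have "E = {} \<or> E = space M"
      by (auto simp: gen_events_def split: if_splits)
    moreover have "{} \<in> gen_events M cyl (sample_path G)"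
      unfolding gen_events_def by (intro CollectI exI[of _ "{}"]) auto
    moreover have "space M \<in> gen_events M cyl (sample_path G)"
      unfolding gen_events_def by (intro CollectI exI[of _ "space (cyl :: ('t \<Rightarrow> real) measure)"] conjI sets.top) (auto simp: space_PiM)
    ultimately show "E \<in> gen_events M cyl (sample_path G)" by blast
  qed
  note sub = this
  show ?thesis
    unfolding independent_GNZ_def
  proof (rule indep_sets_mono_sets[OF assms(1)[unfolded independent_GNZ_def]])
    fix i :: nat assume "i \<in> {..<3}"
    then have "i = 0 \<or> i = 1 \<or> i = 2" by auto
    then show "[gen_events M cyl (sample_path (\<lambda>_ _. 0) :: 'a \<Rightarrow> 't \<Rightarrow> real),
        gen_events M (Pi\<^sub>M (sets n) (\<lambda>_. borel)) (\<lambda>\<omega>. \<lambda>A\<in>sets n. N A \<omega>), gen_events M cyl (sample_path Z)] ! i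
      \<subseteq> [gen_events M cyl (sample_path G),
        gen_events M (Pi\<^sub>M (sets n) (\<lambda>_. borel)) (\<lambda>\<omega>. \<lambda>A\<in>sets n. N A \<omega>), gen_events M cyl (sample_path Z)] ! i"
      using sub by (elim disjE) simp_all
  qed
qed

theorem theorem4p3:
  fixes M :: "'w measure"
    and X G Y Z :: "'t \<Rightarrow> 'w \<Rightarrow> real"
    and \<nu> :: "('t \<Rightarrow> real) measure"
    and N :: "('t \<Rightarrow> real) set \<Rightarrow> 'w \<Rightarrow> ennreal"
    and chi :: "real \<Rightarrow> real"
    and b :: "'t \<Rightarrow> real"
  assumes "prob_space M"
    and "cutoff_function chi"
    and "levy_measure \<nu>" and "sigma_finite_measure \<nu>"
    and "id_process M X"
    and "\<forall>t. \<forall>\<omega>\<in>space M. X t \<omega> = G t \<omega> + Y t \<omega>"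
    and "centered_gaussian_process M G"
    and "poissonian_id_process M chi \<nu> b Y"
    and "prob_space.indep_var M cyl (sample_path G) cyl (sample_path Y)"
    and "poisson_random_measure M \<nu> N"
    and "canonical_spectral_representation M chi \<nu> N b Y"
    and "stoch_process M Z"
    and "independent_GNZ M \<nu> G N Z"
  shows
    "(\<forall>q Nq. absolutely_continuous \<nu> (law M Z) \<and> is_RN_deriv \<nu> (law M Z) q
        \<and> prm_nn_integral M \<nu> N q Nq \<longrightarrow>
        (\<forall>F \<in> borel_measurable cyl.
           expectation_identity M
             (\<lambda>\<omega>. ereal (F (\<lambda>t. X t \<omega> + Z t \<omega>)))
             (\<lambda>\<omega>. ereal (F (\<lambda>t. X t \<omega>)) * enn2ereal (Nq \<omega>)))
      \<and> (\<forall>F \<in> borel_measurable cyl.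
           expectation_identity M
             (\<lambda>\<omega>. ereal (F (\<lambda>t. X t \<omega>) * indicator {\<omega>. Nq \<omega> > 0} \<omega>))
             (\<lambda>\<omega>. ereal (F (\<lambda>t. X t \<omega> + Z t \<omega>))
                    * enn2ereal (inverse (Nq \<omega> + q (\<lambda>t. Z t \<omega>)))))
      \<and> (emeasure \<nu> {x \<in> space \<nu>. q x > 0} = \<infinity> \<longrightarrow>
           equivalent_measures (law M (\<lambda>t \<omega>. Y t \<omega> + Z t \<omega>)) (law M Y)))
   \<and> (\<forall>q Nq. absolutely_continuous (add_measure \<nu> (return cyl zero_path)) (law M Z)
        \<and> is_RN_deriv (add_measure \<nu> (return cyl zero_path)) (law M Z) q
        \<and> prm_nn_integral M \<nu> N q Nq \<longrightarrow>
        (\<forall>F \<in> borel_measurable cyl.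
           expectation_identity M
             (\<lambda>\<omega>. ereal (F (\<lambda>t. X t \<omega> + Z t \<omega>)))
             (\<lambda>\<omega>. ereal (F (\<lambda>t. X t \<omega>)) * enn2ereal (Nq \<omega> + q zero_path)))
      \<and> (\<exists>U \<in> sets cyl. zero_path \<in> U \<and> emeasure \<nu> U = 0)
      \<and> (\<forall>U \<in> sets cyl. zero_path \<in> U \<and> emeasure \<nu> U = 0 \<longrightarrow>
          (\<forall>F \<in> borel_measurable cyl.
             expectation_identity M
               (\<lambda>\<omega>. ereal (F (\<lambda>t. X t \<omega>) * indicator {\<omega>. Nq \<omega> + q zero_path > 0} \<omega>))
               (\<lambda>\<omega>. ereal (F (\<lambda>t. X t \<omega> + Z t \<omega>))
                      * enn2ereal (inverse (Nq \<omega> + q (\<lambda>t. Z t \<omega>)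
                          + q zero_path * indicator (- U) (\<lambda>t. Z t \<omega>))))))
      \<and> (q zero_path > 0 \<or> emeasure \<nu> {x \<in> space \<nu>. q x > 0} = \<infinity> \<longrightarrow>
           equivalent_measures (law M (\<lambda>t \<omega>. Y t \<omega> + Z t \<omega>)) (law M Y)))"
proof -
  interpret prob_space M by fact
  interpret sigma_finite_measure \<nu> by fact
  interpret prm_space M \<nu> N
    by unfold_locales fact
  have sets_\<nu>: "sets \<nu> = sets cyl"
    using assms(3) by (simp add: levy_measure_def)
  have G: "stoch_process M G" and Y: "stoch_process M Y" and Z: "stoch_process M Z"
    using assms by (auto simp: centered_gaussian_process_def id_process_def poissonian_id_process_def)
  have Y_shift: "point_additive (Y t) (\<lambda>x. x t)" for t
  proof -
    have "prm_compensated_integral M \<nu> N chi (\<lambda>x. x t) (\<lambda>\<omega>. Y t \<omega> - b t)"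
      using assms(11) by (simp add: canonical_spectral_representation_def)
    from point_additive_affine[OF point_additive_compensated_integral[OF this], of 1 "b t"]
    show ?thesis by simp
  qed
  have Z_law: "(\<integral>\<^sup>+\<omega>. g (\<lambda>t. Z t \<omega>) \<partial>M) = (\<integral>\<^sup>+x. g x \<partial>law M Z)"
    if "g \<in> borel_measurable cyl" for g :: "('t \<Rightarrow> real) \<Rightarrow> ennreal"
    using nn_integral_distr[OF sample_path_measurable[OF Z], of g] that by (simp add: law_def)
  have shifted: "shifted_process M \<nu> N X G Y Z q Nq c" "shifted_process M \<nu> N Y (\<lambda>_ _. 0) Y Z q Nq c"
    if "q \<in> borel_measurable cyl" "prm_nn_integral M \<nu> N q Nq"
      "\<And>g. g \<in> borel_measurable cyl \<Longrightarrow>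
        (\<integral>\<^sup>+\<omega>. g (\<lambda>t. Z t \<omega>) \<partial>M) = (\<integral>\<^sup>+x. q x * g x \<partial>\<nu>) + c * g zero_path"
    for q Nq c
  proof -
    have "stoch_process M (\<lambda>_ _. 0)" by (simp add: stoch_process_def)
    then show "shifted_process M \<nu> N X G Y Z q Nq c" "shifted_process M \<nu> N Y (\<lambda>_ _. 0) Y Z q Nq c"
      using that assms(6,13) sets_\<nu> G Y Z Y_shift independent_GNZ_zero[OF assms(13) G]
      by (unfold_locales; simp)+
  qed
  show ?thesis
  proof (intro conjI allI impI)
    fix q Nq
    assume *: "absolutely_continuous \<nu> (law M Z) \<and> is_RN_deriv \<nu> (law M Z) q \<and> prm_nn_integral M \<nu> N q Nq"
    have q: "q \<in> borel_measurable cyl"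
      using * measurable_cong_sets[OF sets_\<nu> refl] by (auto simp: is_RN_deriv_def)
    have law: "(\<integral>\<^sup>+\<omega>. g (\<lambda>t. Z t \<omega>) \<partial>M) = (\<integral>\<^sup>+x. q x * g x \<partial>\<nu>) + 0 * g zero_path"
      if g: "g \<in> borel_measurable cyl" for g
    proof -
      have "law M Z = density \<nu> q" using * by (simp add: is_RN_deriv_def)
      then show ?thesis
        using q g by (simp add: Z_law[OF g] nn_integral_density measurable_cong_sets[OF sets_\<nu> refl])
    qed
    have Nq: "prm_nn_integral M \<nu> N q Nq" using * by simp
    interpret X: shifted_process M \<nu> N X G Y Z q Nq 0 by (rule shifted(1)[OF q Nq law])
    interpret Y: shifted_process M \<nu> N Y "\<lambda>_ _. 0" Y Z q Nq 0 by (rule shifted(2)[OF q Nq law])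
    show "\<forall>F \<in> borel_measurable cyl. expectation_identity M
             (\<lambda>\<omega>. ereal (F (\<lambda>t. X t \<omega> + Z t \<omega>)))
             (\<lambda>\<omega>. ereal (F (\<lambda>t. X t \<omega>)) * enn2ereal (Nq \<omega>))"
      using X.expectation_shift by simp
    show "\<forall>F \<in> borel_measurable cyl. expectation_identity M
             (\<lambda>\<omega>. ereal (F (\<lambda>t. X t \<omega>) * indicator {\<omega>. Nq \<omega> > 0} \<omega>))
             (\<lambda>\<omega>. ereal (F (\<lambda>t. X t \<omega> + Z t \<omega>)) * enn2ereal (inverse (Nq \<omega> + q (\<lambda>t. Z t \<omega>))))"
      using X.expectation_unshift[OF _ q] by simp
    show "equivalent_measures (law M (\<lambda>t \<omega>. Y t \<omega> + Z t \<omega>)) (law M Y)"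
      if "emeasure \<nu> {x \<in> space \<nu>. q x > 0} = \<infinity>"
      using Y.equivalent_laws that by simp
  next
    show "\<exists>U \<in> sets cyl. zero_path \<in> U \<and> emeasure \<nu> U = 0"
      by (rule levy_measure_null_set_at_zero) fact+
  next
    fix q Nq
    assume *: "absolutely_continuous (add_measure \<nu> (return cyl zero_path)) (law M Z)
        \<and> is_RN_deriv (add_measure \<nu> (return cyl zero_path)) (law M Z) q
        \<and> prm_nn_integral M \<nu> N q Nq"
    have s: "sets (add_measure \<nu> (return cyl zero_path)) = sets cyl" by (simp add: sets_\<nu>)
    have q: "q \<in> borel_measurable cyl"
      using * measurable_cong_sets[OF s refl] by (auto simp: is_RN_deriv_def)
    have law: "(\<integral>\<^sup>+\<omega>. g (\<lambda>t. Z t \<omega>) \<partial>M) = (\<integral>\<^sup>+x. q x * g x \<partial>\<nu>) + q zero_path * g zero_path"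
      if g [measurable]: "g \<in> borel_measurable cyl" for g
    proof -
      note [measurable] = q
      have "law M Z = density (add_measure \<nu> (return cyl zero_path)) q" using * by (simp add: is_RN_deriv_def)
      then have "(\<integral>\<^sup>+\<omega>. g (\<lambda>t. Z t \<omega>) \<partial>M) = (\<integral>\<^sup>+x. q x * g x \<partial>add_measure \<nu> (return cyl zero_path))"
        using q g by (simp add: Z_law[OF g] nn_integral_density measurable_cong_sets[OF s refl])
      also have "\<dots> = (\<integral>\<^sup>+x. q x * g x \<partial>\<nu>) + (\<integral>\<^sup>+x. q x * g x \<partial>return cyl zero_path)"
      proof (rule nn_integral_add_measure)
        have "(\<lambda>x. q x * g x) \<in> borel_measurable cyl" by measurable
        then show "(\<lambda>x. q x * g x) \<in> borel_measurable \<nu>"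
          using measurable_cong_sets[OF sets_\<nu> refl] by blast
      qed (simp add: sets_\<nu>)
      also have "(\<integral>\<^sup>+x. q x * g x \<partial>return cyl zero_path) = q zero_path * g zero_path"
        by (rule nn_integral_return) (simp_all add: space_PiM)
      finally show ?thesis .
    qed
    have Nq: "prm_nn_integral M \<nu> N q Nq" using * by simp
    interpret X: shifted_process M \<nu> N X G Y Z q Nq "q zero_path" by (rule shifted(1)[OF q Nq law])
    interpret Y: shifted_process M \<nu> N Y "\<lambda>_ _. 0" Y Z q Nq "q zero_path" by (rule shifted(2)[OF q Nq law])
    show "\<forall>F \<in> borel_measurable cyl. expectation_identity M
             (\<lambda>\<omega>. ereal (F (\<lambda>t. X t \<omega> + Z t \<omega>)))
             (\<lambda>\<omega>. ereal (F (\<lambda>t. X t \<omega>)) * enn2ereal (Nq \<omega> + q zero_path))"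
      using X.expectation_shift by simp
    show "equivalent_measures (law M (\<lambda>t \<omega>. Y t \<omega> + Z t \<omega>)) (law M Y)"
      if "q zero_path > 0 \<or> emeasure \<nu> {x \<in> space \<nu>. q x > 0} = \<infinity>"
      by (rule Y.equivalent_laws[OF that])
    show "\<forall>U \<in> sets cyl. zero_path \<in> U \<and> emeasure \<nu> U = 0 \<longrightarrow>
          (\<forall>F \<in> borel_measurable cyl.
             expectation_identity M
               (\<lambda>\<omega>. ereal (F (\<lambda>t. X t \<omega>) * indicator {\<omega>. Nq \<omega> + q zero_path > 0} \<omega>))
               (\<lambda>\<omega>. ereal (F (\<lambda>t. X t \<omega> + Z t \<omega>))
                      * enn2ereal (inverse (Nq \<omega> + q (\<lambda>t. Z t \<omega>)
                          + q zero_path * indicator (- U) (\<lambda>t. Z t \<omega>)))))"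
    proof (intro ballI impI)
      fix U and F :: "('t \<Rightarrow> real) \<Rightarrow> real"
      assume U [measurable]: "U \<in> sets cyl" and U0: "zero_path \<in> U \<and> emeasure \<nu> U = 0"
        and F: "F \<in> borel_measurable cyl"
      \<comment> \<open>The measure \<open>\<nu>\<close> does not charge \<open>U\<close>, while the atom of the law of \<open>Z\<close> sits inside \<open>U\<close>.\<close>
      define r where "r z = q z + q zero_path * indicator (- U) z" for z
      have "- U \<in> sets cyl"
        using sets.compl_sets[OF U] by (simp add: space_PiM Compl_eq_Diff_UNIV)
      then have r: "r \<in> borel_measurable cyl"
        unfolding r_def
        by (intro borel_measurable_add borel_measurable_times_ennreal q borel_measurable_const borel_measurable_indicator)
      have "AE z in \<nu>. z \<notin> U"
        using U0 U by (intro AE_not_in) (simp add: null_sets_def sets_\<nu>)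
      then have r_eq: "AE z in \<nu>. r z = q z + q zero_path"
        by eventually_elim (simp add: r_def)
      have r_0: "r zero_path = q zero_path"
        using U0 by (simp add: r_def)
      have r_Z: "Nq \<omega> + r (\<lambda>t. Z t \<omega>)
          = Nq \<omega> + q (\<lambda>t. Z t \<omega>) + q zero_path * indicator (- U) (\<lambda>t. Z t \<omega>)" for \<omega>
        by (simp only: r_def add.assoc)
      from X.expectation_unshift[OF F r r_eq r_0]
      show "expectation_identity M
               (\<lambda>\<omega>. ereal (F (\<lambda>t. X t \<omega>) * indicator {\<omega>. Nq \<omega> + q zero_path > 0} \<omega>))
               (\<lambda>\<omega>. ereal (F (\<lambda>t. X t \<omega> + Z t \<omega>))
                      * enn2ereal (inverse (Nq \<omega> + q (\<lambda>t. Z t \<omega>)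
                          + q zero_path * indicator (- U) (\<lambda>t. Z t \<omega>))))"
        by (simp only: r_Z)
    qed
  qed
qed

end
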